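(* Let $R$ be a commutative ring and let $A$ be a Frobenius $R$-algebra (finitely generated projective over $R$), with Casimir ideal $c(A)\subseteq\mathcal{Z}(A)$. Then the separability locus of $A$ is $$\operatorname{Spec}R\setminus V(c(A)\cap R)=\{\mathfrak{p}\in\operatorname{Spec}R\mid\mathfrak{p}\nsupseteq c(A)\cap R\}.$$
   Context: An $R$-algebra $A$, finitely generated projective over $R$, is Frobenius if there is an $R$-bilinear form $\beta\colon A\times A\to R$ that is associative ($\beta(xy,z)=\beta(x,yz)$) and nonsingular ($a\mapsto\beta(a,\cdot)$ is an isomorphism $A\to\operatorname{Hom}_R(A,R)$). Dual bases for $\beta$ are finite families $\{x_i\}_1^n,\{y_i\}_1^n\subseteq A$ with $a=\sum_i\beta(a,y_i)x_i$ for all $a\in A$; they exist. The Casimir operator is the $\mathcal{Z}(A)$-linear map $c\colon A\to\mathcal{Z}(A)$, $c(a)=\sum_i y_i a x_i$ ($\mathcal{Z}(A)$ the center of $A$). Its image $c(A)$, the Casimir ideal, is an ideal of $\mathcal{Z}(A)$ that does not depend on the choice of $\beta$ or of the dual bases. $c(A)\cap R$ is the ideal of all $r\in R$ with $r\cdot 1_A\in c(A)$. The separability locus of $A$ is the set of all $\mathfrak{p}\in\operatorname{Spec}R$ such that the algebra $A\otimes_R Q(R/\mathfrak{p})$ over $Q(R/\mathfrak{p})$, the field of fractions of $R/\mathfrak{p}$, is separable (equivalently, the $R_{\mathfrak{p}}$-algebra $A\otimes_R R_{\mathfrak{p}}$ is separable). *)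

theory Defs
  imports "HOL-Algebra.QuotRing" "HOL-Algebra.Module" "HOL-Algebra.Free_Abelian_Groups"
begin

section \<open>Modules and algebras\<close>

text \<open>
  The locale \<^locale>\<open>algebra\<close> of the library requires a commutative algebra.  An algebra here
  is associative and unital, but not necessarily commutative.
\<close>

locale assoc_algebra = A?: ring A + module R A
  for R :: "('r, 'm) ring_scheme" and A :: "('r, 'a, 'n) module_scheme" (structure) +
  assumes smult_mult_left:
      "\<lbrakk>r \<in> carrier R; x \<in> carrier A; y \<in> carrier A\<rbrakk> \<Longrightarrow> (r \<odot> x) \<otimes> y = r \<odot> (x \<otimes> y)"
    and smult_mult_right:
      "\<lbrakk>r \<in> carrier R; x \<in> carrier A; y \<in> carrier A\<rbrakk> \<Longrightarrow> x \<otimes> (r \<odot> y) = r \<odot> (x \<otimes> y)"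

text \<open>
  The following notions are for left modules over a ring that need not be commutative, since they
  are applied to enveloping algebras.  Only the additive structure and the scalar multiplication
  of a module record are relevant.
\<close>

definition linear_maps ::
  "('r, 'l) ring_scheme \<Rightarrow> ('r, 'm, 'k) module_scheme \<Rightarrow> ('r, 'n, 'j) module_scheme \<Rightarrow> ('m \<Rightarrow> 'n) set"
  where "linear_maps R M N =
    {f \<in> carrier M \<rightarrow>\<^sub>E carrier N.
      (\<forall>x\<in>carrier M. \<forall>y\<in>carrier M. f (x \<oplus>\<^bsub>M\<^esub> y) = f x \<oplus>\<^bsub>N\<^esub> f y) \<and>
      (\<forall>r\<in>carrier R. \<forall>x\<in>carrier M. f (r \<odot>\<^bsub>M\<^esub> x) = r \<odot>\<^bsub>N\<^esub> f x)}"

definition regular_module :: "('r, 'l) ring_scheme \<Rightarrow> ('r, 'r) module"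
  where "regular_module R =
    \<lparr>carrier = carrier R, monoid.mult = monoid.mult R, one = \<one>\<^bsub>R\<^esub>, ring.zero = \<zero>\<^bsub>R\<^esub>, add = add R, smult = monoid.mult R\<rparr>"

definition free_module :: "('r, 'l) ring_scheme \<Rightarrow> 'i set \<Rightarrow> ('r, 'i \<Rightarrow> 'r) module"
  where "free_module R I =
    \<lparr>carrier = {f \<in> I \<rightarrow>\<^sub>E carrier R. finite {i \<in> I. f i \<noteq> \<zero>\<^bsub>R\<^esub>}},
     monoid.mult = undefined, one = undefined,
     ring.zero = (\<lambda>i\<in>I. \<zero>\<^bsub>R\<^esub>),
     add = (\<lambda>f g. \<lambda>i\<in>I. f i \<oplus>\<^bsub>R\<^esub> g i),
     smult = (\<lambda>r f. \<lambda>i\<in>I. r \<otimes>\<^bsub>R\<^esub> f i)\<rparr>"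

text \<open>
  A module is projective if it is a direct summand of (equivalently, a retract of) a free module.
  Index sets in the type of the elements of \<open>M\<close> suffice: \<open>M\<close> is a quotient of the free module on
  its carrier, and a projective \<open>M\<close> is a retract of every free module that maps onto it.
\<close>

definition projective_module :: "('r, 'l) ring_scheme \<Rightarrow> ('r, 'm, 'k) module_scheme \<Rightarrow> bool"
  where "projective_module R M \<longleftrightarrow>
    (\<exists>I :: 'm set. \<exists>s \<in> linear_maps R M (free_module R I). \<exists>p \<in> linear_maps R (free_module R I) M.
      \<forall>x\<in>carrier M. p (s x) = x)"

definition fin_gen_module :: "('r, 'l) ring_scheme \<Rightarrow> ('r, 'm, 'k) module_scheme \<Rightarrow> bool"
  where "fin_gen_module R M \<longleftrightarrow>
    (\<exists>X. finite X \<and> X \<subseteq> carrier M \<and>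
      (\<forall>m\<in>carrier M. \<exists>c\<in>X \<rightarrow> carrier R. m = (\<Oplus>\<^bsub>M\<^esub>x\<in>X. c x \<odot>\<^bsub>M\<^esub> x)))"


section \<open>Tensor products of algebras\<close>

text \<open>
  The ring \<open>\<int>[A \<times> B]\<close>: its additive group is the free abelian group on the pairs \<open>(a, b)\<close>, and
  the product of basis elements is given by \<open>(a, b) (a', b') = (a a', b b')\<close>.
\<close>

definition formal_mult ::
  "('a, 'm) ring_scheme \<Rightarrow> ('b, 'n) ring_scheme \<Rightarrow>
    ('a \<times> 'b \<Rightarrow>\<^sub>0 int) \<Rightarrow> ('a \<times> 'b \<Rightarrow>\<^sub>0 int) \<Rightarrow> ('a \<times> 'b \<Rightarrow>\<^sub>0 int)"
  where "formal_mult A B f g =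
    frag_extend (\<lambda>(a, b). frag_extend (\<lambda>(a', b'). frag_of (a \<otimes>\<^bsub>A\<^esub> a', b \<otimes>\<^bsub>B\<^esub> b')) g) f"

definition formal_ring ::
  "('a, 'm) ring_scheme \<Rightarrow> ('b, 'n) ring_scheme \<Rightarrow> ('a \<times> 'b \<Rightarrow>\<^sub>0 int) ring"
  where "formal_ring A B =
    \<lparr>carrier = carrier (free_Abelian_group (carrier A \<times> carrier B)),
     monoid.mult = formal_mult A B,
     one = frag_of (\<one>\<^bsub>A\<^esub>, \<one>\<^bsub>B\<^esub>),
     ring.zero = 0,
     add = (+)\<rparr>"

definition tensor_relations ::
  "('r, 'l) ring_scheme \<Rightarrow> ('r, 'a, 'm) module_scheme \<Rightarrow> ('r, 'b, 'n) module_scheme \<Rightarrow>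
    ('a \<times> 'b \<Rightarrow>\<^sub>0 int) set"
  where "tensor_relations R A B =
    {frag_of (a \<oplus>\<^bsub>A\<^esub> a', b) - frag_of (a, b) - frag_of (a', b) | a a' b.
        a \<in> carrier A \<and> a' \<in> carrier A \<and> b \<in> carrier B} \<union>
    {frag_of (a, b \<oplus>\<^bsub>B\<^esub> b') - frag_of (a, b) - frag_of (a, b') | a b b'.
        a \<in> carrier A \<and> b \<in> carrier B \<and> b' \<in> carrier B} \<union>
    {frag_of (r \<odot>\<^bsub>A\<^esub> a, b) - frag_of (a, r \<odot>\<^bsub>B\<^esub> b) | r a b.
        r \<in> carrier R \<and> a \<in> carrier A \<and> b \<in> carrier B}"

definition tensor_kernel ::
  "('r, 'l) ring_scheme \<Rightarrow> ('r, 'a, 'm) module_scheme \<Rightarrow> ('r, 'b, 'n) module_scheme \<Rightarrow>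
    ('a \<times> 'b \<Rightarrow>\<^sub>0 int) set"
  where "tensor_kernel R A B =
    generate (free_Abelian_group (carrier A \<times> carrier B)) (tensor_relations R A B)"

definition tensor_ring ::
  "('r, 'l) ring_scheme \<Rightarrow> ('r, 'a, 'm) module_scheme \<Rightarrow> ('r, 'b, 'n) module_scheme \<Rightarrow>
    ('a \<times> 'b \<Rightarrow>\<^sub>0 int) set ring"
  where "tensor_ring R A B = formal_ring A B Quot tensor_kernel R A B"

definition pure_tensor ::
  "('r, 'l) ring_scheme \<Rightarrow> ('r, 'a, 'm) module_scheme \<Rightarrow> ('r, 'b, 'n) module_scheme \<Rightarrow>
    'a \<Rightarrow> 'b \<Rightarrow> ('a \<times> 'b \<Rightarrow>\<^sub>0 int) set"
  where "pure_tensor R A B a b = tensor_kernel R A B +>\<^bsub>formal_ring A B\<^esub> frag_of (a, b)"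

text \<open>For a commutative \<open>R\<close>-algebra \<open>K\<close>, the tensor product of \<open>A\<close> and \<open>K\<close> as a \<open>K\<close>-algebra.\<close>

definition base_change ::
  "('r, 'l) ring_scheme \<Rightarrow> ('r, 'a, 'm) module_scheme \<Rightarrow> ('r, 'k, 'n) module_scheme \<Rightarrow>
    ('k, ('a \<times> 'k \<Rightarrow>\<^sub>0 int) set) module"
  where "base_change R A K =
    ring.extend (tensor_ring R A K)
      \<lparr>smult = (\<lambda>k X. pure_tensor R A K \<one>\<^bsub>A\<^esub> k \<otimes>\<^bsub>tensor_ring R A K\<^esub> X)\<rparr>"


section \<open>Separable algebras\<close>

definition opposite :: "('r, 'a, 'm) module_scheme \<Rightarrow> ('r, 'a, 'm) module_scheme"
  where "opposite A = A\<lparr>monoid.mult := (\<lambda>x y. y \<otimes>\<^bsub>A\<^esub> x)\<rparr>"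

definition enveloping_ring ::
  "('r, 'l) ring_scheme \<Rightarrow> ('r, 'a, 'm) module_scheme \<Rightarrow> ('a \<times> 'a \<Rightarrow>\<^sub>0 int) set ring"
  where "enveloping_ring R A = tensor_ring R A (opposite A)"

text \<open>\<open>A\<close> as a left module over its enveloping algebra, by \<open>(a \<otimes> b) z = a z b\<close>.\<close>

definition formal_action :: "('a, 'm) ring_scheme \<Rightarrow> ('a \<times> 'a \<Rightarrow>\<^sub>0 int) \<Rightarrow> 'a \<Rightarrow> 'a"
  where "formal_action A f z =
    (\<Oplus>\<^bsub>A\<^esub>p\<in>Poly_Mapping.keys f.
      [Poly_Mapping.lookup f p] \<cdot>\<^bsub>A\<^esub> (fst p \<otimes>\<^bsub>A\<^esub> z \<otimes>\<^bsub>A\<^esub> snd p))"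

definition enveloping_module ::
  "('r, 'a, 'm) module_scheme \<Rightarrow> (('a \<times> 'a \<Rightarrow>\<^sub>0 int) set, 'a) module"
  where "enveloping_module A =
    \<lparr>carrier = carrier A, monoid.mult = monoid.mult A, one = \<one>\<^bsub>A\<^esub>, ring.zero = \<zero>\<^bsub>A\<^esub>, add = add A,
     smult = (\<lambda>X z. THE w. \<exists>f\<in>X. w = formal_action A f z)\<rparr>"

definition separable_algebra :: "('r, 'l) ring_scheme \<Rightarrow> ('r, 'a, 'm) module_scheme \<Rightarrow> bool"
  where "separable_algebra R A \<longleftrightarrow>
    projective_module (enveloping_ring R A) (enveloping_module A)"


section \<open>Residue fields and the separability locus\<close>

definition fraction :: "('d, 'm) ring_scheme \<Rightarrow> 'd \<Rightarrow> 'd \<Rightarrow> ('d \<times> 'd) set"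
  where "fraction D a s =
    {(b, t). b \<in> carrier D \<and> t \<in> carrier D - {\<zero>\<^bsub>D\<^esub>} \<and> a \<otimes>\<^bsub>D\<^esub> t = b \<otimes>\<^bsub>D\<^esub> s}"

definition fraction_field :: "('d, 'm) ring_scheme \<Rightarrow> ('d \<times> 'd) set ring"
  where "fraction_field D =
    \<lparr>carrier = {fraction D a s | a s. a \<in> carrier D \<and> s \<in> carrier D - {\<zero>\<^bsub>D\<^esub>}},
     monoid.mult = (\<lambda>X Y. \<Union>(a, s)\<in>X. \<Union>(b, t)\<in>Y. fraction D (a \<otimes>\<^bsub>D\<^esub> b) (s \<otimes>\<^bsub>D\<^esub> t)),
     one = fraction D \<one>\<^bsub>D\<^esub> \<one>\<^bsub>D\<^esub>,
     ring.zero = fraction D \<zero>\<^bsub>D\<^esub> \<one>\<^bsub>D\<^esub>,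
     add = (\<lambda>X Y. \<Union>(a, s)\<in>X. \<Union>(b, t)\<in>Y.
       fraction D (a \<otimes>\<^bsub>D\<^esub> t \<oplus>\<^bsub>D\<^esub> b \<otimes>\<^bsub>D\<^esub> s) (s \<otimes>\<^bsub>D\<^esub> t))\<rparr>"

text \<open>The field of fractions of \<open>R/\<pp>\<close>, as a ring and as an \<open>R\<close>-algebra.\<close>

definition residue_field :: "('r, 'm) ring_scheme \<Rightarrow> 'r set \<Rightarrow> ('r set \<times> 'r set) set ring"
  where "residue_field R P = fraction_field (R Quot P)"

definition residue_algebra ::
  "('r, 'm) ring_scheme \<Rightarrow> 'r set \<Rightarrow> ('r, ('r set \<times> 'r set) set) module"
  where "residue_algebra R P =
    ring.extend (residue_field R P)
      \<lparr>smult = (\<lambda>r k. fraction (R Quot P) (P +>\<^bsub>R\<^esub> r) \<one>\<^bsub>R Quot P\<^esub> \<otimes>\<^bsub>residue_field R P\<^esub> k)\<rparr>"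

definition Spec :: "('r, 'm) ring_scheme \<Rightarrow> 'r set set"
  where "Spec R = {P. primeideal P R}"

definition vanishing_set :: "('r, 'm) ring_scheme \<Rightarrow> 'r set \<Rightarrow> 'r set set"
  where "vanishing_set R I = {P \<in> Spec R. I \<subseteq> P}"

definition separability_locus ::
  "('r, 'l) ring_scheme \<Rightarrow> ('r, 'a, 'm) module_scheme \<Rightarrow> 'r set set"
  where "separability_locus R A =
    {P \<in> Spec R. separable_algebra (residue_field R P) (base_change R A (residue_algebra R P))}"


section \<open>Frobenius algebras and the Casimir ideal\<close>

definition bilinear_form ::
  "('r, 'l) ring_scheme \<Rightarrow> ('r, 'a, 'm) module_scheme \<Rightarrow> ('a \<Rightarrow> 'a \<Rightarrow> 'r) \<Rightarrow> bool"
  where "bilinear_form R A \<beta> \<longleftrightarrow>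
    (\<forall>x\<in>carrier A. (\<lambda>y\<in>carrier A. \<beta> x y) \<in> linear_maps R A (regular_module R)) \<and>
    (\<forall>y\<in>carrier A. (\<lambda>x\<in>carrier A. \<beta> x y) \<in> linear_maps R A (regular_module R))"

text \<open>
  In the last condition, the map is linear by bilinearity, so that it is an isomorphism of
  modules if it is bijective.
\<close>

definition frobenius_form ::
  "('r, 'l) ring_scheme \<Rightarrow> ('r, 'a, 'm) module_scheme \<Rightarrow> ('a \<Rightarrow> 'a \<Rightarrow> 'r) \<Rightarrow> bool"
  where "frobenius_form R A \<beta> \<longleftrightarrow>
    bilinear_form R A \<beta> \<and>
    (\<forall>x\<in>carrier A. \<forall>y\<in>carrier A. \<forall>z\<in>carrier A. \<beta> (x \<otimes>\<^bsub>A\<^esub> y) z = \<beta> x (y \<otimes>\<^bsub>A\<^esub> z)) \<and>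
    bij_betw (\<lambda>a. \<lambda>x\<in>carrier A. \<beta> a x) (carrier A) (linear_maps R A (regular_module R))"

definition frobenius_algebra ::
  "('r, 'l) ring_scheme \<Rightarrow> ('r, 'a, 'm) module_scheme \<Rightarrow> bool"
  where "frobenius_algebra R A \<longleftrightarrow>
    assoc_algebra R A \<and> fin_gen_module R A \<and> projective_module R A \<and> (\<exists>\<beta>. frobenius_form R A \<beta>)"

definition dual_bases ::
  "('r, 'a, 'm) module_scheme \<Rightarrow> ('a \<Rightarrow> 'a \<Rightarrow> 'r) \<Rightarrow> nat \<Rightarrow> (nat \<Rightarrow> 'a) \<Rightarrow> (nat \<Rightarrow> 'a) \<Rightarrow> bool"
  where "dual_bases A \<beta> n x y \<longleftrightarrow>
    x \<in> {1..n} \<rightarrow> carrier A \<and> y \<in> {1..n} \<rightarrow> carrier A \<and>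
    (\<forall>a\<in>carrier A. a = (\<Oplus>\<^bsub>A\<^esub>i\<in>{1..n}. \<beta> a (y i) \<odot>\<^bsub>A\<^esub> x i))"

definition casimir_operator ::
  "('a, 'm) ring_scheme \<Rightarrow> nat \<Rightarrow> (nat \<Rightarrow> 'a) \<Rightarrow> (nat \<Rightarrow> 'a) \<Rightarrow> 'a \<Rightarrow> 'a"
  where "casimir_operator A n x y a = (\<Oplus>\<^bsub>A\<^esub>i\<in>{1..n}. y i \<otimes>\<^bsub>A\<^esub> a \<otimes>\<^bsub>A\<^esub> x i)"

text \<open>
  All Frobenius forms and all of their dual bases yield the same image of the Casimir operator,
  see \<open>casimir_ideal_eq\<close> below.  The definition avoids a choice by taking the union of
  these images; it is over a nonempty family for a Frobenius algebra, by \<open>dual_bases_exist\<close>.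
\<close>

definition casimir_ideal :: "('r, 'l) ring_scheme \<Rightarrow> ('r, 'a, 'm) module_scheme \<Rightarrow> 'a set"
  where "casimir_ideal R A =
    \<Union>{casimir_operator A n x y ` carrier A | \<beta> n x y. frobenius_form R A \<beta> \<and> dual_bases A \<beta> n x y}"

text \<open>The ideal \<open>J \<inter> R\<close> of \<open>R\<close>, where \<open>R\<close> need not be contained in \<open>A\<close>.\<close>

definition contraction :: "('r, 'l) ring_scheme \<Rightarrow> ('r, 'a, 'm) module_scheme \<Rightarrow> 'a set \<Rightarrow> 'r set"
  where "contraction R A J = {r \<in> carrier R. r \<odot>\<^bsub>A\<^esub> \<one>\<^bsub>A\<^esub> \<in> J}"

end

theory Submission
  imports Defs
begin

text \<open>
  Let \<open>\<beta>\<close> be a Frobenius form on \<open>A\<close> with dual bases \<open>x\<^sub>i, y\<^sub>i\<close>, and let \<open>tr(a) = \<beta>(a, 1)\<close>.  Associativity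
  and nonsingularity of \<open>\<beta>\<close> give two expansions, \<open>a = \<Sum> tr(a y\<^sub>i) x\<^sub>i\<close> and \<open>a = \<Sum> tr(x\<^sub>i a) y\<^sub>i\<close>.  A linear map \<open>tr\<close> with
  elements \<open>x\<^sub>i, y\<^sub>i\<close> that satisfy them (locale \<open>frobenius_trace\<close>) is a description of the form that
  passes at once to \<open>A \<otimes> K\<close> for every commutative \<open>R\<close>-algebra \<open>K\<close>.

  An algebra with such a trace is separable if and only if \<open>1\<close> is a value of the Casimir operator \<open>c\<close>, a criterion
  of Higman.  By \<open>casimir_invariance\<close>, \<open>\<Sum> z y\<^sub>i \<otimes> x\<^sub>i = \<Sum> y\<^sub>i \<otimes> x\<^sub>i z\<close>, so that \<open>c(a) = 1\<close> makes
  \<open>\<Sum> y\<^sub>i a \<otimes> x\<^sub>i\<close> a separability idempotent.  Conversely, if \<open>\<Sum> u\<^sub>j \<otimes> v\<^sub>j\<close> is a separability idempotent,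
  then \<open>a = \<Sum> tr(u\<^sub>j) v\<^sub>j\<close> has \<open>c(a) = 1\<close>.  The lemmas are \<open>separable_if_casimir_one\<close> and
  \<open>casimir_one_if_separable\<close>.

  The criterion is applied to \<open>A \<otimes> K\<close> over the residue field \<open>K\<close> of a prime ideal \<open>p\<close>.  If
  \<open>c(a) = r 1\<close> with \<open>r \<notin> p\<close>, then \<open>c(a \<otimes> r\<^sup>-\<^sup>1) = 1\<close>, and \<open>A \<otimes> K\<close> is separable.  If conversely
  \<open>c(u) = 1\<close> in \<open>A \<otimes> K\<close>, then \<open>u = a \<otimes> s\<^sup>-\<^sup>1\<close> with \<open>a \<in> A\<close> and \<open>s \<notin> p\<close>, so that \<open>n = s 1 - c(a)\<close> vanishes
  in \<open>A \<otimes> K\<close>.  The functionals \<open>tr(- y)\<close> detect that \<open>n A \<subseteq> p A\<close> (\<open>casimir_congruence\<close>), hence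
  \<open>s A \<subseteq> c(a) A + p A\<close>.  The Nakayama lemma at \<open>p\<close>, in the form \<open>nakayama_prime\<close> that avoids
  localization, yields \<open>q \<notin> p\<close> with \<open>q A \<subseteq> c(a) A\<close>; say \<open>q 1 = c(a) b\<close>.  As \<open>c(a)\<close> is central, \<open>q b\<close>
  is central too, and therefore \<open>q\<^sup>2 1 = c(a) (q b) = c(a q b)\<close> lies in the Casimir ideal
  (\<open>casimir_scalar_if_congruence\<close>).  So \<open>c(A) \<inter> R\<close> is not contained in \<open>p\<close>.
\<close>


section \<open>Sums and additive maps\<close>

lemma abelian_group_cong:
  assumes "abelian_group M" "carrier N = carrier M" "add N = add M" "\<zero>\<^bsub>N\<^esub> = \<zero>\<^bsub>M\<^esub>"
  shows "abelian_group N"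
proof -
  interpret M: abelian_group M by fact
  show ?thesis
  proof (rule abelian_groupI; unfold assms(2-4))
    fix x assume "x \<in> carrier M"
    then show "\<exists>y\<in>carrier M. y \<oplus>\<^bsub>M\<^esub> x = \<zero>\<^bsub>M\<^esub>"
      by (intro bexI[of _ "\<ominus>\<^bsub>M\<^esub> x"]) (simp_all add: M.l_neg)
  qed (simp_all add: M.a_ac)
qed

lemma additive_zero:
  assumes "abelian_group G" "abelian_group H"
    and "\<And>x. x \<in> carrier G \<Longrightarrow> h x \<in> carrier H"
    and "\<And>x y. x \<in> carrier G \<Longrightarrow> y \<in> carrier G \<Longrightarrow> h (x \<oplus>\<^bsub>G\<^esub> y) = h x \<oplus>\<^bsub>H\<^esub> h y"
  shows "h \<zero>\<^bsub>G\<^esub> = \<zero>\<^bsub>H\<^esub>"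
proof -
  interpret G: abelian_group G by fact
  interpret H: abelian_group H by fact
  have "h \<zero>\<^bsub>G\<^esub> \<oplus>\<^bsub>H\<^esub> h \<zero>\<^bsub>G\<^esub> = h \<zero>\<^bsub>G\<^esub>"
    using assms(4)[of "\<zero>\<^bsub>G\<^esub>" "\<zero>\<^bsub>G\<^esub>"] by simp
  moreover have "h \<zero>\<^bsub>G\<^esub> \<in> carrier H"
    using assms(3) by simp
  ultimately show ?thesis
    using H.add.l_cancel_one[of "h \<zero>\<^bsub>G\<^esub>" "h \<zero>\<^bsub>G\<^esub>"] by simp
qed

lemma additive_minus:
  assumes "abelian_group G" "abelian_group H"
    and "\<And>x. x \<in> carrier G \<Longrightarrow> h x \<in> carrier H"
    and "\<And>x y. x \<in> carrier G \<Longrightarrow> y \<in> carrier G \<Longrightarrow> h (x \<oplus>\<^bsub>G\<^esub> y) = h x \<oplus>\<^bsub>H\<^esub> h y"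
    and "x \<in> carrier G" "y \<in> carrier G"
  shows "h (x \<ominus>\<^bsub>G\<^esub> y) = h x \<ominus>\<^bsub>H\<^esub> h y"
proof -
  interpret G: abelian_group G by fact
  interpret H: abelian_group H by fact
  have "h x = h (x \<ominus>\<^bsub>G\<^esub> y) \<oplus>\<^bsub>H\<^esub> h y"
    using assms(4)[of "x \<ominus>\<^bsub>G\<^esub> y" y] assms(5,6) by (simp add: G.minus_eq G.a_assoc G.l_neg)
  then show ?thesis
    using assms(3)[of "x \<ominus>\<^bsub>G\<^esub> y"] assms(3)[of y] assms(5,6)
    by (simp add: H.minus_eq H.a_assoc H.r_neg)
qed

lemma additive_finsum:
  assumes "abelian_group G" "abelian_group H"
    and "\<And>x. x \<in> carrier G \<Longrightarrow> h x \<in> carrier H"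
    and "\<And>x y. x \<in> carrier G \<Longrightarrow> y \<in> carrier G \<Longrightarrow> h (x \<oplus>\<^bsub>G\<^esub> y) = h x \<oplus>\<^bsub>H\<^esub> h y"
    and "finite I" "f \<in> I \<rightarrow> carrier G"
  shows "h (\<Oplus>\<^bsub>G\<^esub>i\<in>I. f i) = (\<Oplus>\<^bsub>H\<^esub>i\<in>I. h (f i))"
proof -
  interpret G: abelian_group G by fact
  interpret H: abelian_group H by fact
  have zero: "h \<zero>\<^bsub>G\<^esub> = \<zero>\<^bsub>H\<^esub>"
    by (rule additive_zero[where h = h, OF assms(1-4)])
  show ?thesis
    using assms(5,6)
  proof (induction I rule: finite_induct)
    case empty
    then show ?case by (simp add: zero)
  next
    case (insert i I)
    then have "f i \<in> carrier G" "f \<in> I \<rightarrow> carrier G" by auto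
    moreover from this have "(\<lambda>j. h (f j)) \<in> I \<rightarrow> carrier H"
      using assms(3) by auto
    ultimately show ?case
      using insert.IH insert.hyps assms(3,4) by simp
  qed
qed

lemma (in abelian_group) finsum_swap:
  assumes "finite I" "finite J" "\<And>i j. i \<in> I \<Longrightarrow> j \<in> J \<Longrightarrow> f i j \<in> carrier G"
  shows "(\<Oplus>i\<in>I. \<Oplus>j\<in>J. f i j) = (\<Oplus>j\<in>J. \<Oplus>i\<in>I. f i j)"
  using assms(1,3)
proof (induction I rule: finite_induct)
  case empty
  then show ?case by simp
next
  case (insert i I)
  have "(\<Oplus>j\<in>J. \<Oplus>i\<in>insert i I. f i j) = (\<Oplus>j\<in>J. f i j \<oplus> (\<Oplus>i\<in>I. f i j))"
    using insert by (intro add.finprod_cong') (auto intro!: finsum_closed)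
  also have "\<dots> = (\<Oplus>j\<in>J. f i j) \<oplus> (\<Oplus>j\<in>J. \<Oplus>i\<in>I. f i j)"
    using insert by (intro finsum_addf) (auto intro!: finsum_closed)
  finally show ?case
    using insert by (simp add: Pi_iff)
qed

text \<open>
  The additive extension of \<open>\<phi>\<close> to formal sums.  It has the shape of \<open>formal_action\<close>, which is
  its instance for \<open>\<phi>(a, b) = a z b\<close>.
\<close>

definition frag_lift :: "('b, 'm) ring_scheme \<Rightarrow> ('a \<Rightarrow> 'b) \<Rightarrow> ('a \<Rightarrow>\<^sub>0 int) \<Rightarrow> 'b"
  where "frag_lift G \<phi> f = (\<Oplus>\<^bsub>G\<^esub>p\<in>Poly_Mapping.keys f. [Poly_Mapping.lookup f p] \<cdot>\<^bsub>G\<^esub> \<phi> p)"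

context abelian_group
begin

lemma frag_lift_superset:
  assumes "finite T" "Poly_Mapping.keys f \<subseteq> T" "\<phi> \<in> T \<rightarrow> carrier G"
  shows "frag_lift G \<phi> f = (\<Oplus>p\<in>T. [Poly_Mapping.lookup f p] \<cdot> \<phi> p)"
  unfolding frag_lift_def
  using assms
  by (intro add.finprod_mono_neutral_cong_left)
     (auto simp: in_keys_iff Pi_iff add_pow_def[where k = "0 :: int"])

lemma frag_lift_closed:
  assumes "Poly_Mapping.keys f \<subseteq> S" "\<phi> \<in> S \<rightarrow> carrier G"
  shows "frag_lift G \<phi> f \<in> carrier G"
  unfolding frag_lift_def using assms by (intro finsum_closed) (auto simp: Pi_iff)

lemma frag_lift_add:
  assumes "Poly_Mapping.keys f \<subseteq> S" "Poly_Mapping.keys g \<subseteq> S" "\<phi> \<in> S \<rightarrow> carrier G"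
  shows "frag_lift G \<phi> (f + g) = frag_lift G \<phi> f \<oplus> frag_lift G \<phi> g"
proof -
  define T where "T = Poly_Mapping.keys f \<union> Poly_Mapping.keys g"
  have T: "finite T" "T \<subseteq> S" "\<phi> \<in> T \<rightarrow> carrier G"
    using assms by (auto simp: T_def)
  have "Poly_Mapping.keys (f + g) \<subseteq> T"
    unfolding T_def by (rule keys_add)
  then have "frag_lift G \<phi> (f + g) =
      (\<Oplus>p\<in>T. [Poly_Mapping.lookup f p] \<cdot> \<phi> p \<oplus> [Poly_Mapping.lookup g p] \<cdot> \<phi> p)"
    using T by (subst frag_lift_superset[where T = T])
      (auto simp: Poly_Mapping.lookup_add add.int_pow_mult Pi_iff simp del: add.finprod_multf
        intro!: add.finprod_cong')
  also have "\<dots> = (\<Oplus>p\<in>T. [Poly_Mapping.lookup f p] \<cdot> \<phi> p) \<oplus> (\<Oplus>p\<in>T. [Poly_Mapping.lookup g p] \<cdot> \<phi> p)"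
    using T by (intro finsum_addf) (auto simp: Pi_iff)
  also have "\<dots> = frag_lift G \<phi> f \<oplus> frag_lift G \<phi> g"
    using T by (simp add: frag_lift_superset[where T = T] T_def)
  finally show ?thesis .
qed

lemma frag_lift_zero [simp]: "frag_lift G \<phi> 0 = \<zero>"
  by (simp add: frag_lift_def)

lemma frag_lift_diff:
  assumes "Poly_Mapping.keys f \<subseteq> S" "Poly_Mapping.keys g \<subseteq> S" "\<phi> \<in> S \<rightarrow> carrier G"
  shows "frag_lift G \<phi> (f - g) = frag_lift G \<phi> f \<ominus> frag_lift G \<phi> g"
proof -
  have k: "Poly_Mapping.keys (f - g) \<subseteq> S"
    using assms keys_diff[of f g] by auto
  have "frag_lift G \<phi> f = frag_lift G \<phi> (f - g) \<oplus> frag_lift G \<phi> g"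
    using frag_lift_add[OF k assms(2,3)] by simp
  then show ?thesis
    using frag_lift_closed[OF k assms(3)] frag_lift_closed[OF assms(2,3)]
    by (simp add: minus_eq a_assoc r_neg)
qed

lemma frag_lift_of:
  assumes "\<phi> p \<in> carrier G"
  shows "frag_lift G \<phi> (frag_of p) = \<phi> p"
  using assms by (simp add: frag_lift_def)

end


section \<open>The ring of formal sums\<close>

lemma formal_mult_add_left: "formal_mult A B (f + f') g = formal_mult A B f g + formal_mult A B f' g"
  by (simp add: formal_mult_def frag_extend_add)

lemma formal_mult_diff_left: "formal_mult A B (f - f') g = formal_mult A B f g - formal_mult A B f' g"
  by (simp add: formal_mult_def frag_extend_diff)

lemma formal_mult_zero_left [simp]: "formal_mult A B 0 g = 0"
  by (simp add: formal_mult_def)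

lemma formal_mult_of_left:
  "formal_mult A B (frag_of (a, b)) g = frag_extend (\<lambda>(a', b'). frag_of (a \<otimes>\<^bsub>A\<^esub> a', b \<otimes>\<^bsub>B\<^esub> b')) g"
  by (simp add: formal_mult_def)

lemma formal_mult_diff_right: "formal_mult A B f (g - g') = formal_mult A B f g - formal_mult A B f g'"
proof -
  have "Poly_Mapping.keys f \<subseteq> UNIV" by simp
  then show ?thesis
  proof (induction f rule: frag_induction)
    case (one p)
    then show ?case by (cases p) (simp add: formal_mult_of_left frag_extend_diff)
  qed (auto simp: formal_mult_diff_left)
qed

lemma formal_mult_zero_right [simp]: "formal_mult A B f 0 = 0"
  using formal_mult_diff_right[of A B f 0 0] by simp

lemma formal_mult_add_right: "formal_mult A B f (g + g') = formal_mult A B f g + formal_mult A B f g'"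
  using formal_mult_diff_right[of A B f "g + g'" g'] by (simp add: algebra_simps)

lemma formal_mult_of [simp]:
  "formal_mult A B (frag_of (a, b)) (frag_of (a', b')) = frag_of (a \<otimes>\<^bsub>A\<^esub> a', b \<otimes>\<^bsub>B\<^esub> b')"
  by (simp add: formal_mult_of_left)

lemma carrier_formal_ring [simp]:
  "f \<in> carrier (formal_ring A B) \<longleftrightarrow> Poly_Mapping.keys f \<subseteq> carrier A \<times> carrier B"
  by (simp add: formal_ring_def)

lemma formal_ring_simps [simp]:
  "monoid.mult (formal_ring A B) = formal_mult A B"
  "add (formal_ring A B) = (+)"
  "\<zero>\<^bsub>formal_ring A B\<^esub> = 0"
  "\<one>\<^bsub>formal_ring A B\<^esub> = frag_of (\<one>\<^bsub>A\<^esub>, \<one>\<^bsub>B\<^esub>)"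
  by (simp_all add: formal_ring_def)

lemma formal_ring_induct [consumes 1, case_names zero pure diff]:
  assumes "Poly_Mapping.keys f \<subseteq> carrier A \<times> carrier B"
    and "P 0"
    and "\<And>a b. a \<in> carrier A \<Longrightarrow> b \<in> carrier B \<Longrightarrow> P (frag_of (a, b))"
    and "\<And>f g. Poly_Mapping.keys f \<subseteq> carrier A \<times> carrier B \<Longrightarrow>
          Poly_Mapping.keys g \<subseteq> carrier A \<times> carrier B \<Longrightarrow> P f \<Longrightarrow> P g \<Longrightarrow> P (f - g)"
  shows "P f"
  by (rule free_Abelian_group_induct[OF assms(1)]) (use assms in auto)

lemma keys_formal_mult:
  assumes "monoid A" "monoid B"
    and "Poly_Mapping.keys f \<subseteq> carrier A \<times> carrier B"
    and g: "Poly_Mapping.keys g \<subseteq> carrier A \<times> carrier B"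
  shows "Poly_Mapping.keys (formal_mult A B f g) \<subseteq> carrier A \<times> carrier B"
proof -
  interpret A: monoid A by fact
  interpret B: monoid B by fact
  show ?thesis
    using assms(3)
  proof (induction f rule: formal_ring_induct)
    case (pure a b)
    show ?case
      using g
    proof (induction g rule: formal_ring_induct)
      case (diff f g)
      then show ?case
        unfolding formal_mult_diff_right by (meson Un_least keys_diff order_trans)
    qed (use pure in auto)
  next
    case (diff f f')
    then show ?case
      unfolding formal_mult_diff_left by (meson Un_least keys_diff order_trans)
  qed simp
qed

lemma formal_mult_assoc:
  assumes "monoid A" "monoid B"
    and "Poly_Mapping.keys f \<subseteq> carrier A \<times> carrier B"
    and g: "Poly_Mapping.keys g \<subseteq> carrier A \<times> carrier B"
    and h: "Poly_Mapping.keys h \<subseteq> carrier A \<times> carrier B"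
  shows "formal_mult A B (formal_mult A B f g) h = formal_mult A B f (formal_mult A B g h)"
proof -
  interpret A: monoid A by fact
  interpret B: monoid B by fact
  show ?thesis
    using assms(3)
  proof (induction f rule: formal_ring_induct)
    case f: (pure a b)
    show ?case
      using g
    proof (induction g rule: formal_ring_induct)
      case g: (pure c d)
      show ?case
        using h
      proof (induction h rule: formal_ring_induct)
        case (pure u v)
        then show ?case using f g by (simp add: A.m_assoc B.m_assoc)
      qed (simp_all add: formal_mult_diff_right)
    qed (simp_all add: formal_mult_diff_right formal_mult_diff_left)
  qed (simp_all add: formal_mult_diff_left)
qed

lemma formal_mult_one:
  assumes "monoid A" "monoid B"
    and "Poly_Mapping.keys f \<subseteq> carrier A \<times> carrier B"
  shows "formal_mult A B (frag_of (\<one>\<^bsub>A\<^esub>, \<one>\<^bsub>B\<^esub>)) f = f"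
    and "formal_mult A B f (frag_of (\<one>\<^bsub>A\<^esub>, \<one>\<^bsub>B\<^esub>)) = f"
proof -
  interpret A: monoid A by fact
  interpret B: monoid B by fact
  show "formal_mult A B (frag_of (\<one>\<^bsub>A\<^esub>, \<one>\<^bsub>B\<^esub>)) f = f"
    using assms(3) by (induction f rule: formal_ring_induct) (simp_all add: formal_mult_diff_right)
  show "formal_mult A B f (frag_of (\<one>\<^bsub>A\<^esub>, \<one>\<^bsub>B\<^esub>)) = f"
    using assms(3) by (induction f rule: formal_ring_induct) (simp_all add: formal_mult_diff_left)
qed

lemma formal_ring_ring:
  assumes "monoid A" "monoid B"
  shows "ring (formal_ring A B)"
proof -
  interpret A: monoid A by fact
  interpret B: monoid B by fact
  show ?thesis
  proof (rule ringI)
    show "abelian_group (formal_ring A B)"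
    proof (rule abelian_groupI)
      fix f assume f: "f \<in> carrier (formal_ring A B)"
      show "\<exists>g\<in>carrier (formal_ring A B). g \<oplus>\<^bsub>formal_ring A B\<^esub> f = \<zero>\<^bsub>formal_ring A B\<^esub>"
        by (rule bexI[of _ "- f"]) (use f in auto)
    next
      fix f g assume "f \<in> carrier (formal_ring A B)" "g \<in> carrier (formal_ring A B)"
      then show "f \<oplus>\<^bsub>formal_ring A B\<^esub> g \<in> carrier (formal_ring A B)"
        by simp (meson Un_least keys_add order_trans)
    qed (simp_all add: add.assoc add.commute)
    show "monoid (formal_ring A B)"
      by (rule monoidI)
         (simp_all add: formal_mult_assoc[OF assms] formal_mult_one[OF assms] keys_formal_mult[OF assms])
  qed (simp_all add: formal_mult_add_left formal_mult_add_right)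
qed


section \<open>Tensor products of algebras\<close>

definition balanced ::
  "('r, 'l) ring_scheme \<Rightarrow> ('r, 'a, 'm) module_scheme \<Rightarrow> ('r, 'b, 'n) module_scheme \<Rightarrow>
    ('g, 'k) ring_scheme \<Rightarrow> ('a \<Rightarrow> 'b \<Rightarrow> 'g) \<Rightarrow> bool"
  where "balanced R A B G \<phi> \<longleftrightarrow>
    (\<forall>a\<in>carrier A. \<forall>b\<in>carrier B. \<phi> a b \<in> carrier G) \<and>
    (\<forall>a\<in>carrier A. \<forall>a'\<in>carrier A. \<forall>b\<in>carrier B. \<phi> (a \<oplus>\<^bsub>A\<^esub> a') b = \<phi> a b \<oplus>\<^bsub>G\<^esub> \<phi> a' b) \<and>
    (\<forall>a\<in>carrier A. \<forall>b\<in>carrier B. \<forall>b'\<in>carrier B. \<phi> a (b \<oplus>\<^bsub>B\<^esub> b') = \<phi> a b \<oplus>\<^bsub>G\<^esub> \<phi> a b') \<and>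
    (\<forall>r\<in>carrier R. \<forall>a\<in>carrier A. \<forall>b\<in>carrier B. \<phi> (r \<odot>\<^bsub>A\<^esub> a) b = \<phi> a (r \<odot>\<^bsub>B\<^esub> b))"

lemma balancedI:
  assumes "\<And>a b. a \<in> carrier A \<Longrightarrow> b \<in> carrier B \<Longrightarrow> \<phi> a b \<in> carrier G"
    and "\<And>a a' b. a \<in> carrier A \<Longrightarrow> a' \<in> carrier A \<Longrightarrow> b \<in> carrier B \<Longrightarrow>
      \<phi> (a \<oplus>\<^bsub>A\<^esub> a') b = \<phi> a b \<oplus>\<^bsub>G\<^esub> \<phi> a' b"
    and "\<And>a b b'. a \<in> carrier A \<Longrightarrow> b \<in> carrier B \<Longrightarrow> b' \<in> carrier B \<Longrightarrow>
      \<phi> a (b \<oplus>\<^bsub>B\<^esub> b') = \<phi> a b \<oplus>\<^bsub>G\<^esub> \<phi> a b'"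
    and "\<And>r a b. r \<in> carrier R \<Longrightarrow> a \<in> carrier A \<Longrightarrow> b \<in> carrier B \<Longrightarrow>
      \<phi> (r \<odot>\<^bsub>A\<^esub> a) b = \<phi> a (r \<odot>\<^bsub>B\<^esub> b)"
  shows "balanced R A B G \<phi>"
  unfolding balanced_def by (intro conjI ballI; (rule assms; assumption))

lemma balanced_closed:
  assumes "balanced R A B G \<phi>" "a \<in> carrier A" "b \<in> carrier B"
  shows "\<phi> a b \<in> carrier G"
  using assms unfolding balanced_def by blast

lemma balanced_funcset:
  assumes "balanced R A B G \<phi>"
  shows "case_prod \<phi> \<in> carrier A \<times> carrier B \<rightarrow> carrier G"
  by (rule funcsetI) (use balanced_closed[OF assms] in fastforce)

text \<open>
  The additive map that a balanced map induces on the tensor product.  The definite description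
  is the one in the scalar multiplication of \<open>enveloping_module\<close>, which thus is an instance.
\<close>

definition tensor_lift :: "('g, 'k) ring_scheme \<Rightarrow> ('a \<Rightarrow> 'b \<Rightarrow> 'g) \<Rightarrow> ('a \<times> 'b \<Rightarrow>\<^sub>0 int) set \<Rightarrow> 'g"
  where "tensor_lift G \<phi> X = (THE w. \<exists>f\<in>X. w = frag_lift G (case_prod \<phi>) f)"

locale algebra_pair = A: assoc_algebra R A + B: assoc_algebra R B
  for R :: "('r, 'l) ring_scheme" and A :: "('r, 'a, 'm) module_scheme"
    and B :: "('r, 'b, 'n) module_scheme"
begin

abbreviation T where "T \<equiv> tensor_ring R A B"
abbreviation pure (infixl "\<otimes>\<otimes>" 75) where "a \<otimes>\<otimes> b \<equiv> pure_tensor R A B a b"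

sublocale F: ring "formal_ring A B"
  by (rule formal_ring_ring) (unfold_locales)

lemma add_monoid_formal_ring:
  "add_monoid (formal_ring A B) = free_Abelian_group (carrier A \<times> carrier B)"
  by (simp add: formal_ring_def free_Abelian_group_def)

lemma tensor_relations_cases [consumes 1, case_names left right scalar]:
  assumes "f \<in> tensor_relations R A B"
    and "\<And>a a' b. f = frag_of (a \<oplus>\<^bsub>A\<^esub> a', b) - frag_of (a, b) - frag_of (a', b) \<Longrightarrow>
      a \<in> carrier A \<Longrightarrow> a' \<in> carrier A \<Longrightarrow> b \<in> carrier B \<Longrightarrow> P"
    and "\<And>a b b'. f = frag_of (a, b \<oplus>\<^bsub>B\<^esub> b') - frag_of (a, b) - frag_of (a, b') \<Longrightarrow>
      a \<in> carrier A \<Longrightarrow> b \<in> carrier B \<Longrightarrow> b' \<in> carrier B \<Longrightarrow> P"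
    and "\<And>r a b. f = frag_of (r \<odot>\<^bsub>A\<^esub> a, b) - frag_of (a, r \<odot>\<^bsub>B\<^esub> b) \<Longrightarrow>
      r \<in> carrier R \<Longrightarrow> a \<in> carrier A \<Longrightarrow> b \<in> carrier B \<Longrightarrow> P"
  shows P
  using assms unfolding tensor_relations_def by blast

lemma tensor_relationsI:
  "a \<in> carrier A \<Longrightarrow> a' \<in> carrier A \<Longrightarrow> b \<in> carrier B \<Longrightarrow>
     frag_of (a \<oplus>\<^bsub>A\<^esub> a', b) - frag_of (a, b) - frag_of (a', b) \<in> tensor_relations R A B"
  "a \<in> carrier A \<Longrightarrow> b \<in> carrier B \<Longrightarrow> b' \<in> carrier B \<Longrightarrow>
     frag_of (a, b \<oplus>\<^bsub>B\<^esub> b') - frag_of (a, b) - frag_of (a, b') \<in> tensor_relations R A B"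
  "r \<in> carrier R \<Longrightarrow> a \<in> carrier A \<Longrightarrow> b \<in> carrier B \<Longrightarrow>
     frag_of (r \<odot>\<^bsub>A\<^esub> a, b) - frag_of (a, r \<odot>\<^bsub>B\<^esub> b) \<in> tensor_relations R A B"
  unfolding tensor_relations_def by blast+

lemma tensor_relations_subset:
  "tensor_relations R A B \<subseteq> carrier (free_Abelian_group (carrier A \<times> carrier B))"
proof
  have *: "Poly_Mapping.keys (f - g) \<subseteq> S"
    if "Poly_Mapping.keys f \<subseteq> S" "Poly_Mapping.keys g \<subseteq> S" for f g :: "'a \<times> 'b \<Rightarrow>\<^sub>0 int" and S
    using that by (meson Un_least keys_diff order_trans)
  fix f assume "f \<in> tensor_relations R A B"
  then show "f \<in> carrier (free_Abelian_group (carrier A \<times> carrier B))"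
    by (cases rule: tensor_relations_cases)
       (simp_all only: carrier_free_Abelian_group_iff, (intro *; simp)+)
qed

lemma tensor_kernel_subgroup:
  "subgroup (tensor_kernel R A B) (free_Abelian_group (carrier A \<times> carrier B))"
  unfolding tensor_kernel_def
  by (intro group.generate_is_subgroup group_free_Abelian_group tensor_relations_subset)

lemma tensor_kernel_carrier:
  "f \<in> tensor_kernel R A B \<Longrightarrow> Poly_Mapping.keys f \<subseteq> carrier A \<times> carrier B"
  using subgroup.mem_carrier[OF tensor_kernel_subgroup] by simp

lemma tensor_kernel_diff:
  assumes "f \<in> tensor_kernel R A B" "g \<in> tensor_kernel R A B"
  shows "f - g \<in> tensor_kernel R A B"
  using subgroup.m_closed[OF tensor_kernel_subgroup assms(1)
      subgroup.m_inv_closed[OF tensor_kernel_subgroup assms(2)]] tensor_kernel_carrier[OF assms(2)]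
  by simp

lemma zero_in_tensor_kernel: "0 \<in> tensor_kernel R A B"
  using subgroup.one_closed[OF tensor_kernel_subgroup] by simp

lemma tensor_kernel_induct [consumes 1, case_names zero relation diff]:
  assumes "f \<in> tensor_kernel R A B"
    and "P 0"
    and "\<And>f. f \<in> tensor_relations R A B \<Longrightarrow> P f"
    and "\<And>f g. f \<in> tensor_kernel R A B \<Longrightarrow> g \<in> tensor_kernel R A B \<Longrightarrow> P f \<Longrightarrow> P g \<Longrightarrow> P (f - g)"
  shows "P f"
proof -
  let ?S = "carrier A \<times> carrier B"
  have "f \<in> generate (free_Abelian_group ?S) (tensor_relations R A B)"
    using assms(1) unfolding tensor_kernel_def .
  then show ?thesis
  proof (induction f rule: generate.induct)
    case (inv h)
    have "h \<in> tensor_kernel R A B"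
      unfolding tensor_kernel_def using inv by (rule generate.incl)
    then have "P (0 - h)"
      using assms(2-4) inv zero_in_tensor_kernel by blast
    then show ?case
      using tensor_kernel_carrier[OF \<open>h \<in> tensor_kernel R A B\<close>] by simp
  next
    case (eng f g)
    have fg: "f \<in> tensor_kernel R A B" "g \<in> tensor_kernel R A B"
      unfolding tensor_kernel_def using eng by auto
    then have "P (f - (0 - g))"
      using assms(2,4) eng zero_in_tensor_kernel tensor_kernel_diff by meson
    then show ?case by simp
  qed (use assms in auto)
qed

lemma tensor_kernel_mult_left:
  assumes "Poly_Mapping.keys f \<subseteq> carrier A \<times> carrier B" "k \<in> tensor_kernel R A B"
  shows "formal_mult A B f k \<in> tensor_kernel R A B"
  using assms(2)
proof (induction k rule: tensor_kernel_induct)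
  case (relation k)
  show ?case
    using assms(1)
  proof (induction f rule: formal_ring_induct)
    case ab: (pure a b)
    have "formal_mult A B (frag_of (a, b)) k \<in> tensor_relations R A B"
      using relation ab
      by (cases rule: tensor_relations_cases)
         (simp_all add: formal_mult_diff_right A.A.r_distr B.A.r_distr A.smult_mult_right
           B.smult_mult_right tensor_relationsI)
    then show ?case
      unfolding tensor_kernel_def by (rule generate.incl)
  qed (simp_all add: zero_in_tensor_kernel formal_mult_diff_left tensor_kernel_diff)
qed (simp_all add: zero_in_tensor_kernel formal_mult_diff_right tensor_kernel_diff)

lemma tensor_kernel_mult_right:
  assumes "Poly_Mapping.keys f \<subseteq> carrier A \<times> carrier B" "k \<in> tensor_kernel R A B"
  shows "formal_mult A B k f \<in> tensor_kernel R A B"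
  using assms(2)
proof (induction k rule: tensor_kernel_induct)
  case (relation k)
  show ?case
    using assms(1)
  proof (induction f rule: formal_ring_induct)
    case ab: (pure a b)
    have "formal_mult A B k (frag_of (a, b)) \<in> tensor_relations R A B"
      using relation ab
      by (cases rule: tensor_relations_cases)
         (simp_all add: formal_mult_diff_left A.A.l_distr B.A.l_distr A.smult_mult_left
           B.smult_mult_left tensor_relationsI)
    then show ?case
      unfolding tensor_kernel_def by (rule generate.incl)
  qed (simp_all add: zero_in_tensor_kernel formal_mult_diff_right tensor_kernel_diff)
qed (simp_all add: zero_in_tensor_kernel formal_mult_diff_left tensor_kernel_diff)

sublocale K: ideal "tensor_kernel R A B" "formal_ring A B"
  by (rule idealI)
     (use tensor_kernel_subgroup in \<open>simp_all add: F.ring_axioms flip: add_monoid_formal_ring\<close>,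
      simp_all add: tensor_kernel_mult_left tensor_kernel_mult_right)

sublocale T: ring "tensor_ring R A B"
  unfolding tensor_ring_def by (rule K.quotient_is_ring)

abbreviation coset where "coset f \<equiv> tensor_kernel R A B +>\<^bsub>formal_ring A B\<^esub> f"

sublocale \<pi>: ring_hom_ring "formal_ring A B" "tensor_ring R A B" coset
  unfolding tensor_ring_def by (rule K.rcos_ring_hom_ring)

lemma carrier_tensor_ring:
  "X \<in> carrier (tensor_ring R A B) \<longleftrightarrow>
    (\<exists>f. Poly_Mapping.keys f \<subseteq> carrier A \<times> carrier B \<and> X = coset f)"
  by (simp add: tensor_ring_def FactRing_def A_RCOSETS_def' Bex_def)

lemma mem_coset_iff: "g \<in> coset f \<longleftrightarrow> g - f \<in> tensor_kernel R A B"
  by (auto simp: a_r_coset_def' intro: bexI[of _ "g - f"])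

lemma coset_eqI:
  assumes "f - g \<in> tensor_kernel R A B"
  shows "coset f = coset g"
proof -
  have "h \<in> coset f \<longleftrightarrow> h \<in> coset g" for h
    using tensor_kernel_diff[of "h - g" "f - g"] tensor_kernel_diff[of "h - f" "0 - (f - g)"]
      tensor_kernel_diff[OF zero_in_tensor_kernel assms] assms
    by (auto simp: mem_coset_iff)
  then show ?thesis by blast
qed

lemma coset_diff:
  assumes f: "Poly_Mapping.keys f \<subseteq> carrier A \<times> carrier B"
    and g: "Poly_Mapping.keys g \<subseteq> carrier A \<times> carrier B"
  shows "coset (f - g) = coset f \<ominus>\<^bsub>T\<^esub> coset g"
proof -
  have fg: "Poly_Mapping.keys (f - g) \<subseteq> carrier A \<times> carrier B"
    using f g by (meson Un_least keys_diff order_trans)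
  have "coset f = coset (f - g) \<oplus>\<^bsub>T\<^esub> coset g"
    using \<pi>.hom_add[of "f - g" g] fg g by simp
  then show ?thesis
    using \<pi>.hom_closed[of "f - g"] \<pi>.hom_closed[of g] fg g
    by (simp add: T.minus_eq T.a_assoc T.r_neg)
qed

lemma pure_closed [simp, intro]:
  "a \<in> carrier A \<Longrightarrow> b \<in> carrier B \<Longrightarrow> a \<otimes>\<otimes> b \<in> carrier T"
  unfolding pure_tensor_def by simp

lemma pure_mult [simp]:
  assumes "a \<in> carrier A" "b \<in> carrier B" "a' \<in> carrier A" "b' \<in> carrier B"
  shows "(a \<otimes>\<otimes> b) \<otimes>\<^bsub>T\<^esub> (a' \<otimes>\<otimes> b') = (a \<otimes>\<^bsub>A\<^esub> a') \<otimes>\<otimes> (b \<otimes>\<^bsub>B\<^esub> b')"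
  unfolding pure_tensor_def using assms by (simp flip: \<pi>.hom_mult)

lemma pure_one: "\<one>\<^bsub>T\<^esub> = \<one>\<^bsub>A\<^esub> \<otimes>\<otimes> \<one>\<^bsub>B\<^esub>"
  unfolding pure_tensor_def using \<pi>.hom_one by simp

lemma coset_add:
  assumes "f - g - h \<in> tensor_relations R A B"
    and "Poly_Mapping.keys g \<subseteq> carrier A \<times> carrier B" "Poly_Mapping.keys h \<subseteq> carrier A \<times> carrier B"
  shows "coset f = coset g \<oplus>\<^bsub>T\<^esub> coset h"
proof -
  have "f - (g + h) \<in> tensor_kernel R A B"
    unfolding tensor_kernel_def using assms(1) by (auto intro: generate.incl simp: diff_diff_eq)
  then have "coset f = coset (g + h)"
    by (rule coset_eqI)
  then show ?thesis
    using \<pi>.hom_add[of g h] assms by simp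
qed

lemma pure_add_left:
  "a \<in> carrier A \<Longrightarrow> a' \<in> carrier A \<Longrightarrow> b \<in> carrier B \<Longrightarrow>
    (a \<oplus>\<^bsub>A\<^esub> a') \<otimes>\<otimes> b = (a \<otimes>\<otimes> b) \<oplus>\<^bsub>T\<^esub> (a' \<otimes>\<otimes> b)"
  unfolding pure_tensor_def by (intro coset_add tensor_relationsI) auto

lemma pure_add_right:
  "a \<in> carrier A \<Longrightarrow> b \<in> carrier B \<Longrightarrow> b' \<in> carrier B \<Longrightarrow>
    a \<otimes>\<otimes> (b \<oplus>\<^bsub>B\<^esub> b') = (a \<otimes>\<otimes> b) \<oplus>\<^bsub>T\<^esub> (a \<otimes>\<otimes> b')"
  unfolding pure_tensor_def by (intro coset_add tensor_relationsI) auto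

lemma pure_scalar:
  "r \<in> carrier R \<Longrightarrow> a \<in> carrier A \<Longrightarrow> b \<in> carrier B \<Longrightarrow>
    (r \<odot>\<^bsub>A\<^esub> a) \<otimes>\<otimes> b = a \<otimes>\<otimes> (r \<odot>\<^bsub>B\<^esub> b)"
  unfolding pure_tensor_def
  by (intro coset_eqI) (simp add: tensor_kernel_def generate.incl tensor_relationsI)

lemma tensor_induct [consumes 1, case_names pure diff]:
  assumes "X \<in> carrier T"
    and pure: "\<And>a b. a \<in> carrier A \<Longrightarrow> b \<in> carrier B \<Longrightarrow> P (a \<otimes>\<otimes> b)"
    and diff: "\<And>X Y. X \<in> carrier T \<Longrightarrow> Y \<in> carrier T \<Longrightarrow> P X \<Longrightarrow> P Y \<Longrightarrow> P (X \<ominus>\<^bsub>T\<^esub> Y)"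
  shows "P X"
proof -
  have zero: "P \<zero>\<^bsub>T\<^esub>"
    using diff[of "\<one>\<^bsub>A\<^esub> \<otimes>\<otimes> \<one>\<^bsub>B\<^esub>" "\<one>\<^bsub>A\<^esub> \<otimes>\<otimes> \<one>\<^bsub>B\<^esub>"] pure by (simp add: T.r_neg T.minus_eq)
  obtain f where f: "Poly_Mapping.keys f \<subseteq> carrier A \<times> carrier B" and X: "X = coset f"
    using assms(1) by (auto simp: carrier_tensor_ring)
  from f have "P (coset f)"
  proof (induction f rule: formal_ring_induct)
    case zero
    show ?case using \<open>P \<zero>\<^bsub>T\<^esub>\<close> \<pi>.hom_zero by simp
  next
    case (pure a b)
    then show ?case using assms(2)[of a b] by (simp add: pure_tensor_def)
  next
    case (diff f g)
    then show ?case
      using assms(3)[of "coset f" "coset g"] by (simp add: coset_diff)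
  qed
  then show ?thesis by (simp add: X)
qed

text \<open>
  The additive extension of a balanced map kills each of the relations of the tensor product,
  hence the subgroup that they generate; so it is constant on cosets.
\<close>

lemma tensor_lift_coset:
  assumes "abelian_group G" "balanced R A B G \<phi>"
    and f: "Poly_Mapping.keys f \<subseteq> carrier A \<times> carrier B"
  shows "tensor_lift G \<phi> (coset f) = frag_lift G (case_prod \<phi>) f"
proof -
  interpret G: abelian_group G by fact
  let ?L = "frag_lift G (case_prod \<phi>)"
  have \<phi>: "case_prod \<phi> \<in> carrier A \<times> carrier B \<rightarrow> carrier G"
    using assms(2) by (rule balanced_funcset)
  have L_diff: "?L (g - h) = ?L g \<ominus>\<^bsub>G\<^esub> ?L h"
    if "Poly_Mapping.keys g \<subseteq> carrier A \<times> carrier B" "Poly_Mapping.keys h \<subseteq> carrier A \<times> carrier B"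
    for g h :: "'a \<times> 'b \<Rightarrow>\<^sub>0 int"
    using that \<phi> by (rule G.frag_lift_diff)
  have keys: "Poly_Mapping.keys (g - h) \<subseteq> carrier A \<times> carrier B"
    if "Poly_Mapping.keys g \<subseteq> carrier A \<times> carrier B" "Poly_Mapping.keys h \<subseteq> carrier A \<times> carrier B"
    for g h :: "'a \<times> 'b \<Rightarrow>\<^sub>0 int"
    using that by (meson Un_least keys_diff order_trans)
  have L_of: "?L (frag_of (a, b)) = \<phi> a b" if "a \<in> carrier A" "b \<in> carrier B" for a b
    using balanced_closed[OF assms(2) that] by (simp add: G.frag_lift_of)
  have \<phi>_closed: "\<phi> a b \<in> carrier G" if "a \<in> carrier A" "b \<in> carrier B" for a b
    using balanced_closed[OF assms(2) that] .
  have cancel: "(u \<oplus>\<^bsub>G\<^esub> v) \<ominus>\<^bsub>G\<^esub> u \<ominus>\<^bsub>G\<^esub> v = \<zero>\<^bsub>G\<^esub>" if "u \<in> carrier G" "v \<in> carrier G" for u v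
  proof -
    have "(u \<oplus>\<^bsub>G\<^esub> v) \<ominus>\<^bsub>G\<^esub> u = v"
      using that by (simp add: G.minus_eq G.a_comm[of u v] G.a_assoc G.r_neg)
    then show ?thesis
      using that by (simp add: G.minus_eq G.r_neg)
  qed
  have kernel: "?L k = \<zero>\<^bsub>G\<^esub>" if "k \<in> tensor_kernel R A B" for k
    using that
  proof (induction k rule: tensor_kernel_induct)
    case (relation k)
    then show ?case
    proof (cases rule: tensor_relations_cases)
      case (left a a' b)
      then have "?L k = \<phi> (a \<oplus>\<^bsub>A\<^esub> a') b \<ominus>\<^bsub>G\<^esub> \<phi> a b \<ominus>\<^bsub>G\<^esub> \<phi> a' b"
        by (simp add: L_diff keys L_of)
      also have "\<phi> (a \<oplus>\<^bsub>A\<^esub> a') b = \<phi> a b \<oplus>\<^bsub>G\<^esub> \<phi> a' b"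
        using left assms(2) unfolding balanced_def by blast
      finally show ?thesis
        using left by (simp add: cancel \<phi>_closed)
    next
      case (right a b b')
      then have "?L k = \<phi> a (b \<oplus>\<^bsub>B\<^esub> b') \<ominus>\<^bsub>G\<^esub> \<phi> a b \<ominus>\<^bsub>G\<^esub> \<phi> a b'"
        by (simp add: L_diff keys L_of)
      also have "\<phi> a (b \<oplus>\<^bsub>B\<^esub> b') = \<phi> a b \<oplus>\<^bsub>G\<^esub> \<phi> a b'"
        using right assms(2) unfolding balanced_def by blast
      finally show ?thesis
        using right by (simp add: cancel \<phi>_closed)
    next
      case (scalar r a b)
      then have "?L k = \<phi> (r \<odot>\<^bsub>A\<^esub> a) b \<ominus>\<^bsub>G\<^esub> \<phi> a (r \<odot>\<^bsub>B\<^esub> b)"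
        by (simp add: L_diff L_of)
      also have "\<phi> (r \<odot>\<^bsub>A\<^esub> a) b = \<phi> a (r \<odot>\<^bsub>B\<^esub> b)"
        using scalar assms(2) unfolding balanced_def by blast
      finally show ?thesis
        using scalar by (simp add: \<phi>_closed G.minus_eq G.r_neg)
    qed
  next
    case (diff k l)
    then show ?case
      by (simp add: L_diff tensor_kernel_carrier G.minus_eq)
  qed simp
  have "?L g = ?L f" if "g \<in> coset f" for g
  proof -
    have k: "g - f \<in> tensor_kernel R A B"
      using that by (simp add: mem_coset_iff)
    have "?L (g - f + f) = ?L (g - f) \<oplus>\<^bsub>G\<^esub> ?L f"
      using tensor_kernel_carrier[OF k] f \<phi> by (rule G.frag_lift_add)
    then show ?thesis
      using kernel[OF k] G.frag_lift_closed[OF f \<phi>] by simp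
  qed
  moreover have "f \<in> coset f"
    by (simp add: mem_coset_iff zero_in_tensor_kernel)
  ultimately show ?thesis
    unfolding tensor_lift_def by blast
qed

lemma tensor_lift_pure [simp]:
  assumes "abelian_group G" "balanced R A B G \<phi>" "a \<in> carrier A" "b \<in> carrier B"
  shows "tensor_lift G \<phi> (a \<otimes>\<otimes> b) = \<phi> a b"
proof -
  interpret G: abelian_group G by fact
  show ?thesis
    using assms(3,4) balanced_closed[OF assms(2-4)]
    by (simp add: pure_tensor_def tensor_lift_coset[OF assms(1,2)] G.frag_lift_of)
qed

lemma tensor_lift_closed:
  assumes "abelian_group G" "balanced R A B G \<phi>" "X \<in> carrier T"
  shows "tensor_lift G \<phi> X \<in> carrier G"
proof -
  interpret G: abelian_group G by fact
  have \<phi>: "case_prod \<phi> \<in> carrier A \<times> carrier B \<rightarrow> carrier G"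
    using assms(2) by (rule balanced_funcset)
  obtain f where f: "Poly_Mapping.keys f \<subseteq> carrier A \<times> carrier B" "X = coset f"
    using assms(3) by (auto simp: carrier_tensor_ring)
  then show ?thesis
    using G.frag_lift_closed[OF f(1) \<phi>] by (simp add: tensor_lift_coset[OF assms(1,2)])
qed

lemma tensor_lift_add:
  assumes "abelian_group G" "balanced R A B G \<phi>" "X \<in> carrier T" "Y \<in> carrier T"
  shows "tensor_lift G \<phi> (X \<oplus>\<^bsub>T\<^esub> Y) = tensor_lift G \<phi> X \<oplus>\<^bsub>G\<^esub> tensor_lift G \<phi> Y"
proof -
  interpret G: abelian_group G by fact
  have \<phi>: "case_prod \<phi> \<in> carrier A \<times> carrier B \<rightarrow> carrier G"
    using assms(2) by (rule balanced_funcset)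
  obtain f where f: "Poly_Mapping.keys f \<subseteq> carrier A \<times> carrier B" "X = coset f"
    using assms(3) by (auto simp: carrier_tensor_ring)
  obtain g where g: "Poly_Mapping.keys g \<subseteq> carrier A \<times> carrier B" "Y = coset g"
    using assms(4) by (auto simp: carrier_tensor_ring)
  have fg: "Poly_Mapping.keys (f + g) \<subseteq> carrier A \<times> carrier B"
    by (rule order_trans[OF keys_add]) (use f(1) g(1) in simp)
  have "X \<oplus>\<^bsub>T\<^esub> Y = coset (f + g)"
    using \<pi>.hom_add[of f g] f(1) g(1) by (simp add: f(2) g(2))
  then have "tensor_lift G \<phi> (X \<oplus>\<^bsub>T\<^esub> Y) = frag_lift G (case_prod \<phi>) (f + g)"
    using tensor_lift_coset[OF assms(1,2) fg] by simp
  also have "\<dots> = frag_lift G (case_prod \<phi>) f \<oplus>\<^bsub>G\<^esub> frag_lift G (case_prod \<phi>) g"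
    by (rule G.frag_lift_add[OF f(1) g(1) \<phi>])
  finally show ?thesis
    by (simp add: f g tensor_lift_coset[OF assms(1,2)])
qed

lemma tensor_lift_diff:
  assumes "abelian_group G" "balanced R A B G \<phi>" "X \<in> carrier T" "Y \<in> carrier T"
  shows "tensor_lift G \<phi> (X \<ominus>\<^bsub>T\<^esub> Y) = tensor_lift G \<phi> X \<ominus>\<^bsub>G\<^esub> tensor_lift G \<phi> Y"
  using assms(3,4)
  by (intro additive_minus[where h = "tensor_lift G \<phi>", OF T.is_abelian_group assms(1)]
      tensor_lift_closed tensor_lift_add assms(1,2))

end

context algebra_pair
begin

text \<open>
  Pure tensors generate the tensor product as an additive group.
\<close>

lemma additive_ext:
  assumes G: "abelian_group G"
    and "\<And>X. X \<in> carrier T \<Longrightarrow> h X \<in> carrier G"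
    and "\<And>X Y. X \<in> carrier T \<Longrightarrow> Y \<in> carrier T \<Longrightarrow> h (X \<oplus>\<^bsub>T\<^esub> Y) = h X \<oplus>\<^bsub>G\<^esub> h Y"
    and "\<And>X. X \<in> carrier T \<Longrightarrow> k X \<in> carrier G"
    and "\<And>X Y. X \<in> carrier T \<Longrightarrow> Y \<in> carrier T \<Longrightarrow> k (X \<oplus>\<^bsub>T\<^esub> Y) = k X \<oplus>\<^bsub>G\<^esub> k Y"
    and "\<And>a b. a \<in> carrier A \<Longrightarrow> b \<in> carrier B \<Longrightarrow> h (a \<otimes>\<otimes> b) = k (a \<otimes>\<otimes> b)"
    and "X \<in> carrier T"
  shows "h X = k X"
  using assms(7)
proof (induction X rule: tensor_induct)
  case (pure a b)
  then show ?case by (rule assms(6))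
next
  case (diff X Y)
  then show ?case
    using additive_minus[where h = h, OF T.is_abelian_group G assms(2,3) diff(1,2)]
      additive_minus[where h = k, OF T.is_abelian_group G assms(4,5) diff(1,2)] by simp
qed

end


section \<open>Opposite algebras and extended ring records\<close>

lemma ring_extend_simps [simp]:
  "carrier (ring.extend S m) = carrier S"
  "monoid.mult (ring.extend S m) = monoid.mult S"
  "one (ring.extend S m) = one S"
  "ring.zero (ring.extend S m) = ring.zero S"
  "add (ring.extend S m) = add S"
  "smult (ring.extend S \<lparr>smult = \<sigma>\<rparr>) = \<sigma>"
  by (simp_all add: ring.extend_def)

lemma a_minus_ring_extend [simp]: "a_minus (ring.extend S m) = a_minus S"
  by (intro ext) (simp add: a_minus_def a_inv_def m_inv_def)

lemma ring_extend:
  assumes "ring S"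
  shows "ring (ring.extend S m)"
proof -
  interpret S: ring S by fact
  have ab: "abelian_group (ring.extend S m)"
    using S.is_abelian_group by (rule abelian_group_cong) simp_all
  have mon: "monoid (ring.extend S m)"
    by (rule monoidI) (simp_all add: S.m_assoc)
  show ?thesis
    by (rule ringI[OF ab mon]) (simp_all add: S.l_distr S.r_distr)
qed

lemma assoc_algebraI:
  assumes "cring R" "ring A"
    and "\<And>r x. r \<in> carrier R \<Longrightarrow> x \<in> carrier A \<Longrightarrow> r \<odot>\<^bsub>A\<^esub> x \<in> carrier A"
    and "\<And>r s x. r \<in> carrier R \<Longrightarrow> s \<in> carrier R \<Longrightarrow> x \<in> carrier A \<Longrightarrow>
      (r \<oplus>\<^bsub>R\<^esub> s) \<odot>\<^bsub>A\<^esub> x = r \<odot>\<^bsub>A\<^esub> x \<oplus>\<^bsub>A\<^esub> s \<odot>\<^bsub>A\<^esub> x"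
    and "\<And>r x y. r \<in> carrier R \<Longrightarrow> x \<in> carrier A \<Longrightarrow> y \<in> carrier A \<Longrightarrow>
      r \<odot>\<^bsub>A\<^esub> (x \<oplus>\<^bsub>A\<^esub> y) = r \<odot>\<^bsub>A\<^esub> x \<oplus>\<^bsub>A\<^esub> r \<odot>\<^bsub>A\<^esub> y"
    and "\<And>r s x. r \<in> carrier R \<Longrightarrow> s \<in> carrier R \<Longrightarrow> x \<in> carrier A \<Longrightarrow>
      (r \<otimes>\<^bsub>R\<^esub> s) \<odot>\<^bsub>A\<^esub> x = r \<odot>\<^bsub>A\<^esub> (s \<odot>\<^bsub>A\<^esub> x)"
    and "\<And>x. x \<in> carrier A \<Longrightarrow> \<one>\<^bsub>R\<^esub> \<odot>\<^bsub>A\<^esub> x = x"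
    and "\<And>r x y. r \<in> carrier R \<Longrightarrow> x \<in> carrier A \<Longrightarrow> y \<in> carrier A \<Longrightarrow>
      (r \<odot>\<^bsub>A\<^esub> x) \<otimes>\<^bsub>A\<^esub> y = r \<odot>\<^bsub>A\<^esub> (x \<otimes>\<^bsub>A\<^esub> y)"
    and "\<And>r x y. r \<in> carrier R \<Longrightarrow> x \<in> carrier A \<Longrightarrow> y \<in> carrier A \<Longrightarrow>
      x \<otimes>\<^bsub>A\<^esub> (r \<odot>\<^bsub>A\<^esub> y) = r \<odot>\<^bsub>A\<^esub> (x \<otimes>\<^bsub>A\<^esub> y)"
  shows "assoc_algebra R A"
proof -
  have "module R A"
    by (rule moduleI[OF assms(1) ring.is_abelian_group[OF assms(2)]]; (rule assms; assumption))
  then show ?thesis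
    by (rule assoc_algebra.intro[OF assms(2)])
       (rule assoc_algebra_axioms.intro; (rule assms; assumption))
qed

lemma opposite_simps [simp]:
  "carrier (opposite A) = carrier A"
  "x \<otimes>\<^bsub>opposite A\<^esub> y = y \<otimes>\<^bsub>A\<^esub> x"
  "one (opposite A) = one A"
  "ring.zero (opposite A) = ring.zero A"
  "add (opposite A) = add A"
  "smult (opposite A) = smult A"
  by (simp_all add: opposite_def)

lemma (in assoc_algebra) assoc_algebra_opposite: "assoc_algebra R (opposite A)"
proof -
  have ab: "abelian_group (opposite A)"
    using A.is_abelian_group by (rule abelian_group_cong) simp_all
  have mon: "monoid (opposite A)"
    by (rule monoidI) (simp_all add: A.m_assoc)
  have ring: "ring (opposite A)"
    by (rule ringI[OF ab mon]) (simp_all add: A.l_distr A.r_distr)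
  show ?thesis
    using R.is_cring ring
    by (rule assoc_algebraI)
       (simp_all only: opposite_simps smult_closed smult_l_distr smult_r_distr smult_assoc1 smult_one
         smult_mult_left smult_mult_right)
qed


section \<open>The action of the enveloping algebra\<close>

lemma enveloping_module_simps [simp]:
  "carrier (enveloping_module A) = carrier A"
  "add (enveloping_module A) = add A"
  "ring.zero (enveloping_module A) = ring.zero A"
  by (simp_all add: enveloping_module_def)

lemma smult_enveloping_module:
  "X \<odot>\<^bsub>enveloping_module A\<^esub> z = tensor_lift A (\<lambda>a b. a \<otimes>\<^bsub>A\<^esub> z \<otimes>\<^bsub>A\<^esub> b) X"
  by (simp add: enveloping_module_def tensor_lift_def formal_action_def frag_lift_def case_prod_beta')

text \<open>
  This is \<open>assoc_algebra\<close> again.  A locale of its own carries the enveloping algebra, because the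
  opposite algebra is in \<open>assoc_algebra\<close> too, and attaching the enveloping algebra there would
  repeat the construction without end.
\<close>

locale enveloping = assoc_algebra R A
  for R :: "('r, 'l) ring_scheme" and A :: "('r, 'a, 'm) module_scheme" (structure)
begin

sublocale E: algebra_pair R A "opposite A"
  by (intro algebra_pair.intro assoc_algebra_axioms assoc_algebra_opposite)

abbreviation act (infixr "\<bullet>" 70) where "X \<bullet> z \<equiv> X \<odot>\<^bsub>enveloping_module A\<^esub> z"

lemma balanced_action:
  assumes "z \<in> carrier A"
  shows "balanced R A (opposite A) A (\<lambda>a b. a \<otimes>\<^bsub>A\<^esub> z \<otimes>\<^bsub>A\<^esub> b)"
  using assms
  by (intro balancedI) (simp_all add: A.l_distr A.r_distr smult_mult_left smult_mult_right)

lemma act_closed [simp, intro]: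
  "X \<in> carrier E.T \<Longrightarrow> z \<in> carrier A \<Longrightarrow> X \<bullet> z \<in> carrier A"
  unfolding smult_enveloping_module by (intro E.tensor_lift_closed balanced_action A.is_abelian_group)

lemma act_pure [simp]:
  "a \<in> carrier A \<Longrightarrow> b \<in> carrier A \<Longrightarrow> z \<in> carrier A \<Longrightarrow> E.pure a b \<bullet> z = a \<otimes>\<^bsub>A\<^esub> z \<otimes>\<^bsub>A\<^esub> b"
  unfolding smult_enveloping_module by (simp add: balanced_action A.is_abelian_group)

lemma act_add_left:
  "X \<in> carrier E.T \<Longrightarrow> Y \<in> carrier E.T \<Longrightarrow> z \<in> carrier A \<Longrightarrow>
    (X \<oplus>\<^bsub>E.T\<^esub> Y) \<bullet> z = X \<bullet> z \<oplus>\<^bsub>A\<^esub> Y \<bullet> z"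
  unfolding smult_enveloping_module by (intro E.tensor_lift_add balanced_action A.is_abelian_group)

lemma act_diff_left:
  "X \<in> carrier E.T \<Longrightarrow> Y \<in> carrier E.T \<Longrightarrow> z \<in> carrier A \<Longrightarrow>
    (X \<ominus>\<^bsub>E.T\<^esub> Y) \<bullet> z = X \<bullet> z \<ominus>\<^bsub>A\<^esub> Y \<bullet> z"
  unfolding smult_enveloping_module by (intro E.tensor_lift_diff balanced_action A.is_abelian_group)

lemma act_zero_left [simp]: "z \<in> carrier A \<Longrightarrow> \<zero>\<^bsub>E.T\<^esub> \<bullet> z = \<zero>\<^bsub>A\<^esub>"
  by (rule additive_zero[where h = "\<lambda>X. X \<bullet> z", OF E.T.is_abelian_group A.is_abelian_group])
     (simp_all add: act_add_left)

lemma act_add_right: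
  assumes "X \<in> carrier E.T" "z \<in> carrier A" "w \<in> carrier A"
  shows "X \<bullet> (z \<oplus>\<^bsub>A\<^esub> w) = X \<bullet> z \<oplus>\<^bsub>A\<^esub> X \<bullet> w"
  using assms(1)
proof (induction X rule: E.tensor_induct)
  case (pure a b)
  then show ?case using assms by (simp add: A.l_distr A.r_distr)
next
  case (diff X Y)
  then show ?case
    using assms by (simp add: act_diff_left A.minus_eq A.minus_add A.a_ac)
qed

lemma act_diff_right:
  assumes "X \<in> carrier E.T" "z \<in> carrier A" "w \<in> carrier A"
  shows "X \<bullet> (z \<ominus>\<^bsub>A\<^esub> w) = X \<bullet> z \<ominus>\<^bsub>A\<^esub> X \<bullet> w"
  using assms
  by (intro additive_minus[where h = "\<lambda>z. X \<bullet> z", OF A.is_abelian_group A.is_abelian_group])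
     (simp_all add: act_add_right)

lemma act_mult:
  assumes "X \<in> carrier E.T" "Y \<in> carrier E.T" "z \<in> carrier A"
  shows "(X \<otimes>\<^bsub>E.T\<^esub> Y) \<bullet> z = X \<bullet> Y \<bullet> z"
  using assms(1)
proof (induction X rule: E.tensor_induct)
  case ab: (pure a b)
  show ?case
    using assms(2)
  proof (induction Y rule: E.tensor_induct)
    case (pure c d)
    then show ?case using ab assms by (simp add: A.m_assoc)
  next
    case (diff X Y)
    have *: "U \<otimes>\<^bsub>E.T\<^esub> (X \<ominus>\<^bsub>E.T\<^esub> Y) = U \<otimes>\<^bsub>E.T\<^esub> X \<ominus>\<^bsub>E.T\<^esub> U \<otimes>\<^bsub>E.T\<^esub> Y" if "U \<in> carrier E.T" for U
      using that diff by (simp add: E.T.minus_eq E.T.r_distr E.T.r_minus)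
    from diff show ?case
      using ab assms * E.pure_closed[of a b] by (simp only: act_diff_left act_diff_right act_closed E.T.m_closed opposite_simps)
  qed
next
  case (diff U V)
  have "(U \<ominus>\<^bsub>E.T\<^esub> V) \<otimes>\<^bsub>E.T\<^esub> Y = U \<otimes>\<^bsub>E.T\<^esub> Y \<ominus>\<^bsub>E.T\<^esub> V \<otimes>\<^bsub>E.T\<^esub> Y"
    using diff assms by (simp add: E.T.minus_eq E.T.l_distr E.T.l_minus)
  with diff show ?case
    using assms by (simp add: act_diff_left)
qed

end


section \<open>Linear maps and dual bases of projective modules\<close>

lemma linear_mapsI:
  assumes "f \<in> extensional (carrier M)"
    and "\<And>x. x \<in> carrier M \<Longrightarrow> f x \<in> carrier N"
    and "\<And>x y. x \<in> carrier M \<Longrightarrow> y \<in> carrier M \<Longrightarrow> f (x \<oplus>\<^bsub>M\<^esub> y) = f x \<oplus>\<^bsub>N\<^esub> f y"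
    and "\<And>r x. r \<in> carrier R \<Longrightarrow> x \<in> carrier M \<Longrightarrow> f (r \<odot>\<^bsub>M\<^esub> x) = r \<odot>\<^bsub>N\<^esub> f x"
  shows "f \<in> linear_maps R M N"
  using assms unfolding linear_maps_def PiE_def by blast

lemma linear_mapsD:
  assumes "f \<in> linear_maps R M N"
  shows "x \<in> carrier M \<Longrightarrow> f x \<in> carrier N"
    and "x \<in> carrier M \<Longrightarrow> y \<in> carrier M \<Longrightarrow> f (x \<oplus>\<^bsub>M\<^esub> y) = f x \<oplus>\<^bsub>N\<^esub> f y"
    and "r \<in> carrier R \<Longrightarrow> x \<in> carrier M \<Longrightarrow> f (r \<odot>\<^bsub>M\<^esub> x) = r \<odot>\<^bsub>N\<^esub> f x"
  using assms unfolding linear_maps_def by auto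

lemma free_module_simps [simp]:
  "f \<in> carrier (free_module R I) \<longleftrightarrow> f \<in> I \<rightarrow>\<^sub>E carrier R \<and> finite {i \<in> I. f i \<noteq> \<zero>\<^bsub>R\<^esub>}"
  "f \<oplus>\<^bsub>free_module R I\<^esub> g = (\<lambda>i\<in>I. f i \<oplus>\<^bsub>R\<^esub> g i)"
  "r \<odot>\<^bsub>free_module R I\<^esub> f = (\<lambda>i\<in>I. r \<otimes>\<^bsub>R\<^esub> f i)"
  by (simp_all add: free_module_def)

lemma linear_map_free_zero:
  assumes "ring R" "abelian_group M" and p: "p \<in> linear_maps R (free_module R I) M"
    and f: "f \<in> carrier (free_module R I)" and zero: "\<And>i. i \<in> I \<Longrightarrow> f i = \<zero>\<^bsub>R\<^esub>"
  shows "p f = \<zero>\<^bsub>M\<^esub>"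
proof -
  interpret R: ring R by fact
  interpret M: abelian_group M by fact
  have "f i = (if i \<in> I then \<zero>\<^bsub>R\<^esub> else undefined)" for i
    using zero f PiE_arb[of f I "\<lambda>_. carrier R" i] by simp
  then have "f \<oplus>\<^bsub>free_module R I\<^esub> f = f"
    by (intro ext) simp
  then have "p f \<oplus>\<^bsub>M\<^esub> p f = p f"
    using linear_mapsD(2)[OF p f f] by metis
  moreover have "p f \<in> carrier M"
    using linear_mapsD(1)[OF p f] .
  ultimately show ?thesis
    using M.add.l_cancel_one[of "p f" "p f"] by simp
qed

text \<open>
  A linear map on a free module is determined by its values on the standard basis: here one
  component of the argument is split off at a time, which allows inductions over finite supports
  also for modules over the enveloping algebra, which is not commutative.
\<close>

lemma linear_map_free_split:
  assumes "ring R" and p: "p \<in> linear_maps R (free_module R I) M"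
    and f: "f \<in> carrier (free_module R I)" and j: "j \<in> I"
  defines "d \<equiv> (\<lambda>i\<in>I. if i = j then \<one>\<^bsub>R\<^esub> else \<zero>\<^bsub>R\<^esub>)"
  shows "f(j := \<zero>\<^bsub>R\<^esub>) \<in> carrier (free_module R I)"
    and "p d \<in> carrier M"
    and "p f = p (f(j := \<zero>\<^bsub>R\<^esub>)) \<oplus>\<^bsub>M\<^esub> f j \<odot>\<^bsub>M\<^esub> p d"
proof -
  interpret R: ring R by fact
  let ?F = "free_module R I" and ?g = "f(j := \<zero>\<^bsub>R\<^esub>)"
  have fI: "f \<in> I \<rightarrow>\<^sub>E carrier R" and fin: "finite {i \<in> I. f i \<noteq> \<zero>\<^bsub>R\<^esub>}"
    using f by auto
  have fj: "f j \<in> carrier R"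
    using fI j by (rule PiE_mem)
  have "?g \<in> I \<rightarrow>\<^sub>E carrier R"
    using PiE_fun_upd[of "\<zero>\<^bsub>R\<^esub>" "\<lambda>_. carrier R" j f I] fI j by (simp add: insert_absorb)
  moreover have "finite {i \<in> I. ?g i \<noteq> \<zero>\<^bsub>R\<^esub>}"
    by (rule finite_subset[OF _ fin]) auto
  ultimately show g: "?g \<in> carrier ?F"
    by simp
  have d: "d \<in> carrier ?F"
    by (simp add: d_def)
  show "p d \<in> carrier M"
    using linear_mapsD(1)[OF p d] .
  have fjd: "f j \<odot>\<^bsub>?F\<^esub> d \<in> carrier ?F"
    using fj by (simp add: d_def if_distrib)
  have "f i = (?g \<oplus>\<^bsub>?F\<^esub> (f j \<odot>\<^bsub>?F\<^esub> d)) i" for i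
    using j fj PiE_mem[OF fI, of i] PiE_arb[OF fI, of i] by (simp add: d_def)
  then have "f = ?g \<oplus>\<^bsub>?F\<^esub> (f j \<odot>\<^bsub>?F\<^esub> d)"
    by (rule ext)
  then have "p f = p (?g \<oplus>\<^bsub>?F\<^esub> (f j \<odot>\<^bsub>?F\<^esub> d))"
    by (rule arg_cong)
  also have "\<dots> = p ?g \<oplus>\<^bsub>M\<^esub> p (f j \<odot>\<^bsub>?F\<^esub> d)"
    by (rule linear_mapsD(2)[OF p g fjd])
  also have "p (f j \<odot>\<^bsub>?F\<^esub> d) = f j \<odot>\<^bsub>M\<^esub> p d"
    by (rule linear_mapsD(3)[OF p fj d])
  finally show "p f = p ?g \<oplus>\<^bsub>M\<^esub> f j \<odot>\<^bsub>M\<^esub> p d" .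
qed

lemma regular_module_simps [simp]:
  "carrier (regular_module S) = carrier S"
  "add (regular_module S) = add S"
  "smult (regular_module S) = monoid.mult S"
  by (simp_all add: regular_module_def)

context module
begin

lemma linear_map_free_expand:
  assumes p: "p \<in> linear_maps R (free_module R I) M"
    and "finite J" "J \<subseteq> I" "f \<in> carrier (free_module R I)" "\<And>i. i \<in> I - J \<Longrightarrow> f i = \<zero>"
  shows "p f = (\<Oplus>\<^bsub>M\<^esub>j\<in>J. f j \<odot>\<^bsub>M\<^esub> p (\<lambda>i\<in>I. if i = j then \<one> else \<zero>))"
  using assms(2-5)
proof (induction J arbitrary: f rule: finite_induct)
  case empty
  then show ?case
    using linear_map_free_zero[OF R.ring_axioms M.abelian_group_axioms p empty(2)] by simp
next
  case (insert j J)
  let ?b = "\<lambda>j. p (\<lambda>i\<in>I. if i = j then \<one> else \<zero>)" and ?g = "f(j := \<zero>)"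
  have j: "j \<in> I" and J: "J \<subseteq> I"
    using insert.prems(1) by auto
  note split = linear_map_free_split[OF R.ring_axioms p insert.prems(2)]
  have f: "f i \<in> carrier R" if "i \<in> I" for i
    using insert.prems(2) that by auto
  have terms: "f i \<odot>\<^bsub>M\<^esub> ?b i \<in> carrier M" if "i \<in> I" for i
    using f split(2) that by simp
  have "p ?g = (\<Oplus>\<^bsub>M\<^esub>i\<in>J. ?g i \<odot>\<^bsub>M\<^esub> ?b i)"
    using insert.prems(3) by (intro insert.IH J split(1) j) auto
  also have "\<dots> = (\<Oplus>\<^bsub>M\<^esub>i\<in>J. f i \<odot>\<^bsub>M\<^esub> ?b i)"
    using insert.hyps(2) terms J by (intro M.finsum_cong') auto
  finally have g: "p ?g = (\<Oplus>\<^bsub>M\<^esub>i\<in>J. f i \<odot>\<^bsub>M\<^esub> ?b i)" .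
  have J_terms: "(\<lambda>i. f i \<odot>\<^bsub>M\<^esub> ?b i) \<in> J \<rightarrow> carrier M" and j_term: "f j \<odot>\<^bsub>M\<^esub> ?b j \<in> carrier M"
    using terms J j by auto
  have "p f = p ?g \<oplus>\<^bsub>M\<^esub> f j \<odot>\<^bsub>M\<^esub> ?b j"
    by (rule split(3)[OF j])
  also have "\<dots> = f j \<odot>\<^bsub>M\<^esub> ?b j \<oplus>\<^bsub>M\<^esub> p ?g"
    unfolding g by (rule M.a_comm[OF M.finsum_closed[OF J_terms] j_term])
  also have "\<dots> = (\<Oplus>\<^bsub>M\<^esub>i\<in>insert j J. f i \<odot>\<^bsub>M\<^esub> ?b i)"
    unfolding g by (rule M.finsum_insert[OF insert.hyps J_terms j_term, symmetric])
  finally show ?case .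
qed

text \<open>
  The coordinates of a section of a free cover of \<open>M\<close> are linear forms.  Only finitely many of
  them are nonzero: each generator has finitely many nonzero coordinates, and a coordinate that
  vanishes on the generators vanishes on \<open>M\<close>.
\<close>

lemma dual_basis:
  assumes "fin_gen_module R M" "projective_module R M"
  obtains n x f where "\<And>i. i \<in> {1..n::nat} \<Longrightarrow> x i \<in> carrier M"
    and "\<And>i. i \<in> {1..n} \<Longrightarrow> f i \<in> linear_maps R M (regular_module R)"
    and "\<And>a. a \<in> carrier M \<Longrightarrow> (\<Oplus>\<^bsub>M\<^esub>i\<in>{1..n}. f i a \<odot>\<^bsub>M\<^esub> x i) = a"
proof -
  obtain I :: "'c set" and s p where s: "s \<in> linear_maps R M (free_module R I)"
    and p: "p \<in> linear_maps R (free_module R I) M" and ps: "\<And>a. a \<in> carrier M \<Longrightarrow> p (s a) = a"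
    using assms(2) unfolding projective_module_def by auto
  obtain G where G: "finite G" "G \<subseteq> carrier M"
    and gen: "\<And>m. m \<in> carrier M \<Longrightarrow> \<exists>c\<in>G \<rightarrow> carrier R. m = (\<Oplus>\<^bsub>M\<^esub>g\<in>G. c g \<odot>\<^bsub>M\<^esub> g)"
    using assms(1) unfolding fin_gen_module_def by auto
  have s_free: "s a \<in> I \<rightarrow>\<^sub>E carrier R" "finite {i \<in> I. s a i \<noteq> \<zero>}" if "a \<in> carrier M" for a
    using linear_mapsD(1)[OF s that] by auto
  have coord: "(\<lambda>a\<in>carrier M. s a i) \<in> linear_maps R M (regular_module R)" if i: "i \<in> I" for i
  proof (rule linear_mapsI)
    fix a b assume ab: "a \<in> carrier M" "b \<in> carrier M"
    then show "(\<lambda>a\<in>carrier M. s a i) (a \<oplus>\<^bsub>M\<^esub> b) =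
      (\<lambda>a\<in>carrier M. s a i) a \<oplus>\<^bsub>regular_module R\<^esub> (\<lambda>a\<in>carrier M. s a i) b"
      using i linear_mapsD(2)[OF s ab] by simp
  next
    fix r a assume ra: "r \<in> carrier R" "a \<in> carrier M"
    then show "(\<lambda>a\<in>carrier M. s a i) (r \<odot>\<^bsub>M\<^esub> a) = r \<odot>\<^bsub>regular_module R\<^esub> (\<lambda>a\<in>carrier M. s a i) a"
      using i linear_mapsD(3)[OF s ra] by simp
  qed (use i PiE_mem[OF s_free(1)] in simp_all)
  define J where "J = (\<Union>g\<in>G. {i \<in> I. s g i \<noteq> \<zero>})"
  have J: "finite J" "J \<subseteq> I"
    using G s_free(2) by (auto simp: J_def)
  have supp: "s a i = \<zero>" if a: "a \<in> carrier M" and i: "i \<in> I - J" for a i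
  proof -
    have iI: "i \<in> I" using i by simp
    note lin = linear_mapsD[OF coord[OF iI], simplified]
    have Gi: "s g i = \<zero>" if "g \<in> G" for g
      using that i by (auto simp: J_def)
    obtain c where c: "c \<in> G \<rightarrow> carrier R" and a_eq: "a = (\<Oplus>\<^bsub>M\<^esub>g\<in>G. c g \<odot>\<^bsub>M\<^esub> g)"
      using gen[OF a] by blast
    have cl: "c g \<in> carrier R" "g \<in> carrier M" if "g \<in> G" for g
      using c G(2) that by auto
    have "s a i = (\<Oplus>g\<in>G. s (c g \<odot>\<^bsub>M\<^esub> g) i)"
      unfolding a_eq using G(1) cl lin
      by (intro additive_finsum[where h = "\<lambda>a. s a i", OF M.abelian_group_axioms R.is_abelian_group]) auto
    also have "\<dots> = (\<Oplus>g\<in>G. \<zero>)"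
      using cl lin(3) Gi by (intro R.finsum_cong') auto
    finally show ?thesis by simp
  qed
  obtain e where e: "bij_betw e {1..card J} J"
    using ex_bij_betw_nat_finite_1[OF J(1)] by auto
  define b where "b j = p (\<lambda>i\<in>I. if i = j then \<one> else \<zero>)" for j
  have b: "b j \<in> carrier M" if "j \<in> I" for j
    unfolding b_def using linear_map_free_split(2)[OF R.ring_axioms p _ that] linear_mapsD(1)[OF s M.zero_closed]
    by blast
  have eJ: "e i \<in> I" if "i \<in> {1..card J}" for i
    using bij_betwE[OF e] that J(2) by auto
  show thesis
  proof
    show "b (e i) \<in> carrier M" if "i \<in> {1..card J}" for i
      using b eJ that by blast
    show "(\<lambda>a\<in>carrier M. s a (e i)) \<in> linear_maps R M (regular_module R)" if "i \<in> {1..card J}" for i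
      using coord eJ that by blast
    fix a assume a: "a \<in> carrier M"
    have sa: "s a j \<in> carrier R" if "j \<in> I" for j
      using PiE_mem[OF s_free(1)[OF a] that] .
    have "a = (\<Oplus>\<^bsub>M\<^esub>j\<in>J. s a j \<odot>\<^bsub>M\<^esub> b j)"
      unfolding b_def
      using linear_map_free_expand[OF p J linear_mapsD(1)[OF s a] supp[OF a]] ps[OF a] by simp
    also have "\<dots> = (\<Oplus>\<^bsub>M\<^esub>j\<in>e ` {1..card J}. s a j \<odot>\<^bsub>M\<^esub> b j)"
      using e by (simp add: bij_betw_def)
    also have "\<dots> = (\<Oplus>\<^bsub>M\<^esub>i\<in>{1..card J}. s a (e i) \<odot>\<^bsub>M\<^esub> b (e i))"
      using e eJ sa b J(2) by (intro M.finsum_reindex) (auto simp: bij_betw_def)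
    also have "\<dots> = (\<Oplus>\<^bsub>M\<^esub>i\<in>{1..card J}. (\<lambda>a\<in>carrier M. s a (e i)) a \<odot>\<^bsub>M\<^esub> b (e i))"
      using a eJ sa b by (intro M.finsum_cong') auto
    finally show "(\<Oplus>\<^bsub>M\<^esub>i\<in>{1..card J}. (\<lambda>a\<in>carrier M. s a (e i)) a \<odot>\<^bsub>M\<^esub> b (e i)) = a" ..
  qed
qed

end


section \<open>Separability idempotents\<close>

context enveloping
begin

text \<open>
  As the second factor is multiplied in the opposite order, the condition on \<open>e = \<Sum> u\<^sub>j \<otimes> v\<^sub>j\<close> reads
  \<open>\<Sum> z u\<^sub>j \<otimes> v\<^sub>j = \<Sum> u\<^sub>j \<otimes> v\<^sub>j z\<close>.
\<close>

abbreviation casimir_element :: "('a \<times> 'a \<Rightarrow>\<^sub>0 int) set \<Rightarrow> bool"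
  where "casimir_element e \<equiv> e \<in> carrier E.T \<and>
    (\<forall>z\<in>carrier A. E.pure z \<one>\<^bsub>A\<^esub> \<otimes>\<^bsub>E.T\<^esub> e = E.pure \<one>\<^bsub>A\<^esub> z \<otimes>\<^bsub>E.T\<^esub> e)"

text \<open>
  An element \<open>e\<close> with \<open>(z \<otimes> 1) e = (1 \<otimes> z) e\<close> makes \<open>z \<mapsto> (z \<otimes> 1) e\<close> linear over the enveloping
  algebra, and \<open>e 1 = 1\<close> makes it a section of the multiplication map \<open>X \<mapsto> X 1\<close>.  Hence \<open>A\<close> is a
  retract of the free module of rank one.
\<close>

lemma separable_if_idempotent:
  assumes e: "casimir_element e" and unit: "e \<bullet> \<one>\<^bsub>A\<^esub> = \<one>\<^bsub>A\<^esub>"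
  shows "separable_algebra R A"
proof -
  have eC: "e \<in> carrier E.T"
    and comm: "\<And>z. z \<in> carrier A \<Longrightarrow> E.pure z \<one>\<^bsub>A\<^esub> \<otimes>\<^bsub>E.T\<^esub> e = E.pure \<one>\<^bsub>A\<^esub> z \<otimes>\<^bsub>E.T\<^esub> e"
    using e by auto
  let ?F = "free_module E.T {\<one>\<^bsub>A\<^esub>}"
  define s where "s = (\<lambda>z\<in>carrier A. \<lambda>i\<in>{\<one>\<^bsub>A\<^esub>}. E.pure z \<one>\<^bsub>A\<^esub> \<otimes>\<^bsub>E.T\<^esub> e)"
  define p where "p = (\<lambda>f\<in>carrier ?F. f \<one>\<^bsub>A\<^esub> \<bullet> \<one>\<^bsub>A\<^esub>)"
  \<comment> \<open>For \<open>X = a \<otimes> b\<close> this is \<open>(a z b \<otimes> 1) e = (a z \<otimes> 1) (1 \<otimes> b) e = (a \<otimes> b) (z \<otimes> 1) e\<close>.\<close>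
  have central: "E.pure (X \<bullet> z) \<one>\<^bsub>A\<^esub> \<otimes>\<^bsub>E.T\<^esub> e = X \<otimes>\<^bsub>E.T\<^esub> (E.pure z \<one>\<^bsub>A\<^esub> \<otimes>\<^bsub>E.T\<^esub> e)"
    if "X \<in> carrier E.T" and z: "z \<in> carrier A" for X z
    using that(1)
  proof (induction X rule: E.tensor_induct)
    case (pure a b)
    then have ab: "a \<in> carrier A" "b \<in> carrier A" by simp_all
    have "E.pure (a \<otimes>\<^bsub>A\<^esub> z \<otimes>\<^bsub>A\<^esub> b) \<one>\<^bsub>A\<^esub> \<otimes>\<^bsub>E.T\<^esub> e =
        E.pure (a \<otimes>\<^bsub>A\<^esub> z) \<one>\<^bsub>A\<^esub> \<otimes>\<^bsub>E.T\<^esub> (E.pure b \<one>\<^bsub>A\<^esub> \<otimes>\<^bsub>E.T\<^esub> e)"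
      using eC ab z by (simp flip: E.T.m_assoc)
    also have "\<dots> = E.pure (a \<otimes>\<^bsub>A\<^esub> z) \<one>\<^bsub>A\<^esub> \<otimes>\<^bsub>E.T\<^esub> (E.pure \<one>\<^bsub>A\<^esub> b \<otimes>\<^bsub>E.T\<^esub> e)"
      using comm ab by simp
    also have "\<dots> = E.pure a b \<otimes>\<^bsub>E.T\<^esub> (E.pure z \<one>\<^bsub>A\<^esub> \<otimes>\<^bsub>E.T\<^esub> e)"
      using eC ab z by (simp flip: E.T.m_assoc)
    finally show ?case
      using ab z by simp
  next
    case (diff X Y)
    have pure_diff: "E.pure (u \<ominus>\<^bsub>A\<^esub> v) \<one>\<^bsub>A\<^esub> = E.pure u \<one>\<^bsub>A\<^esub> \<ominus>\<^bsub>E.T\<^esub> E.pure v \<one>\<^bsub>A\<^esub>"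
      if "u \<in> carrier A" "v \<in> carrier A" for u v
      using that
      by (intro additive_minus[where h = "\<lambda>u. E.pure u \<one>\<^bsub>A\<^esub>", OF A.is_abelian_group E.T.is_abelian_group])
         (simp_all add: E.pure_add_left)
    have "E.pure ((X \<ominus>\<^bsub>E.T\<^esub> Y) \<bullet> z) \<one>\<^bsub>A\<^esub> \<otimes>\<^bsub>E.T\<^esub> e =
      E.pure (X \<bullet> z) \<one>\<^bsub>A\<^esub> \<otimes>\<^bsub>E.T\<^esub> e \<ominus>\<^bsub>E.T\<^esub> E.pure (Y \<bullet> z) \<one>\<^bsub>A\<^esub> \<otimes>\<^bsub>E.T\<^esub> e"
      using diff(1,2) eC z
      by (simp add: act_diff_left pure_diff) (simp add: E.T.minus_eq E.T.l_distr E.T.l_minus)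
    then show ?case
      using diff eC z by (simp add: E.T.minus_eq E.T.l_distr E.T.l_minus)
  qed
  have "s \<in> linear_maps E.T (enveloping_module A) ?F"
  proof (rule linear_mapsI)
    fix X z assume "X \<in> carrier E.T" "z \<in> carrier (enveloping_module A)"
    then show "s (X \<odot>\<^bsub>enveloping_module A\<^esub> z) = X \<odot>\<^bsub>?F\<^esub> s z"
      by (simp add: s_def central cong: restrict_cong)
  next
    fix z w assume "z \<in> carrier (enveloping_module A)" "w \<in> carrier (enveloping_module A)"
    then show "s (z \<oplus>\<^bsub>enveloping_module A\<^esub> w) = s z \<oplus>\<^bsub>?F\<^esub> s w"
      using eC by (simp add: s_def E.pure_add_left E.T.l_distr cong: restrict_cong)
  qed (use eC in \<open>simp_all add: s_def\<close>)
  moreover have "p \<in> linear_maps E.T ?F (enveloping_module A)"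
    by (rule linear_mapsI) (auto simp: p_def act_mult act_add_left PiE_iff)
  moreover have "p (s z) = z" if "z \<in> carrier (enveloping_module A)" for z
    using that eC unit by (simp add: p_def s_def act_mult)
  ultimately show ?thesis
    unfolding separable_algebra_def projective_module_def enveloping_ring_def by blast
qed

lemma idempotent_if_separable:
  assumes "separable_algebra R A"
  obtains e where "casimir_element e" "e \<bullet> \<one>\<^bsub>A\<^esub> = \<one>\<^bsub>A\<^esub>"
proof -
  obtain I :: "'a set" and s p where
    s: "s \<in> linear_maps E.T (enveloping_module A) (free_module E.T I)" and
    p: "p \<in> linear_maps E.T (free_module E.T I) (enveloping_module A)" and
    ps: "\<And>z. z \<in> carrier A \<Longrightarrow> p (s z) = z"
    using assms unfolding separable_algebra_def projective_module_def enveloping_ring_def by auto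
  let ?F = "free_module E.T I"
  let ?l = "\<lambda>z. E.pure z \<one>\<^bsub>A\<^esub>" and ?r = "\<lambda>z. E.pure \<one>\<^bsub>A\<^esub> z"
  have M: "abelian_group (enveloping_module A)"
    using A.is_abelian_group by (rule abelian_group_cong) simp_all
  \<comment> \<open>The components of \<open>s 1\<close> commute with \<open>A\<close>, so that \<open>e = \<Sum> (s 1)\<^sub>i (p(\<delta>\<^sub>i) \<otimes> 1)\<close> does as well,
    and it acts on \<open>1\<close> as \<open>\<Sum> (s 1)\<^sub>i p(\<delta>\<^sub>i) = p (s 1) = 1\<close>.  The sum is built one component
    at a time.\<close>
  have collapse: "\<exists>e. casimir_element e \<and> e \<bullet> \<one>\<^bsub>A\<^esub> = p f"
    if "finite J" "{i \<in> I. f i \<noteq> \<zero>\<^bsub>E.T\<^esub>} = J" "f \<in> carrier ?F"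
      "\<forall>i\<in>I. casimir_element (f i)" for f J
    using that
  proof (induction J arbitrary: f rule: finite_induct)
    case empty
    have "p f = \<zero>\<^bsub>enveloping_module A\<^esub>"
      using empty(1) by (intro linear_map_free_zero[OF E.T.ring_axioms M p empty(2)]) blast
    then show ?case
      by (intro exI[of _ "\<zero>\<^bsub>E.T\<^esub>"]) simp
  next
    case (insert j J)
    have "j \<in> {i \<in> I. f i \<noteq> \<zero>\<^bsub>E.T\<^esub>}"
      unfolding insert.prems(1) by simp
    then have j: "j \<in> I" by simp
    have fj: "f j \<in> carrier E.T"
      using insert.prems(2) j by auto
    define g where "g = f(j := \<zero>\<^bsub>E.T\<^esub>)"
    define m where "m = p (\<lambda>i\<in>I. if i = j then \<one>\<^bsub>E.T\<^esub> else \<zero>\<^bsub>E.T\<^esub>)"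
    note split = linear_map_free_split[OF E.T.ring_axioms p insert.prems(2) j, folded g_def m_def,
        unfolded enveloping_module_simps]
    have "{i \<in> I. g i \<noteq> \<zero>\<^bsub>E.T\<^esub>} = {i \<in> I. f i \<noteq> \<zero>\<^bsub>E.T\<^esub>} - {j}"
      by (auto simp: g_def)
    also have "\<dots> = J"
      unfolding insert.prems(1) using insert.hyps(2) by simp
    finally have supp: "{i \<in> I. g i \<noteq> \<zero>\<^bsub>E.T\<^esub>} = J" .
    obtain e where e: "casimir_element e" "e \<bullet> \<one>\<^bsub>A\<^esub> = p g"
      using insert.IH[OF supp split(1)] insert.prems(3) by (fastforce simp: g_def)
    have "(e \<oplus>\<^bsub>E.T\<^esub> f j \<otimes>\<^bsub>E.T\<^esub> ?l m) \<bullet> \<one>\<^bsub>A\<^esub> = p g \<oplus>\<^bsub>A\<^esub> f j \<bullet> m"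
      using e fj split(2) by (simp add: act_add_left act_mult)
    also have "\<dots> = p f"
      by (rule split(3)[symmetric])
    finally have "(e \<oplus>\<^bsub>E.T\<^esub> f j \<otimes>\<^bsub>E.T\<^esub> ?l m) \<bullet> \<one>\<^bsub>A\<^esub> = p f" .
    moreover have "casimir_element (e \<oplus>\<^bsub>E.T\<^esub> f j \<otimes>\<^bsub>E.T\<^esub> ?l m)"
      using e(1) insert.prems(3) j split(2) by (simp add: E.T.r_distr flip: E.T.m_assoc)
    ultimately show ?case by blast
  qed
  have s1: "s \<one>\<^bsub>A\<^esub> \<in> carrier ?F"
    using linear_mapsD(1)[OF s] by simp
  have "casimir_element (s \<one>\<^bsub>A\<^esub> i)" if i: "i \<in> I" for i
  proof -
    have "?l z \<otimes>\<^bsub>E.T\<^esub> s \<one>\<^bsub>A\<^esub> i = ?r z \<otimes>\<^bsub>E.T\<^esub> s \<one>\<^bsub>A\<^esub> i" if z: "z \<in> carrier A" for z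
    proof -
      have "?l z \<odot>\<^bsub>?F\<^esub> s \<one>\<^bsub>A\<^esub> = s (?l z \<bullet> \<one>\<^bsub>A\<^esub>)"
        by (rule linear_mapsD(3)[OF s, symmetric]) (use z in simp_all)
      also have "\<dots> = s (?r z \<bullet> \<one>\<^bsub>A\<^esub>)"
        using z by simp
      also have "\<dots> = ?r z \<odot>\<^bsub>?F\<^esub> s \<one>\<^bsub>A\<^esub>"
        by (rule linear_mapsD(3)[OF s]) (use z in simp_all)
      finally have "(?l z \<odot>\<^bsub>?F\<^esub> s \<one>\<^bsub>A\<^esub>) i = (?r z \<odot>\<^bsub>?F\<^esub> s \<one>\<^bsub>A\<^esub>) i"
        by (rule arg_cong)
      then show ?thesis
        using i by simp
    qed
    then show ?thesis
      using s1 i by (auto simp: PiE_iff)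
  qed
  then obtain e where "casimir_element e" "e \<bullet> \<one>\<^bsub>A\<^esub> = p (s \<one>\<^bsub>A\<^esub>)"
    using collapse[OF _ refl s1] s1 by auto
  then show ?thesis
    using that ps by simp
qed

end


section \<open>Casimir operators and the criterion of Higman\<close>

text \<open>
  The trace \<open>a \<mapsto> \<beta>(a, 1)\<close> of a Frobenius form \<open>\<beta>\<close> with a pair of dual bases.  The associative form
  is recovered as \<open>\<beta>(a, b) = tr (a b)\<close>, and its nonsingularity is expressed by the two expansions.
\<close>

locale frobenius_trace = enveloping R A
  for R :: "('r, 'l) ring_scheme" and A :: "('r, 'a, 'm) module_scheme" (structure) +
  fixes tr :: "'a \<Rightarrow> 'r" and I :: "'i set" and X Y :: "'i \<Rightarrow> 'a"
  assumes finite_I: "finite I"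
    and X_closed [simp]: "i \<in> I \<Longrightarrow> X i \<in> carrier A"
    and Y_closed [simp]: "i \<in> I \<Longrightarrow> Y i \<in> carrier A"
    and tr_closed [simp]: "a \<in> carrier A \<Longrightarrow> tr a \<in> carrier R"
    and tr_add: "a \<in> carrier A \<Longrightarrow> b \<in> carrier A \<Longrightarrow> tr (a \<oplus> b) = tr a \<oplus>\<^bsub>R\<^esub> tr b"
    and tr_smult: "r \<in> carrier R \<Longrightarrow> a \<in> carrier A \<Longrightarrow> tr (r \<odot> a) = r \<otimes>\<^bsub>R\<^esub> tr a"
    and expand_X: "a \<in> carrier A \<Longrightarrow> (\<Oplus>i\<in>I. tr (a \<otimes> Y i) \<odot> X i) = a"
    and expand_Y: "a \<in> carrier A \<Longrightarrow> (\<Oplus>i\<in>I. tr (X i \<otimes> a) \<odot> Y i) = a"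
begin

definition casimir :: "'a \<Rightarrow> 'a" where "casimir a = (\<Oplus>i\<in>I. Y i \<otimes> a \<otimes> X i)"

lemma casimir_closed [simp]: "a \<in> carrier A \<Longrightarrow> casimir a \<in> carrier A"
  unfolding casimir_def by (intro A.finsum_closed) auto

text \<open>
  The identity \<open>\<Sum> z y\<^sub>i \<otimes> x\<^sub>i = \<Sum> y\<^sub>i \<otimes> x\<^sub>i z\<close>, tested on balanced maps.  Expanding \<open>z y\<^sub>i\<close> in the
  \<open>y\<^sub>j\<close>, moving the coefficients \<open>tr (x\<^sub>j z y\<^sub>i)\<close> across, and summing over \<open>i\<close> gives \<open>x\<^sub>j z\<close> in the second
  argument.
\<close>

lemma casimir_invariance:
  assumes G: "abelian_group G" and \<theta>: "balanced R A A G \<theta>" and z: "z \<in> carrier A"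
  shows "(\<Oplus>\<^bsub>G\<^esub>i\<in>I. \<theta> (z \<otimes> Y i) (X i)) = (\<Oplus>\<^bsub>G\<^esub>i\<in>I. \<theta> (Y i) (X i \<otimes> z))"
proof -
  interpret G: abelian_group G by fact
  note \<theta>_closed = balanced_closed[OF \<theta>]
  have add_left: "\<theta> (a \<oplus> a') b = \<theta> a b \<oplus>\<^bsub>G\<^esub> \<theta> a' b"
    if "a \<in> carrier A" "a' \<in> carrier A" "b \<in> carrier A" for a a' b
    using \<theta> that unfolding balanced_def by blast
  have add_right: "\<theta> b (a \<oplus> a') = \<theta> b a \<oplus>\<^bsub>G\<^esub> \<theta> b a'"
    if "a \<in> carrier A" "a' \<in> carrier A" "b \<in> carrier A" for a a' b
    using \<theta> that unfolding balanced_def by blast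
  have scalar: "\<theta> (r \<odot> a) b = \<theta> a (r \<odot> b)"
    if "r \<in> carrier R" "a \<in> carrier A" "b \<in> carrier A" for r a b
    using \<theta> that unfolding balanced_def by blast
  define t where "t i j = tr (X j \<otimes> (z \<otimes> Y i))" for i j
  have t [simp]: "t i j \<in> carrier R" if "i \<in> I" "j \<in> I" for i j
    using that z by (simp add: t_def)
  have "(\<Oplus>\<^bsub>G\<^esub>i\<in>I. \<theta> (z \<otimes> Y i) (X i)) = (\<Oplus>\<^bsub>G\<^esub>i\<in>I. \<Oplus>\<^bsub>G\<^esub>j\<in>I. \<theta> (Y j) (t i j \<odot> X i))"
  proof (rule G.finsum_cong')
    fix i assume i: "i \<in> I"
    have "\<theta> (z \<otimes> Y i) (X i) = \<theta> (\<Oplus>j\<in>I. t i j \<odot> Y j) (X i)"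
      using expand_Y[of "z \<otimes> Y i"] i z by (simp add: t_def)
    also have "\<dots> = (\<Oplus>\<^bsub>G\<^esub>j\<in>I. \<theta> (t i j \<odot> Y j) (X i))"
      using i finite_I by (intro additive_finsum[OF A.is_abelian_group G]) (auto simp: \<theta>_closed add_left)
    also have "\<dots> = (\<Oplus>\<^bsub>G\<^esub>j\<in>I. \<theta> (Y j) (t i j \<odot> X i))"
      using i by (intro G.finsum_cong') (auto simp: scalar \<theta>_closed)
    finally show "\<theta> (z \<otimes> Y i) (X i) = (\<Oplus>\<^bsub>G\<^esub>j\<in>I. \<theta> (Y j) (t i j \<odot> X i))" .
  qed (auto intro!: G.finsum_closed simp: \<theta>_closed)
  also have "\<dots> = (\<Oplus>\<^bsub>G\<^esub>j\<in>I. \<Oplus>\<^bsub>G\<^esub>i\<in>I. \<theta> (Y j) (t i j \<odot> X i))"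
    using finite_I by (intro G.finsum_swap) (auto simp: \<theta>_closed)
  also have "\<dots> = (\<Oplus>\<^bsub>G\<^esub>j\<in>I. \<theta> (Y j) (X j \<otimes> z))"
  proof (rule G.finsum_cong')
    fix j assume j: "j \<in> I"
    have "(\<Oplus>\<^bsub>G\<^esub>i\<in>I. \<theta> (Y j) (t i j \<odot> X i)) = \<theta> (Y j) (\<Oplus>i\<in>I. t i j \<odot> X i)"
      using j finite_I
      by (intro additive_finsum[OF A.is_abelian_group G, symmetric]) (auto simp: \<theta>_closed add_right)
    also have "(\<Oplus>i\<in>I. t i j \<odot> X i) = (\<Oplus>i\<in>I. tr ((X j \<otimes> z) \<otimes> Y i) \<odot> X i)"
      using j z by (intro A.finsum_cong') (auto simp: t_def A.m_assoc)
    also have "\<dots> = X j \<otimes> z"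
      using j z by (intro expand_X) simp
    finally show "(\<Oplus>\<^bsub>G\<^esub>i\<in>I. \<theta> (Y j) (t i j \<odot> X i)) = \<theta> (Y j) (X j \<otimes> z)" .
  qed (use z in \<open>auto simp: \<theta>_closed\<close>)
  finally show ?thesis .
qed

lemma casimir_central:
  assumes a: "a \<in> carrier A" and z: "z \<in> carrier A"
  shows "z \<otimes> casimir a = casimir a \<otimes> z"
proof -
  have "balanced R A A A (\<lambda>u v. u \<otimes> a \<otimes> v)"
    using a by (intro balancedI) (simp_all add: A.l_distr A.r_distr smult_mult_left smult_mult_right)
  from casimir_invariance[OF A.is_abelian_group this z]
  have *: "(\<Oplus>i\<in>I. z \<otimes> Y i \<otimes> a \<otimes> X i) = (\<Oplus>i\<in>I. Y i \<otimes> a \<otimes> (X i \<otimes> z))" .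
  have "z \<otimes> casimir a = (\<Oplus>i\<in>I. z \<otimes> (Y i \<otimes> a \<otimes> X i))"
    unfolding casimir_def using a z finite_I by (intro A.finsum_rdistr) auto
  also have "\<dots> = (\<Oplus>i\<in>I. z \<otimes> Y i \<otimes> a \<otimes> X i)"
    using a z by (intro A.finsum_cong') (auto simp: A.m_assoc)
  also note *
  also have "(\<Oplus>i\<in>I. Y i \<otimes> a \<otimes> (X i \<otimes> z)) = (\<Oplus>i\<in>I. (Y i \<otimes> a \<otimes> X i) \<otimes> z)"
    using a z by (intro A.finsum_cong') (auto simp: A.m_assoc)
  also have "\<dots> = casimir a \<otimes> z"
    unfolding casimir_def using a z finite_I by (intro A.finsum_ldistr[symmetric]) auto
  finally show ?thesis .
qed

lemma casimir_mult_central: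
  assumes a: "a \<in> carrier A" and z: "z \<in> carrier A"
    and central: "\<And>b. b \<in> carrier A \<Longrightarrow> b \<otimes> z = z \<otimes> b"
  shows "casimir a \<otimes> z = casimir (a \<otimes> z)"
proof -
  have "casimir a \<otimes> z = (\<Oplus>i\<in>I. (Y i \<otimes> a \<otimes> X i) \<otimes> z)"
    unfolding casimir_def using a z finite_I by (intro A.finsum_ldistr) auto
  also have "\<dots> = casimir (a \<otimes> z)"
    unfolding casimir_def using a z by (intro A.finsum_cong') (auto simp: A.m_assoc central[OF X_closed])
  finally show ?thesis .
qed

lemma casimir_smult:
  assumes "r \<in> carrier R" "a \<in> carrier A"
  shows "casimir (r \<odot> a) = r \<odot> casimir a"
proof -
  have "casimir (r \<odot> a) = (\<Oplus>i\<in>I. r \<odot> (Y i \<otimes> a \<otimes> X i))"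
    unfolding casimir_def using assms
    by (intro A.finsum_cong') (auto simp: smult_mult_left smult_mult_right)
  also have "\<dots> = r \<odot> casimir a"
    unfolding casimir_def using assms finite_I
    by (intro additive_finsum[OF A.is_abelian_group A.is_abelian_group, symmetric]) (auto simp: smult_r_distr)
  finally show ?thesis .
qed

lemma separable_if_casimir_one:
  assumes a: "a \<in> carrier A" and one: "casimir a = \<one>"
  shows "separable_algebra R A"
proof (rule separable_if_idempotent)
  define e where "e = (\<Oplus>\<^bsub>E.T\<^esub>i\<in>I. E.pure (Y i \<otimes> a) (X i))"
  have eC: "e \<in> carrier E.T"
    unfolding e_def using a by (intro E.T.finsum_closed) auto
  have bal: "balanced R A A E.T (\<lambda>u v. E.pure (u \<otimes> a) v)"
    using a by (intro balancedI)
      (simp_all add: A.l_distr smult_mult_left E.pure_add_left E.pure_add_right[simplified] E.pure_scalar)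
  show "casimir_element e"
  proof (intro conjI ballI eC)
    fix z assume z: "z \<in> carrier A"
    have "E.pure z \<one> \<otimes>\<^bsub>E.T\<^esub> e = (\<Oplus>\<^bsub>E.T\<^esub>i\<in>I. E.pure z \<one> \<otimes>\<^bsub>E.T\<^esub> E.pure (Y i \<otimes> a) (X i))"
      unfolding e_def using a z finite_I by (intro E.T.finsum_rdistr) auto
    also have "\<dots> = (\<Oplus>\<^bsub>E.T\<^esub>i\<in>I. E.pure (z \<otimes> Y i \<otimes> a) (X i))"
      using a z by (intro E.T.finsum_cong') (auto simp: A.m_assoc)
    also have "\<dots> = (\<Oplus>\<^bsub>E.T\<^esub>i\<in>I. E.pure (Y i \<otimes> a) (X i \<otimes> z))"
      by (rule casimir_invariance[OF E.T.is_abelian_group bal z])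
    also have "\<dots> = (\<Oplus>\<^bsub>E.T\<^esub>i\<in>I. E.pure \<one> z \<otimes>\<^bsub>E.T\<^esub> E.pure (Y i \<otimes> a) (X i))"
      using a z by (intro E.T.finsum_cong') auto
    also have "\<dots> = E.pure \<one> z \<otimes>\<^bsub>E.T\<^esub> e"
      unfolding e_def using a z finite_I by (intro E.T.finsum_rdistr[symmetric]) auto
    finally show "E.pure z \<one> \<otimes>\<^bsub>E.T\<^esub> e = E.pure \<one> z \<otimes>\<^bsub>E.T\<^esub> e" .
  qed
  have "e \<bullet> \<one> = (\<Oplus>i\<in>I. E.pure (Y i \<otimes> a) (X i) \<bullet> \<one>)"
    unfolding e_def using a finite_I
    by (intro additive_finsum[OF E.T.is_abelian_group A.is_abelian_group]) (auto simp: act_add_left)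
  also have "\<dots> = casimir a"
    unfolding casimir_def using a by (intro A.finsum_cong') auto
  finally show "e \<bullet> \<one> = \<one>"
    by (simp add: one)
qed

text \<open>
  For a separability idempotent \<open>e = \<Sum> u\<^sub>j \<otimes> v\<^sub>j\<close>, let \<open>a = \<Lambda>(e) = \<Sum> tr(u\<^sub>j) v\<^sub>j\<close>.  Since
  \<open>\<Lambda>((x \<otimes> 1) e) = \<Lambda>((1 \<otimes> x) e) = a x\<close>, the Casimir operator has the value
  \<open>\<Sum> y\<^sub>i a x\<^sub>i = \<Sum>\<^sub>j (\<Sum>\<^sub>i tr(x\<^sub>i u\<^sub>j) y\<^sub>i) v\<^sub>j = \<Sum> u\<^sub>j v\<^sub>j = 1\<close> at \<open>a\<close>.
\<close>

lemma casimir_one_if_separable: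
  assumes "separable_algebra R A"
  obtains a where "a \<in> carrier A" "casimir a = \<one>"
proof -
  obtain e where e: "casimir_element e" "e \<bullet> \<one> = \<one>"
    using idempotent_if_separable[OF assms] .
  then have eC: "e \<in> carrier E.T" by simp
  define \<Lambda> where "\<Lambda> = tensor_lift A (\<lambda>u v. tr u \<odot> v)"
  have bal: "balanced R A (opposite A) A (\<lambda>u v. tr u \<odot> v)"
    by (intro balancedI)
      (simp_all add: tr_add smult_l_distr smult_r_distr tr_smult R.m_comm flip: smult_assoc1)
  have \<Lambda>_closed [simp]: "\<Lambda> U \<in> carrier A" if "U \<in> carrier E.T" for U
    unfolding \<Lambda>_def using that by (intro E.tensor_lift_closed A.is_abelian_group bal)
  have \<Lambda>_add: "\<Lambda> (U \<oplus>\<^bsub>E.T\<^esub> V) = \<Lambda> U \<oplus> \<Lambda> V" if "U \<in> carrier E.T" "V \<in> carrier E.T" for U V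
    unfolding \<Lambda>_def using that by (intro E.tensor_lift_add A.is_abelian_group bal)
  have \<Lambda>_pure: "\<Lambda> (E.pure u v) = tr u \<odot> v" if "u \<in> carrier A" "v \<in> carrier A" for u v
    unfolding \<Lambda>_def using that by (simp add: A.is_abelian_group bal)
  have \<Lambda>_right: "\<Lambda> (E.pure \<one> z \<otimes>\<^bsub>E.T\<^esub> U) = \<Lambda> U \<otimes> z" if U: "U \<in> carrier E.T" and z: "z \<in> carrier A" for U z
    by (rule E.additive_ext[OF A.is_abelian_group _ _ _ _ _ U])
       (use z in \<open>simp_all add: \<Lambda>_add \<Lambda>_pure E.T.r_distr A.l_distr smult_mult_left\<close>)
  have recover: "(\<Oplus>i\<in>I. Y i \<otimes> \<Lambda> (E.pure (X i) \<one> \<otimes>\<^bsub>E.T\<^esub> U)) = U \<bullet> \<one>" if U: "U \<in> carrier E.T" for U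
  proof (rule E.additive_ext[OF A.is_abelian_group _ _ _ _ _ U])
    fix u v assume "u \<in> carrier A" "v \<in> carrier (opposite A)"
    then have u: "u \<in> carrier A" and v: "v \<in> carrier A" by simp_all
    have "(\<Oplus>i\<in>I. Y i \<otimes> \<Lambda> (E.pure (X i) \<one> \<otimes>\<^bsub>E.T\<^esub> E.pure u v)) = (\<Oplus>i\<in>I. (tr (X i \<otimes> u) \<odot> Y i) \<otimes> v)"
      using u v by (intro A.finsum_cong') (auto simp: \<Lambda>_pure smult_mult_left smult_mult_right)
    also have "\<dots> = (\<Oplus>i\<in>I. tr (X i \<otimes> u) \<odot> Y i) \<otimes> v"
      using u v finite_I by (intro A.finsum_ldistr[symmetric]) auto
    also have "\<dots> = E.pure u v \<bullet> \<one>"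
      using u v by (simp add: expand_Y)
    finally show "(\<Oplus>i\<in>I. Y i \<otimes> \<Lambda> (E.pure (X i) \<one> \<otimes>\<^bsub>E.T\<^esub> E.pure u v)) = E.pure u v \<bullet> \<one>" .
  next
    fix U V assume UV: "U \<in> carrier E.T" "V \<in> carrier E.T"
    have "(\<Oplus>i\<in>I. Y i \<otimes> \<Lambda> (E.pure (X i) \<one> \<otimes>\<^bsub>E.T\<^esub> (U \<oplus>\<^bsub>E.T\<^esub> V))) =
      (\<Oplus>i\<in>I. Y i \<otimes> \<Lambda> (E.pure (X i) \<one> \<otimes>\<^bsub>E.T\<^esub> U) \<oplus> Y i \<otimes> \<Lambda> (E.pure (X i) \<one> \<otimes>\<^bsub>E.T\<^esub> V))"
      using UV by (intro A.finsum_cong') (auto simp: E.T.r_distr \<Lambda>_add A.r_distr)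
    also have "\<dots> = (\<Oplus>i\<in>I. Y i \<otimes> \<Lambda> (E.pure (X i) \<one> \<otimes>\<^bsub>E.T\<^esub> U)) \<oplus> (\<Oplus>i\<in>I. Y i \<otimes> \<Lambda> (E.pure (X i) \<one> \<otimes>\<^bsub>E.T\<^esub> V))"
      using UV by (intro A.finsum_addf) auto
    finally show "(\<Oplus>i\<in>I. Y i \<otimes> \<Lambda> (E.pure (X i) \<one> \<otimes>\<^bsub>E.T\<^esub> (U \<oplus>\<^bsub>E.T\<^esub> V))) =
      (\<Oplus>i\<in>I. Y i \<otimes> \<Lambda> (E.pure (X i) \<one> \<otimes>\<^bsub>E.T\<^esub> U)) \<oplus> (\<Oplus>i\<in>I. Y i \<otimes> \<Lambda> (E.pure (X i) \<one> \<otimes>\<^bsub>E.T\<^esub> V))" .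
  qed (auto intro!: A.finsum_closed simp: act_add_left)
  have "casimir (\<Lambda> e) = (\<Oplus>i\<in>I. Y i \<otimes> \<Lambda> (E.pure (X i) \<one> \<otimes>\<^bsub>E.T\<^esub> e))"
    unfolding casimir_def
  proof (rule A.finsum_cong')
    fix i assume i: "i \<in> I"
    have "\<Lambda> (E.pure (X i) \<one> \<otimes>\<^bsub>E.T\<^esub> e) = \<Lambda> (E.pure \<one> (X i) \<otimes>\<^bsub>E.T\<^esub> e)"
      using e(1) i by simp
    also have "\<dots> = \<Lambda> e \<otimes> X i"
      using eC i by (intro \<Lambda>_right) auto
    finally show "Y i \<otimes> \<Lambda> e \<otimes> X i = Y i \<otimes> \<Lambda> (E.pure (X i) \<one> \<otimes>\<^bsub>E.T\<^esub> e)"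
      using i eC by (simp add: A.m_assoc)
  qed (use eC in auto)
  also have "\<dots> = \<one>"
    using recover[OF eC] e(2) by simp
  finally have "casimir (\<Lambda> e) = \<one>" .
  then show ?thesis
    by (rule that[OF \<Lambda>_closed[OF eC]])
qed

end


section \<open>Base change\<close>

text \<open>
  The scalar multiplication \<open>\<sigma>\<close> turns the commutative ring \<open>L\<close> into an \<open>R\<close>-algebra.  Keeping the
  ring apart from its extension by \<open>\<sigma>\<close> matches \<open>residue_field\<close> and \<open>residue_algebra\<close>.
\<close>

locale base_change_setup = A: assoc_algebra R A + K: cring L
  for R :: "('r, 'l) ring_scheme" and A :: "('r, 'a, 'm) module_scheme" and L :: "'k ring"
    and \<sigma> :: "'r \<Rightarrow> 'k \<Rightarrow> 'k" +
  assumes assoc_algebra_extend: "assoc_algebra R (ring.extend L \<lparr>smult = \<sigma>\<rparr>)"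
begin

abbreviation K where "K \<equiv> ring.extend L \<lparr>smult = \<sigma>\<rparr>"
abbreviation AK where "AK \<equiv> base_change R A K"

sublocale P: algebra_pair R A K
  by (intro algebra_pair.intro A.assoc_algebra_axioms assoc_algebra_extend)

abbreviation pure (infixl "\<otimes>\<otimes>" 75) where "a \<otimes>\<otimes> b \<equiv> pure_tensor R A K a b"

lemma base_change_simps [simp]:
  "carrier AK = carrier P.T"
  "monoid.mult AK = monoid.mult P.T"
  "one AK = one P.T"
  "ring.zero AK = ring.zero P.T"
  "add AK = add P.T"
  "a_minus AK = a_minus P.T"
  by (simp_all add: base_change_def)

lemma base_change_smult: "k \<odot>\<^bsub>AK\<^esub> X = (\<one>\<^bsub>A\<^esub> \<otimes>\<otimes> k) \<otimes>\<^bsub>P.T\<^esub> X"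
  by (simp add: base_change_def)

lemma smult_pure [simp]:
  "a \<in> carrier A \<Longrightarrow> k \<in> carrier L \<Longrightarrow> l \<in> carrier L \<Longrightarrow> k \<odot>\<^bsub>AK\<^esub> (a \<otimes>\<otimes> l) = a \<otimes>\<otimes> (k \<otimes>\<^bsub>L\<^esub> l)"
  by (simp add: base_change_smult)

lemma pure_central:
  assumes "X \<in> carrier P.T" "k \<in> carrier L"
  shows "(\<one>\<^bsub>A\<^esub> \<otimes>\<otimes> k) \<otimes>\<^bsub>P.T\<^esub> X = X \<otimes>\<^bsub>P.T\<^esub> (\<one>\<^bsub>A\<^esub> \<otimes>\<otimes> k)"
  using assms(1)
proof (induction X rule: P.tensor_induct)
  case (pure a l)
  then show ?case using assms by (simp add: K.m_comm)
next
  case (diff X Y)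
  then show ?case
    using assms by (simp add: P.T.minus_eq P.T.r_distr P.T.l_distr P.T.r_minus P.T.l_minus)
qed

sublocale AK: enveloping L AK
proof (intro enveloping.intro assoc_algebraI)
  show "cring L" by (rule K.is_cring)
  show "ring AK"
    unfolding base_change_def by (rule ring_extend) (rule P.T.ring_axioms)
  fix k X Y assume k: "k \<in> carrier L" and X: "X \<in> carrier AK" and Y: "Y \<in> carrier AK"
  show "k \<odot>\<^bsub>AK\<^esub> X \<in> carrier AK"
    using k X by (simp add: base_change_smult)
  show "k \<odot>\<^bsub>AK\<^esub> (X \<oplus>\<^bsub>AK\<^esub> Y) = k \<odot>\<^bsub>AK\<^esub> X \<oplus>\<^bsub>AK\<^esub> k \<odot>\<^bsub>AK\<^esub> Y"
    using k X Y by (simp add: base_change_smult P.T.r_distr)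
  show "(k \<odot>\<^bsub>AK\<^esub> X) \<otimes>\<^bsub>AK\<^esub> Y = k \<odot>\<^bsub>AK\<^esub> (X \<otimes>\<^bsub>AK\<^esub> Y)"
    using k X Y by (simp add: base_change_smult P.T.m_assoc)
  show "X \<otimes>\<^bsub>AK\<^esub> (k \<odot>\<^bsub>AK\<^esub> Y) = k \<odot>\<^bsub>AK\<^esub> (X \<otimes>\<^bsub>AK\<^esub> Y)"
    using k X Y pure_central[of X k] by (simp add: base_change_smult flip: P.T.m_assoc)
next
  fix k l X assume k: "k \<in> carrier L" and l: "l \<in> carrier L" and X: "X \<in> carrier AK"
  show "(k \<oplus>\<^bsub>L\<^esub> l) \<odot>\<^bsub>AK\<^esub> X = k \<odot>\<^bsub>AK\<^esub> X \<oplus>\<^bsub>AK\<^esub> l \<odot>\<^bsub>AK\<^esub> X"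
    using P.pure_add_right[of "\<one>\<^bsub>A\<^esub>" k l] k l X by (simp add: base_change_smult P.T.l_distr)
  show "(k \<otimes>\<^bsub>L\<^esub> l) \<odot>\<^bsub>AK\<^esub> X = k \<odot>\<^bsub>AK\<^esub> (l \<odot>\<^bsub>AK\<^esub> X)"
    using P.pure_mult[of "\<one>\<^bsub>A\<^esub>" k "\<one>\<^bsub>A\<^esub>" l] k l X by (simp add: base_change_smult flip: P.T.m_assoc)
next
  fix X assume "X \<in> carrier AK"
  then have "\<one>\<^bsub>P.T\<^esub> \<otimes>\<^bsub>P.T\<^esub> X = X"
    by (intro P.T.l_one) simp
  then show "\<one>\<^bsub>L\<^esub> \<odot>\<^bsub>AK\<^esub> X = X"
    unfolding P.pure_one base_change_smult ring_extend_simps .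
qed

end

lemma assoc_algebra_of_hom:
  assumes "cring R" "cring L" and \<iota>: "\<iota> \<in> ring_hom R L"
  shows "assoc_algebra R (ring.extend L \<lparr>smult = \<lambda>r k. \<iota> r \<otimes>\<^bsub>L\<^esub> k\<rparr>)"
proof -
  interpret R: cring R by fact
  interpret L: cring L by fact
  have [simp]: "\<iota> r \<in> carrier L" if "r \<in> carrier R" for r
    using ring_hom_closed[OF \<iota> that] .
  show ?thesis
    by (rule assoc_algebraI[OF R.is_cring ring_extend[OF L.ring_axioms]]; unfold ring_extend_simps)
       (simp_all add: ring_hom_add[OF \<iota>] ring_hom_mult[OF \<iota>] ring_hom_one[OF \<iota>] L.l_distr L.r_distr
         L.m_assoc L.m_lcomm)
qed

locale trace_base_change = base_change_setup R A L "\<lambda>r k. \<iota> r \<otimes>\<^bsub>L\<^esub> k" + F: frobenius_trace R A tr I X Y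
  for R :: "('r, 'l) ring_scheme" and A :: "('r, 'a, 'm) module_scheme" and L :: "'k ring"
    and \<iota> :: "'r \<Rightarrow> 'k" and tr :: "'a \<Rightarrow> 'r" and I :: "'i set" and X Y :: "'i \<Rightarrow> 'a" +
  assumes \<iota>: "\<iota> \<in> ring_hom R L"
begin

notation pure (infixl "\<otimes>\<otimes>" 75)

lemma \<iota>_closed [simp]: "r \<in> carrier R \<Longrightarrow> \<iota> r \<in> carrier L"
  by (rule ring_hom_closed[OF \<iota>])

definition trK where "trK = tensor_lift L (\<lambda>a k. \<iota> (tr a) \<otimes>\<^bsub>L\<^esub> k)"

lemma L_abelian_group: "abelian_group L" and AK_abelian_group: "abelian_group AK"
  by (rule K.is_abelian_group, rule AK.A.is_abelian_group)

lemma balanced_trK: "balanced R A K L (\<lambda>a k. \<iota> (tr a) \<otimes>\<^bsub>L\<^esub> k)"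
  by (rule balancedI)
     (simp_all add: F.tr_add F.tr_smult ring_hom_add[OF \<iota>] ring_hom_mult[OF \<iota>] K.l_distr K.r_distr
       K.m_assoc K.m_lcomm)

lemma trK_closed [simp]: "U \<in> carrier P.T \<Longrightarrow> trK U \<in> carrier L"
  unfolding trK_def by (rule P.tensor_lift_closed[OF L_abelian_group balanced_trK])

lemma trK_add: "U \<in> carrier P.T \<Longrightarrow> V \<in> carrier P.T \<Longrightarrow> trK (U \<oplus>\<^bsub>P.T\<^esub> V) = trK U \<oplus>\<^bsub>L\<^esub> trK V"
  unfolding trK_def by (rule P.tensor_lift_add[OF L_abelian_group balanced_trK])

lemma trK_pure: "a \<in> carrier A \<Longrightarrow> k \<in> carrier L \<Longrightarrow> trK (a \<otimes>\<otimes> k) = \<iota> (tr a) \<otimes>\<^bsub>L\<^esub> k"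
  unfolding trK_def by (rule P.tensor_lift_pure[OF L_abelian_group balanced_trK]) simp_all

lemma pure_scalar:
  "r \<in> carrier R \<Longrightarrow> a \<in> carrier A \<Longrightarrow> k \<in> carrier L \<Longrightarrow> (r \<odot>\<^bsub>A\<^esub> a) \<otimes>\<otimes> k = a \<otimes>\<otimes> (\<iota> r \<otimes>\<^bsub>L\<^esub> k)"
  using P.pure_scalar[of r a k] by simp

lemma pure_add_right:
  "a \<in> carrier A \<Longrightarrow> k \<in> carrier L \<Longrightarrow> l \<in> carrier L \<Longrightarrow>
    a \<otimes>\<otimes> (k \<oplus>\<^bsub>L\<^esub> l) = (a \<otimes>\<otimes> k) \<oplus>\<^bsub>P.T\<^esub> (a \<otimes>\<otimes> l)"
  using P.pure_add_right[of a k l] by simp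

lemma trK_smult:
  assumes k: "k \<in> carrier L" and U: "U \<in> carrier P.T"
  shows "trK (k \<odot>\<^bsub>AK\<^esub> U) = k \<otimes>\<^bsub>L\<^esub> trK U"
proof (rule P.additive_ext[OF L_abelian_group _ _ _ _ _ U])
  fix a l assume "a \<in> carrier A" "l \<in> carrier K"
  then show "trK (k \<odot>\<^bsub>AK\<^esub> (a \<otimes>\<otimes> l)) = k \<otimes>\<^bsub>L\<^esub> trK (a \<otimes>\<otimes> l)"
    using k by (simp add: trK_pure K.m_lcomm)
next
  fix U V assume UV: "U \<in> carrier P.T" "V \<in> carrier P.T"
  then have "k \<odot>\<^bsub>AK\<^esub> (U \<oplus>\<^bsub>P.T\<^esub> V) = k \<odot>\<^bsub>AK\<^esub> U \<oplus>\<^bsub>P.T\<^esub> k \<odot>\<^bsub>AK\<^esub> V"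
    using k AK.smult_r_distr[of k U V] by simp
  then show "trK (k \<odot>\<^bsub>AK\<^esub> (U \<oplus>\<^bsub>P.T\<^esub> V)) = trK (k \<odot>\<^bsub>AK\<^esub> U) \<oplus>\<^bsub>L\<^esub> trK (k \<odot>\<^bsub>AK\<^esub> V)"
    using k UV AK.smult_closed[of k] by (simp add: trK_add)
next
  fix U V assume "U \<in> carrier P.T" "V \<in> carrier P.T"
  then show "k \<otimes>\<^bsub>L\<^esub> trK (U \<oplus>\<^bsub>P.T\<^esub> V) = k \<otimes>\<^bsub>L\<^esub> trK U \<oplus>\<^bsub>L\<^esub> k \<otimes>\<^bsub>L\<^esub> trK V"
    using k by (simp add: trK_add K.r_distr)
qed (use k AK.smult_closed[of k] in simp_all)

lemma pure_finsum:
  assumes "f \<in> I \<rightarrow> carrier A" "k \<in> carrier L"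
  shows "(\<Oplus>\<^bsub>A\<^esub>i\<in>I. f i) \<otimes>\<otimes> k = (\<Oplus>\<^bsub>AK\<^esub>i\<in>I. f i \<otimes>\<otimes> k)"
  using assms F.finite_I
  by (intro additive_finsum[OF A.A.is_abelian_group AK_abelian_group])
     (simp_all add: P.pure_add_left)

sublocale FK: frobenius_trace L AK trK I "\<lambda>i. X i \<otimes>\<otimes> \<one>\<^bsub>L\<^esub>" "\<lambda>i. Y i \<otimes>\<otimes> \<one>\<^bsub>L\<^esub>"
proof (intro frobenius_trace.intro AK.enveloping_axioms frobenius_trace_axioms.intro)
  fix U assume "U \<in> carrier AK"
  then have U: "U \<in> carrier P.T" by simp
  show "(\<Oplus>\<^bsub>AK\<^esub>i\<in>I. trK (U \<otimes>\<^bsub>AK\<^esub> (Y i \<otimes>\<otimes> \<one>\<^bsub>L\<^esub>)) \<odot>\<^bsub>AK\<^esub> (X i \<otimes>\<otimes> \<one>\<^bsub>L\<^esub>)) = U"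
  proof (rule P.additive_ext[OF AK_abelian_group _ _ _ _ _ U])
    fix a k assume "a \<in> carrier A" "k \<in> carrier K"
    then have a: "a \<in> carrier A" and k: "k \<in> carrier L" by simp_all
    have "(\<Oplus>\<^bsub>AK\<^esub>i\<in>I. trK ((a \<otimes>\<otimes> k) \<otimes>\<^bsub>AK\<^esub> (Y i \<otimes>\<otimes> \<one>\<^bsub>L\<^esub>)) \<odot>\<^bsub>AK\<^esub> (X i \<otimes>\<otimes> \<one>\<^bsub>L\<^esub>)) =
      (\<Oplus>\<^bsub>AK\<^esub>i\<in>I. (tr (a \<otimes>\<^bsub>A\<^esub> Y i) \<odot>\<^bsub>A\<^esub> X i) \<otimes>\<otimes> k)"
      using a k by (intro AK.A.finsum_cong') (simp_all add: trK_pure pure_scalar Pi_iff)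
    also have "\<dots> = (\<Oplus>\<^bsub>A\<^esub>i\<in>I. tr (a \<otimes>\<^bsub>A\<^esub> Y i) \<odot>\<^bsub>A\<^esub> X i) \<otimes>\<otimes> k"
      using a k by (intro pure_finsum[symmetric]) simp_all
    also have "\<dots> = a \<otimes>\<otimes> k"
      using a by (simp add: F.expand_X)
    finally show "(\<Oplus>\<^bsub>AK\<^esub>i\<in>I. trK ((a \<otimes>\<otimes> k) \<otimes>\<^bsub>AK\<^esub> (Y i \<otimes>\<otimes> \<one>\<^bsub>L\<^esub>)) \<odot>\<^bsub>AK\<^esub> (X i \<otimes>\<otimes> \<one>\<^bsub>L\<^esub>)) = a \<otimes>\<otimes> k" .
  next
    fix U V assume UV: "U \<in> carrier P.T" "V \<in> carrier P.T"
    let ?f = "\<lambda>U i. trK (U \<otimes>\<^bsub>AK\<^esub> (Y i \<otimes>\<otimes> \<one>\<^bsub>L\<^esub>)) \<odot>\<^bsub>AK\<^esub> (X i \<otimes>\<otimes> \<one>\<^bsub>L\<^esub>)"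
    have "(\<Oplus>\<^bsub>AK\<^esub>i\<in>I. ?f (U \<oplus>\<^bsub>P.T\<^esub> V) i) = (\<Oplus>\<^bsub>AK\<^esub>i\<in>I. ?f U i \<oplus>\<^bsub>AK\<^esub> ?f V i)"
      using UV by (intro AK.A.finsum_cong') (simp_all add: P.T.l_distr trK_add pure_add_right Pi_iff)
    also have "\<dots> = (\<Oplus>\<^bsub>AK\<^esub>i\<in>I. ?f U i) \<oplus>\<^bsub>AK\<^esub> (\<Oplus>\<^bsub>AK\<^esub>i\<in>I. ?f V i)"
      using UV by (intro AK.A.finsum_addf) (simp_all add: Pi_iff)
    finally show "(\<Oplus>\<^bsub>AK\<^esub>i\<in>I. ?f (U \<oplus>\<^bsub>P.T\<^esub> V) i) = (\<Oplus>\<^bsub>AK\<^esub>i\<in>I. ?f U i) \<oplus>\<^bsub>AK\<^esub> (\<Oplus>\<^bsub>AK\<^esub>i\<in>I. ?f V i)" .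
  next
    fix U assume "U \<in> carrier P.T"
    then show "(\<Oplus>\<^bsub>AK\<^esub>i\<in>I. trK (U \<otimes>\<^bsub>AK\<^esub> (Y i \<otimes>\<otimes> \<one>\<^bsub>L\<^esub>)) \<odot>\<^bsub>AK\<^esub> (X i \<otimes>\<otimes> \<one>\<^bsub>L\<^esub>)) \<in> carrier AK"
      by (intro AK.A.finsum_closed) (simp add: Pi_iff)
  qed simp_all
  show "(\<Oplus>\<^bsub>AK\<^esub>i\<in>I. trK ((X i \<otimes>\<otimes> \<one>\<^bsub>L\<^esub>) \<otimes>\<^bsub>AK\<^esub> U) \<odot>\<^bsub>AK\<^esub> (Y i \<otimes>\<otimes> \<one>\<^bsub>L\<^esub>)) = U"
  proof (rule P.additive_ext[OF AK_abelian_group _ _ _ _ _ U])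
    fix a k assume "a \<in> carrier A" "k \<in> carrier K"
    then have a: "a \<in> carrier A" and k: "k \<in> carrier L" by simp_all
    have "(\<Oplus>\<^bsub>AK\<^esub>i\<in>I. trK ((X i \<otimes>\<otimes> \<one>\<^bsub>L\<^esub>) \<otimes>\<^bsub>AK\<^esub> (a \<otimes>\<otimes> k)) \<odot>\<^bsub>AK\<^esub> (Y i \<otimes>\<otimes> \<one>\<^bsub>L\<^esub>)) =
      (\<Oplus>\<^bsub>AK\<^esub>i\<in>I. (tr (X i \<otimes>\<^bsub>A\<^esub> a) \<odot>\<^bsub>A\<^esub> Y i) \<otimes>\<otimes> k)"
      using a k by (intro AK.A.finsum_cong') (simp_all add: trK_pure pure_scalar Pi_iff)
    also have "\<dots> = (\<Oplus>\<^bsub>A\<^esub>i\<in>I. tr (X i \<otimes>\<^bsub>A\<^esub> a) \<odot>\<^bsub>A\<^esub> Y i) \<otimes>\<otimes> k"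
      using a k by (intro pure_finsum[symmetric]) simp_all
    also have "\<dots> = a \<otimes>\<otimes> k"
      using a by (simp add: F.expand_Y)
    finally show "(\<Oplus>\<^bsub>AK\<^esub>i\<in>I. trK ((X i \<otimes>\<otimes> \<one>\<^bsub>L\<^esub>) \<otimes>\<^bsub>AK\<^esub> (a \<otimes>\<otimes> k)) \<odot>\<^bsub>AK\<^esub> (Y i \<otimes>\<otimes> \<one>\<^bsub>L\<^esub>)) = a \<otimes>\<otimes> k" .
  next
    fix U V assume UV: "U \<in> carrier P.T" "V \<in> carrier P.T"
    let ?f = "\<lambda>U i. trK ((X i \<otimes>\<otimes> \<one>\<^bsub>L\<^esub>) \<otimes>\<^bsub>AK\<^esub> U) \<odot>\<^bsub>AK\<^esub> (Y i \<otimes>\<otimes> \<one>\<^bsub>L\<^esub>)"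
    have "(\<Oplus>\<^bsub>AK\<^esub>i\<in>I. ?f (U \<oplus>\<^bsub>P.T\<^esub> V) i) = (\<Oplus>\<^bsub>AK\<^esub>i\<in>I. ?f U i \<oplus>\<^bsub>AK\<^esub> ?f V i)"
      using UV by (intro AK.A.finsum_cong') (simp_all add: P.T.r_distr trK_add pure_add_right Pi_iff)
    also have "\<dots> = (\<Oplus>\<^bsub>AK\<^esub>i\<in>I. ?f U i) \<oplus>\<^bsub>AK\<^esub> (\<Oplus>\<^bsub>AK\<^esub>i\<in>I. ?f V i)"
      using UV by (intro AK.A.finsum_addf) (simp_all add: Pi_iff)
    finally show "(\<Oplus>\<^bsub>AK\<^esub>i\<in>I. ?f (U \<oplus>\<^bsub>P.T\<^esub> V) i) = (\<Oplus>\<^bsub>AK\<^esub>i\<in>I. ?f U i) \<oplus>\<^bsub>AK\<^esub> (\<Oplus>\<^bsub>AK\<^esub>i\<in>I. ?f V i)" .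
  next
    fix U assume "U \<in> carrier P.T"
    then show "(\<Oplus>\<^bsub>AK\<^esub>i\<in>I. trK ((X i \<otimes>\<otimes> \<one>\<^bsub>L\<^esub>) \<otimes>\<^bsub>AK\<^esub> U) \<odot>\<^bsub>AK\<^esub> (Y i \<otimes>\<otimes> \<one>\<^bsub>L\<^esub>)) \<in> carrier AK"
      by (intro AK.A.finsum_closed) (simp add: Pi_iff)
  qed simp_all
qed (simp_all add: F.finite_I trK_add trK_smult)

lemma casimir_base_change:
  assumes "a \<in> carrier A" "k \<in> carrier L"
  shows "FK.casimir (a \<otimes>\<otimes> k) = F.casimir a \<otimes>\<otimes> k"
proof -
  have "FK.casimir (a \<otimes>\<otimes> k) = (\<Oplus>\<^bsub>AK\<^esub>i\<in>I. (Y i \<otimes>\<^bsub>A\<^esub> a \<otimes>\<^bsub>A\<^esub> X i) \<otimes>\<otimes> k)"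
    unfolding FK.casimir_def using assms by (intro AK.A.finsum_cong') (simp_all add: Pi_iff)
  also have "\<dots> = F.casimir a \<otimes>\<otimes> k"
    unfolding F.casimir_def using assms by (intro pure_finsum[symmetric]) simp_all
  finally show ?thesis .
qed

end


section \<open>Fields of fractions and residue fields\<close>

lemma UN_pairs_const:
  assumes "p \<in> U" "q \<in> V"
    and "\<And>a s b t. (a, s) \<in> U \<Longrightarrow> (b, t) \<in> V \<Longrightarrow> f a s b t = W"
  shows "(\<Union>(a, s)\<in>U. \<Union>(b, t)\<in>V. f a s b t) = W"
proof -
  obtain a s b t where pq: "p = (a, s)" "q = (b, t)"
    by (cases p, cases q)
  have "W \<subseteq> (\<Union>(a, s)\<in>U. \<Union>(b, t)\<in>V. f a s b t)"
    using assms(1,2) assms(3)[of a s b t] by (intro UN_upper[of p U, THEN order_trans[rotated]]) (auto simp: pq)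
  moreover have "(\<Union>(a, s)\<in>U. \<Union>(b, t)\<in>V. f a s b t) \<subseteq> W"
    by (auto simp: assms(3))
  ultimately show ?thesis by (rule equalityI[rotated])
qed

context domain
begin

abbreviation nonzero where "nonzero s \<equiv> s \<in> carrier R - {\<zero>}"

lemma nonzero_mult: "nonzero s \<Longrightarrow> nonzero t \<Longrightarrow> nonzero (s \<otimes> t)"
  by (simp add: integral_iff)

lemma fraction_eq_iff:
  assumes "a \<in> carrier R" "nonzero s" "b \<in> carrier R" "nonzero t"
  shows "fraction R a s = fraction R b t \<longleftrightarrow> a \<otimes> t = b \<otimes> s"
proof
  assume "fraction R a s = fraction R b t"
  moreover have "(b, t) \<in> fraction R b t"
    using assms by (simp add: fraction_def)
  ultimately have "(b, t) \<in> fraction R a s"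
    by simp
  then show "a \<otimes> t = b \<otimes> s"
    by (simp add: fraction_def)
next
  have sub: "fraction R a s \<subseteq> fraction R b t"
    if "a \<in> carrier R" "nonzero s" "b \<in> carrier R" "nonzero t" "a \<otimes> t = b \<otimes> s" for a s b t
  proof
    fix p assume "p \<in> fraction R a s"
    then obtain c w where p: "p = (c, w)" and c: "c \<in> carrier R" and w: "nonzero w"
      and eq: "a \<otimes> w = c \<otimes> s"
      by (auto simp: fraction_def)
    have "s \<otimes> (b \<otimes> w) = (b \<otimes> s) \<otimes> w"
      using that c w by (simp add: m_ac)
    also have "\<dots> = (a \<otimes> w) \<otimes> t"
      using that c w by (simp add: m_ac flip: that(5))
    also have "\<dots> = s \<otimes> (c \<otimes> t)"
      unfolding eq using that c w by (simp add: m_ac)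
    finally have "b \<otimes> w = c \<otimes> t"
      using m_lcancel[of s "b \<otimes> w" "c \<otimes> t"] that c w by simp
    then show "p \<in> fraction R b t"
      using c w by (simp add: fraction_def p)
  qed
  assume "a \<otimes> t = b \<otimes> s"
  then show "fraction R a s = fraction R b t"
    using sub[of a s b t] sub[of b t a s] assms by auto
qed

lemma fraction_memD:
  assumes "(b, t) \<in> fraction R a s" "a \<in> carrier R" "nonzero s"
  shows "b \<in> carrier R" "nonzero t" "a \<otimes> t = b \<otimes> s"
  using assms by (auto simp: fraction_def)

lemma fraction_mem_self: "a \<in> carrier R \<Longrightarrow> nonzero s \<Longrightarrow> (a, s) \<in> fraction R a s"
  by (simp add: fraction_def)

lemma fraction_mult:
  assumes a: "a \<in> carrier R" "nonzero s" and b: "b \<in> carrier R" "nonzero t"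
  shows "fraction R a s \<otimes>\<^bsub>fraction_field R\<^esub> fraction R b t = fraction R (a \<otimes> b) (s \<otimes> t)"
proof -
  have "fraction R (a' \<otimes> b') (s' \<otimes> t') = fraction R (a \<otimes> b) (s \<otimes> t)"
    if "(a', s') \<in> fraction R a s" "(b', t') \<in> fraction R b t" for a' s' b' t'
  proof -
    note m = fraction_memD[OF that(1) a] fraction_memD[OF that(2) b]
    have "(a' \<otimes> b') \<otimes> (s \<otimes> t) = (a' \<otimes> s) \<otimes> (b' \<otimes> t)"
      using a b m(1,2,4,5) by (simp add: m_ac)
    also have "\<dots> = (a \<otimes> s') \<otimes> (b \<otimes> t')"
      unfolding m(3)[symmetric] m(6)[symmetric] ..
    also have "\<dots> = (a \<otimes> b) \<otimes> (s' \<otimes> t')"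
      using a b m(1,2,4,5) by (simp add: m_ac)
    finally show ?thesis
      using a b m nonzero_mult by (subst fraction_eq_iff) auto
  qed
  then show ?thesis
    by (simp add: fraction_field_def UN_pairs_const[OF fraction_mem_self[OF a] fraction_mem_self[OF b]])
qed

lemma fraction_add:
  assumes a: "a \<in> carrier R" "nonzero s" and b: "b \<in> carrier R" "nonzero t"
  shows "fraction R a s \<oplus>\<^bsub>fraction_field R\<^esub> fraction R b t = fraction R (a \<otimes> t \<oplus> b \<otimes> s) (s \<otimes> t)"
proof -
  have "fraction R (a' \<otimes> t' \<oplus> b' \<otimes> s') (s' \<otimes> t') = fraction R (a \<otimes> t \<oplus> b \<otimes> s) (s \<otimes> t)"
    if "(a', s') \<in> fraction R a s" "(b', t') \<in> fraction R b t" for a' s' b' t'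
  proof -
    note m = fraction_memD[OF that(1) a] fraction_memD[OF that(2) b]
    have "(a' \<otimes> t' \<oplus> b' \<otimes> s') \<otimes> (s \<otimes> t) = (a' \<otimes> s) \<otimes> (t \<otimes> t') \<oplus> (b' \<otimes> t) \<otimes> (s \<otimes> s')"
      using a b m(1,2,4,5) by (simp add: l_distr r_distr m_ac)
    also have "\<dots> = (a \<otimes> s') \<otimes> (t \<otimes> t') \<oplus> (b \<otimes> t') \<otimes> (s \<otimes> s')"
      unfolding m(3)[symmetric] m(6)[symmetric] ..
    also have "\<dots> = (a \<otimes> t \<oplus> b \<otimes> s) \<otimes> (s' \<otimes> t')"
      using a b m(1,2,4,5) by (simp add: l_distr r_distr m_ac)
    finally show ?thesis
      using a b m nonzero_mult by (subst fraction_eq_iff) auto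
  qed
  then show ?thesis
    by (simp add: fraction_field_def UN_pairs_const[OF fraction_mem_self[OF a] fraction_mem_self[OF b]])
qed

lemma fraction_closed: "a \<in> carrier R \<Longrightarrow> nonzero s \<Longrightarrow> fraction R a s \<in> carrier (fraction_field R)"
  by (auto simp: fraction_field_def)

lemma fraction_cases:
  assumes "x \<in> carrier (fraction_field R)"
  obtains a s where "x = fraction R a s" "a \<in> carrier R" "nonzero s"
  using assms by (auto simp: fraction_field_def)

lemma fraction_zero: "\<zero>\<^bsub>fraction_field R\<^esub> = fraction R \<zero> \<one>"
  and fraction_one: "\<one>\<^bsub>fraction_field R\<^esub> = fraction R \<one> \<one>"
  by (simp_all add: fraction_field_def)

lemma fraction_field_cring: "cring (fraction_field R)"
proof -
  let ?Q = "fraction_field R"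
  have one: "nonzero \<one>" by simp
  note rules = fraction_mult fraction_add fraction_zero fraction_one fraction_closed fraction_eq_iff
    nonzero_mult integral_iff
  show ?thesis
  proof (rule cringI)
    show "abelian_group ?Q"
    proof (rule abelian_groupI)
      fix x y assume "x \<in> carrier ?Q" "y \<in> carrier ?Q"
      then show "x \<oplus>\<^bsub>?Q\<^esub> y \<in> carrier ?Q"
        by (elim fraction_cases) (simp add: rules)
    next
      show "\<zero>\<^bsub>?Q\<^esub> \<in> carrier ?Q" by (simp add: rules)
    next
      fix x y z assume "x \<in> carrier ?Q" "y \<in> carrier ?Q" "z \<in> carrier ?Q"
      then show "x \<oplus>\<^bsub>?Q\<^esub> y \<oplus>\<^bsub>?Q\<^esub> z = x \<oplus>\<^bsub>?Q\<^esub> (y \<oplus>\<^bsub>?Q\<^esub> z)"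
        by (elim fraction_cases) (simp add: rules l_distr r_distr m_ac a_ac)
    next
      fix x y assume "x \<in> carrier ?Q" "y \<in> carrier ?Q"
      then show "x \<oplus>\<^bsub>?Q\<^esub> y = y \<oplus>\<^bsub>?Q\<^esub> x"
        by (elim fraction_cases) (simp add: rules l_distr r_distr m_ac a_ac)
    next
      fix x assume "x \<in> carrier ?Q"
      then show "\<zero>\<^bsub>?Q\<^esub> \<oplus>\<^bsub>?Q\<^esub> x = x"
        by (elim fraction_cases) (simp add: rules l_distr r_distr m_ac a_ac)
    next
      fix x assume "x \<in> carrier ?Q"
      then obtain a s where x: "x = fraction R a s" "a \<in> carrier R" "nonzero s"
        by (rule fraction_cases)
      then show "\<exists>y\<in>carrier ?Q. y \<oplus>\<^bsub>?Q\<^esub> x = \<zero>\<^bsub>?Q\<^esub>"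
        by (intro bexI[of _ "fraction R (\<ominus> a) s"]) (simp_all add: rules l_minus l_neg)
    qed
    show "comm_monoid ?Q"
    proof (rule comm_monoidI)
      fix x y assume "x \<in> carrier ?Q" "y \<in> carrier ?Q"
      then show "x \<otimes>\<^bsub>?Q\<^esub> y \<in> carrier ?Q"
        by (elim fraction_cases) (simp add: rules)
    next
      show "\<one>\<^bsub>?Q\<^esub> \<in> carrier ?Q" by (simp add: rules)
    next
      fix x y z assume "x \<in> carrier ?Q" "y \<in> carrier ?Q" "z \<in> carrier ?Q"
      then show "x \<otimes>\<^bsub>?Q\<^esub> y \<otimes>\<^bsub>?Q\<^esub> z = x \<otimes>\<^bsub>?Q\<^esub> (y \<otimes>\<^bsub>?Q\<^esub> z)"
        by (elim fraction_cases) (simp add: rules m_ac)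
    next
      fix x assume "x \<in> carrier ?Q"
      then show "\<one>\<^bsub>?Q\<^esub> \<otimes>\<^bsub>?Q\<^esub> x = x"
        by (elim fraction_cases) (simp add: rules)
    next
      fix x y assume "x \<in> carrier ?Q" "y \<in> carrier ?Q"
      then show "x \<otimes>\<^bsub>?Q\<^esub> y = y \<otimes>\<^bsub>?Q\<^esub> x"
        by (elim fraction_cases) (simp add: rules m_ac)
    qed
    fix x y z assume "x \<in> carrier ?Q" "y \<in> carrier ?Q" "z \<in> carrier ?Q"
    then show "(x \<oplus>\<^bsub>?Q\<^esub> y) \<otimes>\<^bsub>?Q\<^esub> z = x \<otimes>\<^bsub>?Q\<^esub> z \<oplus>\<^bsub>?Q\<^esub> y \<otimes>\<^bsub>?Q\<^esub> z"
      by (elim fraction_cases) (simp add: rules l_distr r_distr m_ac a_ac)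
  qed
qed

end

lemma zero_FactRing: "\<zero>\<^bsub>R Quot I\<^esub> = I"
  by (simp add: FactRing_def)

lemma carrier_FactRing: "x \<in> carrier (R Quot I) \<longleftrightarrow> (\<exists>r\<in>carrier R. x = I +>\<^bsub>R\<^esub> r)"
  by (simp add: FactRing_def A_RCOSETS_def')

text \<open>
  The properties of \<open>R \<rightarrow> Q(R/p)\<close> on which the locale \<open>residue_base_change\<close> rests, and the inverses
  that the other direction of the theorem needs.
\<close>

lemma residue_field_fractions:
  fixes R :: "('r, 'l) ring_scheme"
  assumes "cring R" and p: "primeideal p R"
  defines "\<iota> \<equiv> \<lambda>r. fraction (R Quot p) (p +>\<^bsub>R\<^esub> r) \<one>\<^bsub>R Quot p\<^esub>"
  shows "cring (residue_field R p)"
    and "\<iota> \<in> ring_hom R (residue_field R p)"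
    and "\<And>r. r \<in> carrier R \<Longrightarrow> \<iota> r = \<zero>\<^bsub>residue_field R p\<^esub> \<longleftrightarrow> r \<in> p"
    and "\<And>k. k \<in> carrier (residue_field R p) \<Longrightarrow>
      \<exists>r\<in>carrier R. \<exists>s\<in>carrier R - p. k \<otimes>\<^bsub>residue_field R p\<^esub> \<iota> s = \<iota> r"
    and "\<And>r. r \<in> carrier R - p \<Longrightarrow>
      \<exists>k\<in>carrier (residue_field R p). k \<otimes>\<^bsub>residue_field R p\<^esub> \<iota> r = \<one>\<^bsub>residue_field R p\<^esub>"
proof -
  interpret R: cring R by fact
  interpret p: primeideal p R by fact
  interpret D: domain "R Quot p" by (rule p.quotient_is_domain)
  interpret \<pi>: ring_hom_cring R "R Quot p" "\<lambda>r. p +>\<^bsub>R\<^esub> r" by (rule p.rcos_ring_hom_cring)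
  let ?D = "R Quot p" and ?L = "residue_field R p"
  have L: "?L = fraction_field ?D" by (simp add: residue_field_def)
  have one: "D.nonzero \<one>\<^bsub>?D\<^esub>" by simp
  have zero: "\<zero>\<^bsub>?D\<^esub> = p"
    by (rule zero_FactRing)
  have zero_iff: "p +>\<^bsub>R\<^esub> r = \<zero>\<^bsub>?D\<^esub> \<longleftrightarrow> r \<in> p" if r: "r \<in> carrier R" for r
    unfolding zero using p.a_rcos_self[OF r] p.a_rcos_const[of r] by metis
  have nonzero: "D.nonzero (p +>\<^bsub>R\<^esub> s)" if "s \<in> carrier R - p" for s
    using zero_iff[of s] that by simp
  note rules = D.fraction_mult D.fraction_add D.fraction_zero D.fraction_one D.fraction_closed
    D.fraction_eq_iff D.nonzero_mult D.integral_iff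
  show "cring ?L"
    unfolding L by (rule D.fraction_field_cring)
  show "\<iota> \<in> ring_hom R ?L"
    unfolding L by (rule ring_hom_memI) (simp_all add: \<iota>_def rules)
  show "\<iota> r = \<zero>\<^bsub>?L\<^esub> \<longleftrightarrow> r \<in> p" if "r \<in> carrier R" for r
    unfolding L using that zero_iff[OF that] by (simp add: \<iota>_def rules)
  show "\<exists>r\<in>carrier R. \<exists>s\<in>carrier R - p. k \<otimes>\<^bsub>?L\<^esub> \<iota> s = \<iota> r" if kL: "k \<in> carrier ?L" for k
  proof -
    obtain x y where k_eq: "k = fraction ?D x y" and x: "x \<in> carrier ?D" and y: "D.nonzero y"
      by (rule D.fraction_cases[OF kL[unfolded L]])
    obtain r where r: "r \<in> carrier R" "x = p +>\<^bsub>R\<^esub> r"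
      using x unfolding carrier_FactRing by blast
    obtain s where s: "s \<in> carrier R" "y = p +>\<^bsub>R\<^esub> s"
      using y unfolding carrier_FactRing Diff_iff by blast
    have "s \<notin> p"
      using y zero_iff[OF s(1)] s(2) by simp
    moreover have "k \<otimes>\<^bsub>?L\<^esub> \<iota> s = \<iota> r"
      unfolding L k_eq \<iota>_def using x y by (simp add: rules D.m_comm flip: r(2) s(2))
    ultimately show ?thesis
      using r s by blast
  qed
  show "\<exists>k\<in>carrier ?L. k \<otimes>\<^bsub>?L\<^esub> \<iota> r = \<one>\<^bsub>?L\<^esub>" if r: "r \<in> carrier R - p" for r
  proof (rule bexI[of _ "fraction ?D \<one>\<^bsub>?D\<^esub> (p +>\<^bsub>R\<^esub> r)"])
    show "fraction ?D \<one>\<^bsub>?D\<^esub> (p +>\<^bsub>R\<^esub> r) \<otimes>\<^bsub>?L\<^esub> \<iota> r = \<one>\<^bsub>?L\<^esub>"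
      unfolding L using nonzero[OF r] by (simp add: \<iota>_def rules)
    show "fraction ?D \<one>\<^bsub>?D\<^esub> (p +>\<^bsub>R\<^esub> r) \<in> carrier ?L"
      unfolding L using nonzero[OF r] by (intro D.fraction_closed) simp_all
  qed
qed


section \<open>A form of the Nakayama lemma at a prime ideal\<close>

text \<open>
  The hypothesis says that \<open>s x\<^sub>i \<in> N + p M'\<close> for some \<open>s \<notin> p\<close>, where \<open>M'\<close> is spanned by the \<open>x\<^sub>i\<close>.  The
  generators are eliminated one by one: in \<open>s x\<^sub>k = m + \<Sum> c\<^sub>j x\<^sub>j\<close> the coefficient \<open>u = s - c\<^sub>k\<close> is not in \<open>p\<close>,
  and multiplying the other relations by \<open>u\<close> replaces \<open>x\<^sub>k\<close> by the remaining generators.  This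
  uses neither localization nor determinants.
\<close>

lemma (in module) nakayama_prime:
  assumes P: "primeideal P R" and "finite I" and "x \<in> I \<rightarrow> carrier M"
    and NM: "N \<subseteq> carrier M"
    and N_add: "\<And>m n. m \<in> N \<Longrightarrow> n \<in> N \<Longrightarrow> m \<oplus>\<^bsub>M\<^esub> n \<in> N"
    and N_smult: "\<And>r n. r \<in> carrier R \<Longrightarrow> n \<in> N \<Longrightarrow> r \<odot>\<^bsub>M\<^esub> n \<in> N"
    and "\<And>i. i \<in> I \<Longrightarrow> \<exists>s\<in>carrier R - P. \<exists>m\<in>N. \<exists>c\<in>I \<rightarrow> P.
      s \<odot>\<^bsub>M\<^esub> x i = m \<oplus>\<^bsub>M\<^esub> (\<Oplus>\<^bsub>M\<^esub>j\<in>I. c j \<odot>\<^bsub>M\<^esub> x j)"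
  shows "\<exists>q\<in>carrier R - P. \<forall>i\<in>I. q \<odot>\<^bsub>M\<^esub> x i \<in> N"
proof -
  interpret P: primeideal P R by fact
  have P_mult: "r \<otimes> s \<in> carrier R - P" if "r \<in> carrier R - P" "s \<in> carrier R - P" for r s
    using that P.I_prime by auto
  have N_sum: "m \<oplus>\<^bsub>M\<^esub> (\<Oplus>\<^bsub>M\<^esub>j\<in>J. f j) \<in> N" if "finite J" "f \<in> J \<rightarrow> N" "m \<in> N" for f and J :: "'e set" and m
    using that
  proof (induction J arbitrary: m rule: finite_induct)
    case empty
    then show ?case using NM by auto
  next
    case (insert j J)
    then have f: "f j \<in> N" "f \<in> J \<rightarrow> N" by auto
    then have c: "f j \<in> carrier M" "f \<in> J \<rightarrow> carrier M" "m \<in> carrier M"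
      using NM insert.prems by auto
    have "m \<oplus>\<^bsub>M\<^esub> (\<Oplus>\<^bsub>M\<^esub>j\<in>insert j J. f j) = (m \<oplus>\<^bsub>M\<^esub> f j) \<oplus>\<^bsub>M\<^esub> (\<Oplus>\<^bsub>M\<^esub>j\<in>J. f j)"
      using insert.hyps c by (simp add: M.a_assoc)
    also have "\<dots> \<in> N"
      using insert.prems f N_add by (intro insert.IH) auto
    finally show ?case .
  qed
  have smult_sum: "r \<odot>\<^bsub>M\<^esub> (\<Oplus>\<^bsub>M\<^esub>j\<in>J. c j \<odot>\<^bsub>M\<^esub> x j) = (\<Oplus>\<^bsub>M\<^esub>j\<in>J. (r \<otimes> c j) \<odot>\<^bsub>M\<^esub> x j)"
    if "finite J" "x \<in> J \<rightarrow> carrier M" "c \<in> J \<rightarrow> carrier R" "r \<in> carrier R" for r c J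
  proof -
    have "r \<odot>\<^bsub>M\<^esub> (\<Oplus>\<^bsub>M\<^esub>j\<in>J. c j \<odot>\<^bsub>M\<^esub> x j) = (\<Oplus>\<^bsub>M\<^esub>j\<in>J. r \<odot>\<^bsub>M\<^esub> (c j \<odot>\<^bsub>M\<^esub> x j))"
      using that by (intro additive_finsum[OF M.abelian_group_axioms M.abelian_group_axioms])
        (auto simp: smult_r_distr Pi_iff)
    also have "\<dots> = (\<Oplus>\<^bsub>M\<^esub>j\<in>J. (r \<otimes> c j) \<odot>\<^bsub>M\<^esub> x j)"
      using that by (intro M.finsum_cong') (auto simp: smult_assoc1 Pi_iff)
    finally show ?thesis .
  qed
  have Pc: "c \<in> carrier R" if "c \<in> P" for c
    using that P.Icarr by simp
  show ?thesis
    using assms(2,3,7)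
  proof (induction I rule: finite_induct)
    case empty
    have "\<one> \<in> carrier R - P"
      using P.I_notcarr P.one_imp_carrier by auto
    then show ?case by blast
  next
    case (insert k I)
    have xk: "x k \<in> carrier M" and xI: "x \<in> I \<rightarrow> carrier M"
      using insert.prems(1) by auto
    obtain s m c where s: "s \<in> carrier R - P" and m: "m \<in> N" and c: "c \<in> insert k I \<rightarrow> P"
      and sx: "s \<odot>\<^bsub>M\<^esub> x k = m \<oplus>\<^bsub>M\<^esub> (\<Oplus>\<^bsub>M\<^esub>j\<in>insert k I. c j \<odot>\<^bsub>M\<^esub> x j)"
      using insert.prems(2)[of k] by auto
    have mM: "m \<in> carrier M" using m NM by auto
    have ck: "c k \<in> P" "c k \<in> carrier R" and cI: "c \<in> I \<rightarrow> carrier R" "c \<in> I \<rightarrow> P"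
      using c by (auto simp: Pi_iff Pc)
    define u where "u = s \<ominus> c k"
    define S where "S = (\<Oplus>\<^bsub>M\<^esub>j\<in>I. c j \<odot>\<^bsub>M\<^esub> x j)"
    have S: "S \<in> carrier M"
      unfolding S_def using cI xI by (intro M.finsum_closed) auto
    have uR: "u \<in> carrier R" using s ck by (simp add: u_def)
    have "u \<notin> P"
    proof
      assume "u \<in> P"
      then have "u \<oplus> c k \<in> P" using ck by (intro P.a_closed)
      moreover have "u \<oplus> c k = s"
        using s ck by (simp add: u_def R.minus_eq R.a_assoc R.l_neg)
      ultimately show False using s by simp
    qed
    with uR have u: "u \<in> carrier R - P" by simp
    have ux: "u \<odot>\<^bsub>M\<^esub> x k = m \<oplus>\<^bsub>M\<^esub> S"
    proof -
      have "(\<Oplus>\<^bsub>M\<^esub>j\<in>insert k I. c j \<odot>\<^bsub>M\<^esub> x j) = c k \<odot>\<^bsub>M\<^esub> x k \<oplus>\<^bsub>M\<^esub> S"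
        unfolding S_def using insert.hyps xk xI ck cI by (intro M.finsum_insert) auto
      then have "s \<odot>\<^bsub>M\<^esub> x k = (m \<oplus>\<^bsub>M\<^esub> S) \<oplus>\<^bsub>M\<^esub> c k \<odot>\<^bsub>M\<^esub> x k"
        using sx mM S ck xk by (simp add: M.a_ac)
      moreover have "u \<odot>\<^bsub>M\<^esub> x k \<oplus>\<^bsub>M\<^esub> c k \<odot>\<^bsub>M\<^esub> x k = s \<odot>\<^bsub>M\<^esub> x k"
        using s ck xk by (simp add: u_def R.minus_eq R.a_assoc R.l_neg flip: smult_l_distr)
      ultimately show ?thesis
        using M.add.right_cancel[of "c k \<odot>\<^bsub>M\<^esub> x k" "u \<odot>\<^bsub>M\<^esub> x k" "m \<oplus>\<^bsub>M\<^esub> S"] uR xk mM S ck by simp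
    qed
    have step: "\<exists>s\<in>carrier R - P. \<exists>m\<in>N. \<exists>c\<in>I \<rightarrow> P.
      s \<odot>\<^bsub>M\<^esub> x i = m \<oplus>\<^bsub>M\<^esub> (\<Oplus>\<^bsub>M\<^esub>j\<in>I. c j \<odot>\<^bsub>M\<^esub> x j)" if i: "i \<in> I" for i
    proof -
      have xi: "x i \<in> carrier M" using xI i by auto
      obtain t n d where t: "t \<in> carrier R - P" and n: "n \<in> N" and d: "d \<in> insert k I \<rightarrow> P"
        and tx: "t \<odot>\<^bsub>M\<^esub> x i = n \<oplus>\<^bsub>M\<^esub> (\<Oplus>\<^bsub>M\<^esub>j\<in>insert k I. d j \<odot>\<^bsub>M\<^esub> x j)"
        using insert.prems(2)[of i] i by auto
      have nM: "n \<in> carrier M" using n NM by auto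
      have dk: "d k \<in> P" "d k \<in> carrier R" and dI: "d \<in> I \<rightarrow> carrier R" "d \<in> I \<rightarrow> P"
        using d by (auto simp: Pi_iff Pc)
      define S' where "S' = (\<Oplus>\<^bsub>M\<^esub>j\<in>I. d j \<odot>\<^bsub>M\<^esub> x j)"
      have S': "S' \<in> carrier M"
        unfolding S'_def using dI xI by (intro M.finsum_closed) auto
      have "(\<Oplus>\<^bsub>M\<^esub>j\<in>insert k I. d j \<odot>\<^bsub>M\<^esub> x j) = d k \<odot>\<^bsub>M\<^esub> x k \<oplus>\<^bsub>M\<^esub> S'"
        unfolding S'_def using insert.hyps xk xI dk dI by (intro M.finsum_insert) auto
      then have "(u \<otimes> t) \<odot>\<^bsub>M\<^esub> x i = u \<odot>\<^bsub>M\<^esub> (n \<oplus>\<^bsub>M\<^esub> (d k \<odot>\<^bsub>M\<^esub> x k \<oplus>\<^bsub>M\<^esub> S'))"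
        using tx uR t xi by (simp add: smult_assoc1)
      also have "\<dots> = u \<odot>\<^bsub>M\<^esub> n \<oplus>\<^bsub>M\<^esub> (d k \<odot>\<^bsub>M\<^esub> (u \<odot>\<^bsub>M\<^esub> x k) \<oplus>\<^bsub>M\<^esub> u \<odot>\<^bsub>M\<^esub> S')"
        using uR nM dk xk S' by (simp add: smult_r_distr R.m_comm flip: smult_assoc1)
      also have "\<dots> = u \<odot>\<^bsub>M\<^esub> n \<oplus>\<^bsub>M\<^esub> ((d k \<odot>\<^bsub>M\<^esub> m \<oplus>\<^bsub>M\<^esub> d k \<odot>\<^bsub>M\<^esub> S) \<oplus>\<^bsub>M\<^esub> u \<odot>\<^bsub>M\<^esub> S')"
        unfolding ux using mM S dk by (simp add: smult_r_distr)
      also have "\<dots> = (u \<odot>\<^bsub>M\<^esub> n \<oplus>\<^bsub>M\<^esub> d k \<odot>\<^bsub>M\<^esub> m) \<oplus>\<^bsub>M\<^esub> (d k \<odot>\<^bsub>M\<^esub> S \<oplus>\<^bsub>M\<^esub> u \<odot>\<^bsub>M\<^esub> S')"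
        using uR nM dk mM S S' by (simp add: M.a_assoc)
      also have "d k \<odot>\<^bsub>M\<^esub> S \<oplus>\<^bsub>M\<^esub> u \<odot>\<^bsub>M\<^esub> S' = (\<Oplus>\<^bsub>M\<^esub>j\<in>I. (d k \<otimes> c j \<oplus> u \<otimes> d j) \<odot>\<^bsub>M\<^esub> x j)"
      proof -
        have "d k \<odot>\<^bsub>M\<^esub> S \<oplus>\<^bsub>M\<^esub> u \<odot>\<^bsub>M\<^esub> S' =
          (\<Oplus>\<^bsub>M\<^esub>j\<in>I. (d k \<otimes> c j) \<odot>\<^bsub>M\<^esub> x j \<oplus>\<^bsub>M\<^esub> (u \<otimes> d j) \<odot>\<^bsub>M\<^esub> x j)"
          unfolding S_def S'_def smult_sum[OF insert.hyps(1) xI cI(1) dk(2)]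
            smult_sum[OF insert.hyps(1) xI dI(1) uR]
          using xI cI(1) dI(1) dk(2) uR by (intro M.finsum_addf[symmetric]) (simp_all add: Pi_iff)
        also have "\<dots> = (\<Oplus>\<^bsub>M\<^esub>j\<in>I. (d k \<otimes> c j \<oplus> u \<otimes> d j) \<odot>\<^bsub>M\<^esub> x j)"
          using xI cI(1) dI(1) dk(2) uR by (intro M.finsum_cong') (simp_all add: smult_l_distr Pi_iff)
        finally show ?thesis .
      qed
      finally have "(u \<otimes> t) \<odot>\<^bsub>M\<^esub> x i =
        (u \<odot>\<^bsub>M\<^esub> n \<oplus>\<^bsub>M\<^esub> d k \<odot>\<^bsub>M\<^esub> m) \<oplus>\<^bsub>M\<^esub> (\<Oplus>\<^bsub>M\<^esub>j\<in>I. (d k \<otimes> c j \<oplus> u \<otimes> d j) \<odot>\<^bsub>M\<^esub> x j)" .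
      moreover have "u \<odot>\<^bsub>M\<^esub> n \<oplus>\<^bsub>M\<^esub> d k \<odot>\<^bsub>M\<^esub> m \<in> N"
        using uR n dk m by (intro N_add N_smult)
      moreover have "(\<lambda>j. d k \<otimes> c j \<oplus> u \<otimes> d j) \<in> I \<rightarrow> P"
        using dk uR cI dI by (auto intro!: P.I_l_closed)
      ultimately show ?thesis
        using P_mult[OF u t]
        by (intro bexI[of _ "u \<otimes> t"] bexI[of _ "u \<odot>\<^bsub>M\<^esub> n \<oplus>\<^bsub>M\<^esub> d k \<odot>\<^bsub>M\<^esub> m"]
          bexI[of _ "\<lambda>j. d k \<otimes> c j \<oplus> u \<otimes> d j"])
    qed
    obtain q where q: "q \<in> carrier R - P" and qx: "\<And>i. i \<in> I \<Longrightarrow> q \<odot>\<^bsub>M\<^esub> x i \<in> N"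
      using insert.IH[OF xI step] by auto
    have qR: "q \<in> carrier R" using q by simp
    have "(q \<otimes> u) \<odot>\<^bsub>M\<^esub> x i \<in> N" if i: "i \<in> insert k I" for i
    proof (cases "i = k")
      case True
      have "(q \<otimes> u) \<odot>\<^bsub>M\<^esub> x k = q \<odot>\<^bsub>M\<^esub> m \<oplus>\<^bsub>M\<^esub> q \<odot>\<^bsub>M\<^esub> S"
        using qR uR xk ux mM S by (simp add: smult_assoc1 smult_r_distr)
      also have "q \<odot>\<^bsub>M\<^esub> S = (\<Oplus>\<^bsub>M\<^esub>j\<in>I. (q \<otimes> c j) \<odot>\<^bsub>M\<^esub> x j)"
        unfolding S_def by (rule smult_sum[OF insert.hyps(1) xI cI(1) qR])
      also have "(\<Oplus>\<^bsub>M\<^esub>j\<in>I. (q \<otimes> c j) \<odot>\<^bsub>M\<^esub> x j) = (\<Oplus>\<^bsub>M\<^esub>j\<in>I. c j \<odot>\<^bsub>M\<^esub> (q \<odot>\<^bsub>M\<^esub> x j))"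
        using qR xI cI(1) by (intro M.finsum_cong') (auto simp: R.m_comm Pi_iff simp flip: smult_assoc1)
      also have "q \<odot>\<^bsub>M\<^esub> m \<oplus>\<^bsub>M\<^esub> (\<Oplus>\<^bsub>M\<^esub>j\<in>I. c j \<odot>\<^bsub>M\<^esub> (q \<odot>\<^bsub>M\<^esub> x j)) \<in> N"
        using qx cI(1) by (intro N_sum[OF insert.hyps(1)] N_smult[OF qR m]) (simp add: Pi_iff N_smult)
      finally show ?thesis using True by simp
    next
      case False
      with i have "i \<in> I" by simp
      moreover from this have "(q \<otimes> u) \<odot>\<^bsub>M\<^esub> x i = u \<odot>\<^bsub>M\<^esub> (q \<odot>\<^bsub>M\<^esub> x i)"
        using qR uR xI by (subst R.m_comm) (simp_all add: smult_assoc1 Pi_iff)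
      ultimately show ?thesis
        using N_smult[OF uR qx] by simp
    qed
    then show ?case
      using P_mult[OF q u] by blast
  qed
qed


section \<open>Descent of Casimir values from a residue field\<close>

lemma (in trace_base_change) separable_if_casimir_scalar:
  assumes a: "a \<in> carrier A" and r: "r \<in> carrier R" and ca: "F.casimir a = r \<odot>\<^bsub>A\<^esub> \<one>\<^bsub>A\<^esub>"
    and k: "k \<in> carrier L" and inv: "k \<otimes>\<^bsub>L\<^esub> \<iota> r = \<one>\<^bsub>L\<^esub>"
  shows "separable_algebra L AK"
proof (rule FK.separable_if_casimir_one)
  show "a \<otimes>\<otimes> k \<in> carrier AK"
    using a k by simp
  have "FK.casimir (a \<otimes>\<otimes> k) = (r \<odot>\<^bsub>A\<^esub> \<one>\<^bsub>A\<^esub>) \<otimes>\<otimes> k"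
    using casimir_base_change[OF a k] ca by simp
  also have "\<dots> = \<one>\<^bsub>A\<^esub> \<otimes>\<otimes> (k \<otimes>\<^bsub>L\<^esub> \<iota> r)"
    using r k pure_scalar[OF r A.A.one_closed k] K.m_comm[of k "\<iota> r"] by simp
  also have "\<dots> = \<one>\<^bsub>AK\<^esub>"
    using P.pure_one by (simp add: inv)
  finally show "FK.casimir (a \<otimes>\<otimes> k) = \<one>\<^bsub>AK\<^esub>" .
qed

text \<open>
  What is needed of the residue field \<open>L\<close> of \<open>p\<close>: the kernel of \<open>R \<rightarrow> L\<close> is \<open>p\<close>, and all elements
  of \<open>L\<close> are fractions of elements of \<open>R\<close>.
\<close>

locale residue_base_change = trace_base_change R A L \<iota> tr I X Y
  for R :: "('r, 'l) ring_scheme" and A :: "('r, 'a, 'm) module_scheme" and L :: "'k ring"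
    and \<iota> :: "'r \<Rightarrow> 'k" and tr :: "'a \<Rightarrow> 'r" and I :: "'i set" and X Y :: "'i \<Rightarrow> 'a" +
  fixes p :: "'r set"
  assumes prime: "primeideal p R"
    and kernel: "r \<in> carrier R \<Longrightarrow> \<iota> r = \<zero>\<^bsub>L\<^esub> \<longleftrightarrow> r \<in> p"
    and fractions: "k \<in> carrier L \<Longrightarrow> \<exists>r\<in>carrier R. \<exists>s\<in>carrier R - p. k \<otimes>\<^bsub>L\<^esub> \<iota> s = \<iota> r"
begin

notation pure (infixl "\<otimes>\<otimes>" 75)

lemma outside_mult: "r \<in> carrier R - p \<Longrightarrow> s \<in> carrier R - p \<Longrightarrow> r \<otimes>\<^bsub>R\<^esub> s \<in> carrier R - p"
  using primeideal.I_prime[OF prime] by auto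

lemma common_denominator:
  assumes "U \<in> carrier P.T"
  shows "\<exists>a\<in>carrier A. \<exists>s\<in>carrier R - p. \<iota> s \<odot>\<^bsub>AK\<^esub> U = a \<otimes>\<otimes> \<one>\<^bsub>L\<^esub>"
  using assms
proof (induction U rule: P.tensor_induct)
  case (pure a k)
  then have a: "a \<in> carrier A" and k: "k \<in> carrier L" by simp_all
  obtain r s where r: "r \<in> carrier R" and s: "s \<in> carrier R - p" and rs: "k \<otimes>\<^bsub>L\<^esub> \<iota> s = \<iota> r"
    using fractions[OF k] by auto
  have "\<iota> s \<odot>\<^bsub>AK\<^esub> (a \<otimes>\<otimes> k) = a \<otimes>\<otimes> (k \<otimes>\<^bsub>L\<^esub> \<iota> s)"
    using a k s K.m_comm[of k "\<iota> s"] by simp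
  also have "\<dots> = (r \<odot>\<^bsub>A\<^esub> a) \<otimes>\<otimes> \<one>\<^bsub>L\<^esub>"
    using a r pure_scalar[OF r a K.one_closed] by (simp add: rs)
  finally show ?case
    using s A.smult_closed[OF r a] by blast
next
  case (diff U V)
  obtain a s where a: "a \<in> carrier A" and s: "s \<in> carrier R - p" and U: "\<iota> s \<odot>\<^bsub>AK\<^esub> U = a \<otimes>\<otimes> \<one>\<^bsub>L\<^esub>"
    using diff.IH(1) by blast
  obtain b t where b: "b \<in> carrier A" and t: "t \<in> carrier R - p" and V: "\<iota> t \<odot>\<^bsub>AK\<^esub> V = b \<otimes>\<otimes> \<one>\<^bsub>L\<^esub>"
    using diff.IH(2) by blast
  have sR: "s \<in> carrier R" and tR: "t \<in> carrier R" using s t by auto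
  have scale: "\<iota> r \<odot>\<^bsub>AK\<^esub> (c \<otimes>\<otimes> \<one>\<^bsub>L\<^esub>) = (r \<odot>\<^bsub>A\<^esub> c) \<otimes>\<otimes> \<one>\<^bsub>L\<^esub>" if "r \<in> carrier R" "c \<in> carrier A" for r c
    using that by (simp add: pure_scalar)
  have "\<iota> (s \<otimes>\<^bsub>R\<^esub> t) \<odot>\<^bsub>AK\<^esub> U = \<iota> t \<odot>\<^bsub>AK\<^esub> (\<iota> s \<odot>\<^bsub>AK\<^esub> U)"
    using AK.smult_assoc1[of "\<iota> t" "\<iota> s" U] diff(1) sR tR K.m_comm[of "\<iota> s" "\<iota> t"]
    by (simp add: ring_hom_mult[OF \<iota>])
  then have U': "\<iota> (s \<otimes>\<^bsub>R\<^esub> t) \<odot>\<^bsub>AK\<^esub> U = (t \<odot>\<^bsub>A\<^esub> a) \<otimes>\<otimes> \<one>\<^bsub>L\<^esub>"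
    unfolding U scale[OF tR a] .
  have "\<iota> (s \<otimes>\<^bsub>R\<^esub> t) \<odot>\<^bsub>AK\<^esub> V = \<iota> s \<odot>\<^bsub>AK\<^esub> (\<iota> t \<odot>\<^bsub>AK\<^esub> V)"
    using AK.smult_assoc1[of "\<iota> s" "\<iota> t" V] diff(2) sR tR by (simp add: ring_hom_mult[OF \<iota>])
  then have V': "\<iota> (s \<otimes>\<^bsub>R\<^esub> t) \<odot>\<^bsub>AK\<^esub> V = (s \<odot>\<^bsub>A\<^esub> b) \<otimes>\<otimes> \<one>\<^bsub>L\<^esub>"
    unfolding V scale[OF sR b] .
  have "\<iota> (s \<otimes>\<^bsub>R\<^esub> t) \<odot>\<^bsub>AK\<^esub> (U \<ominus>\<^bsub>AK\<^esub> V) =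
      \<iota> (s \<otimes>\<^bsub>R\<^esub> t) \<odot>\<^bsub>AK\<^esub> U \<ominus>\<^bsub>AK\<^esub> \<iota> (s \<otimes>\<^bsub>R\<^esub> t) \<odot>\<^bsub>AK\<^esub> V"
    using diff(1,2) sR tR
    by (intro additive_minus[where h = "\<lambda>U. \<iota> (s \<otimes>\<^bsub>R\<^esub> t) \<odot>\<^bsub>AK\<^esub> U", OF AK_abelian_group AK_abelian_group]
        AK.smult_closed AK.smult_r_distr) simp_all
  also have "\<dots> = (t \<odot>\<^bsub>A\<^esub> a) \<otimes>\<otimes> \<one>\<^bsub>L\<^esub> \<ominus>\<^bsub>AK\<^esub> (s \<odot>\<^bsub>A\<^esub> b) \<otimes>\<otimes> \<one>\<^bsub>L\<^esub>"
    unfolding U' V' ..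
  also have "\<dots> = (t \<odot>\<^bsub>A\<^esub> a \<ominus>\<^bsub>A\<^esub> s \<odot>\<^bsub>A\<^esub> b) \<otimes>\<otimes> \<one>\<^bsub>L\<^esub>"
    using a b sR tR
    by (intro additive_minus[where h = "\<lambda>a. a \<otimes>\<otimes> \<one>\<^bsub>L\<^esub>", OF A.A.is_abelian_group AK_abelian_group, symmetric])
       (simp_all add: P.pure_add_left)
  finally show ?case
    using a b sR tR outside_mult[OF s t]
    by (intro bexI[of _ "t \<odot>\<^bsub>A\<^esub> a \<ominus>\<^bsub>A\<^esub> s \<odot>\<^bsub>A\<^esub> b"] bexI[of _ "s \<otimes>\<^bsub>R\<^esub> t"]) simp_all
qed

text \<open>
  The functional \<open>a \<mapsto> tr(a y)\<close> extends to \<open>A \<otimes> L\<close>, so that its value at an element that vanishes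
  there is in the kernel \<open>p\<close> of \<open>R \<rightarrow> L\<close>.
\<close>

lemma trace_in_prime:
  assumes n: "n \<in> carrier A" and y: "y \<in> carrier A" and zero: "n \<otimes>\<otimes> \<one>\<^bsub>L\<^esub> = \<zero>\<^bsub>P.T\<^esub>"
  shows "tr (n \<otimes>\<^bsub>A\<^esub> y) \<in> p"
proof -
  have "\<iota> (tr (n \<otimes>\<^bsub>A\<^esub> y)) = trK ((n \<otimes>\<otimes> \<one>\<^bsub>L\<^esub>) \<otimes>\<^bsub>P.T\<^esub> (y \<otimes>\<otimes> \<one>\<^bsub>L\<^esub>))"
    using n y by (simp add: trK_pure)
  also have "\<dots> = trK \<zero>\<^bsub>P.T\<^esub>"
    using y by (simp add: zero)
  also have "\<dots> = \<zero>\<^bsub>L\<^esub>"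
    by (rule additive_zero[where h = trK, OF P.T.is_abelian_group L_abelian_group]) (simp_all add: trK_add)
  finally show ?thesis
    using kernel[of "tr (n \<otimes>\<^bsub>A\<^esub> y)"] n y by simp
qed

text \<open>
  Multiplying \<open>u\<close> with \<open>c(u) = 1\<close> by a common denominator \<open>s\<close> gives \<open>c(a) \<otimes> 1 = s 1 \<otimes> 1\<close>.  The
  conclusion says that \<open>s 1 - c(a)\<close> multiplies \<open>A\<close> into \<open>p A\<close>, as the traces are coordinates.
\<close>

lemma casimir_congruence:
  assumes "separable_algebra L AK"
  obtains a s where "a \<in> carrier A" "s \<in> carrier R - p"
    "\<And>y. y \<in> carrier A \<Longrightarrow> tr ((s \<odot>\<^bsub>A\<^esub> \<one>\<^bsub>A\<^esub> \<ominus>\<^bsub>A\<^esub> F.casimir a) \<otimes>\<^bsub>A\<^esub> y) \<in> p"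
proof -
  obtain U where U: "U \<in> carrier AK" and one: "FK.casimir U = \<one>\<^bsub>AK\<^esub>"
    using FK.casimir_one_if_separable[OF assms] .
  obtain a s where a: "a \<in> carrier A" and s: "s \<in> carrier R - p" and aU: "\<iota> s \<odot>\<^bsub>AK\<^esub> U = a \<otimes>\<otimes> \<one>\<^bsub>L\<^esub>"
    using common_denominator[of U] U by auto
  have sR: "s \<in> carrier R" using s by simp
  have "F.casimir a \<otimes>\<otimes> \<one>\<^bsub>L\<^esub> = FK.casimir (\<iota> s \<odot>\<^bsub>AK\<^esub> U)"
    unfolding aU using casimir_base_change[OF a K.one_closed] by simp
  also have "\<dots> = \<iota> s \<odot>\<^bsub>AK\<^esub> \<one>\<^bsub>AK\<^esub>"
    using FK.casimir_smult[of "\<iota> s" U] U sR one by simp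
  also have "\<dots> = (s \<odot>\<^bsub>A\<^esub> \<one>\<^bsub>A\<^esub>) \<otimes>\<otimes> \<one>\<^bsub>L\<^esub>"
    using sR by (simp add: P.pure_one pure_scalar)
  finally have eq: "F.casimir a \<otimes>\<otimes> \<one>\<^bsub>L\<^esub> = (s \<odot>\<^bsub>A\<^esub> \<one>\<^bsub>A\<^esub>) \<otimes>\<otimes> \<one>\<^bsub>L\<^esub>" .
  have "(s \<odot>\<^bsub>A\<^esub> \<one>\<^bsub>A\<^esub> \<ominus>\<^bsub>A\<^esub> F.casimir a) \<otimes>\<otimes> \<one>\<^bsub>L\<^esub> =
      (s \<odot>\<^bsub>A\<^esub> \<one>\<^bsub>A\<^esub>) \<otimes>\<otimes> \<one>\<^bsub>L\<^esub> \<ominus>\<^bsub>P.T\<^esub> F.casimir a \<otimes>\<otimes> \<one>\<^bsub>L\<^esub>"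
    using a sR
    by (intro additive_minus[where h = "\<lambda>a. a \<otimes>\<otimes> \<one>\<^bsub>L\<^esub>", OF A.A.is_abelian_group P.T.is_abelian_group])
       (simp_all add: P.pure_add_left)
  also have "\<dots> = \<zero>\<^bsub>P.T\<^esub>"
    unfolding eq using sR by (simp add: P.T.minus_eq P.T.r_neg)
  finally have "(s \<odot>\<^bsub>A\<^esub> \<one>\<^bsub>A\<^esub> \<ominus>\<^bsub>A\<^esub> F.casimir a) \<otimes>\<otimes> \<one>\<^bsub>L\<^esub> = \<zero>\<^bsub>P.T\<^esub>" .
  then have "tr ((s \<odot>\<^bsub>A\<^esub> \<one>\<^bsub>A\<^esub> \<ominus>\<^bsub>A\<^esub> F.casimir a) \<otimes>\<^bsub>A\<^esub> y) \<in> p" if "y \<in> carrier A" for y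
    using a sR that by (intro trace_in_prime) simp_all
  with a s show thesis by (rule that)
qed

end

text \<open>
  The element \<open>w = c(a)\<close> is central and \<open>s A \<subseteq> w A + p A\<close>, so that \<open>q 1 = w b\<close> for some \<open>q \<notin> p\<close> by
  the Nakayama lemma.  The inverse up to \<open>q\<close> of a central element is central up to \<open>q\<close>:
  \<open>q z b = b w z b = b z w b = q b z\<close>.  Thus \<open>q b\<close> can be moved into the Casimir operator.
\<close>

lemma (in frobenius_trace) casimir_scalar_if_congruence:
  assumes p: "primeideal p R" and a: "a \<in> carrier A" and s: "s \<in> carrier R - p"
    and cong: "\<And>y. y \<in> carrier A \<Longrightarrow> tr ((s \<odot> \<one> \<ominus> casimir a) \<otimes> y) \<in> p"
  shows "\<exists>b\<in>carrier A. \<exists>q\<in>carrier R - p. casimir b = q \<odot> \<one>"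
proof -
  interpret p: primeideal p R by fact
  have sR: "s \<in> carrier R" using s by simp
  define w where "w = casimir a"
  define n where "n = s \<odot> \<one> \<ominus> w"
  have w: "w \<in> carrier A" and n: "n \<in> carrier A"
    using a sR by (simp_all add: w_def n_def)
  have wn: "w \<oplus> n = s \<odot> \<one>"
    using w sR by (simp add: n_def A.minus_eq A.a_comm[of w] A.a_assoc A.l_neg)
  have central: "z \<otimes> w = w \<otimes> z" if "z \<in> carrier A" for z
    using casimir_central[OF a that] by (simp add: w_def)
  \<comment> \<open>The Nakayama lemma is applied to the submodule \<open>w A\<close> and the generators \<open>x\<^sub>i\<close> of \<open>A\<close>.\<close>
  let ?N = "(\<lambda>z. w \<otimes> z) ` carrier A"
  have "\<exists>q\<in>carrier R - p. \<forall>i\<in>I. q \<odot> X i \<in> ?N"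
  proof (rule nakayama_prime[OF p finite_I])
    show "X \<in> I \<rightarrow> carrier A" by simp
    show "?N \<subseteq> carrier A" using w by auto
    show "u \<oplus> v \<in> ?N" if uv: "u \<in> ?N" "v \<in> ?N" for u v
    proof -
      obtain z z' where z: "z \<in> carrier A" "u = w \<otimes> z" and z': "z' \<in> carrier A" "v = w \<otimes> z'"
        using uv by auto
      then have "u \<oplus> v = w \<otimes> (z \<oplus> z')"
        using w by (simp add: A.r_distr)
      then show ?thesis using z z' by auto
    qed
    show "r \<odot> u \<in> ?N" if r: "r \<in> carrier R" and u: "u \<in> ?N" for r u
    proof -
      obtain z where z: "z \<in> carrier A" "u = w \<otimes> z"
        using u by auto
      then have "r \<odot> u = w \<otimes> (r \<odot> z)"
        using w r by (simp add: smult_mult_right)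
      then show ?thesis using z r by auto
    qed
    fix i assume i: "i \<in> I"
    define c where "c j = tr (n \<otimes> X i \<otimes> Y j)" for j
    have "c \<in> I \<rightarrow> p"
      using cong[of "X i \<otimes> Y _"] i n w by (auto simp: c_def n_def w_def A.m_assoc)
    moreover have "s \<odot> X i = w \<otimes> X i \<oplus> (\<Oplus>j\<in>I. c j \<odot> X j)"
    proof -
      have "s \<odot> X i = (s \<odot> \<one>) \<otimes> X i"
        using i sR by (simp add: smult_mult_left)
      also have "\<dots> = w \<otimes> X i \<oplus> n \<otimes> X i"
        using i w n by (simp add: A.l_distr flip: wn)
      also have "n \<otimes> X i = (\<Oplus>j\<in>I. c j \<odot> X j)"
        using expand_X[of "n \<otimes> X i"] i n by (simp add: c_def)
      finally show ?thesis .
    qed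
    ultimately show "\<exists>s\<in>carrier R - p. \<exists>m\<in>?N. \<exists>c\<in>I \<rightarrow> p. s \<odot> X i = m \<oplus> (\<Oplus>j\<in>I. c j \<odot> X j)"
      using i by (intro bexI[OF _ s] bexI[of _ "w \<otimes> X i"] bexI[of _ c]) simp_all
  qed
  then obtain q z where q: "q \<in> carrier R - p" and z: "\<And>i. i \<in> I \<Longrightarrow> z i \<in> carrier A"
    and qX: "\<And>i. i \<in> I \<Longrightarrow> q \<odot> X i = w \<otimes> z i"
    by (auto simp: image_iff) metis
  have qR: "q \<in> carrier R" using q by simp
  define b where "b = (\<Oplus>i\<in>I. tr (Y i) \<odot> z i)"
  have b: "b \<in> carrier A"
    unfolding b_def using z by (intro A.finsum_closed) simp
  have wb: "w \<otimes> b = q \<odot> \<one>"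
  proof -
    have "w \<otimes> b = (\<Oplus>i\<in>I. w \<otimes> (tr (Y i) \<odot> z i))"
      unfolding b_def using w z finite_I by (intro A.finsum_rdistr) auto
    also have "\<dots> = (\<Oplus>i\<in>I. q \<odot> (tr (\<one> \<otimes> Y i) \<odot> X i))"
    proof (rule A.finsum_cong')
      fix i assume i: "i \<in> I"
      have "w \<otimes> (tr (Y i) \<odot> z i) = tr (Y i) \<odot> (q \<odot> X i)"
        using i w z by (simp add: qX smult_mult_right)
      also have "\<dots> = q \<odot> (tr (\<one> \<otimes> Y i) \<odot> X i)"
        using i qR R.m_comm[of q "tr (Y i)"] by (simp flip: smult_assoc1)
      finally show "w \<otimes> (tr (Y i) \<odot> z i) = q \<odot> (tr (\<one> \<otimes> Y i) \<odot> X i)" .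
    qed (use qR in auto)
    also have "\<dots> = q \<odot> (\<Oplus>i\<in>I. tr (\<one> \<otimes> Y i) \<odot> X i)"
      using qR finite_I
      by (intro additive_finsum[where h = "\<lambda>a. q \<odot> a", OF A.is_abelian_group A.is_abelian_group, symmetric])
        (auto simp: smult_r_distr)
    also have "\<dots> = q \<odot> \<one>"
      by (simp only: expand_X[OF A.one_closed])
    finally show ?thesis .
  qed
  \<comment> \<open>From here on \<open>b\<close> plays the role of an inverse of the central element \<open>w\<close>, up to the factor \<open>q\<close>.\<close>
  have bw: "b \<otimes> w = q \<odot> \<one>"
    using central[OF b] wb by simp
  have qb_central: "z \<otimes> (q \<odot> b) = (q \<odot> b) \<otimes> z" if z: "z \<in> carrier A" for z
  proof -
    have "z \<otimes> (q \<odot> b) = ((q \<odot> \<one>) \<otimes> z) \<otimes> b"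
      using z b qR by (simp add: smult_mult_left smult_mult_right)
    also have "\<dots> = b \<otimes> (w \<otimes> z) \<otimes> b"
      using z b w by (simp add: A.m_assoc flip: bw)
    also have "\<dots> = b \<otimes> (z \<otimes> w) \<otimes> b"
      using central[OF z] by simp
    also have "\<dots> = (b \<otimes> z) \<otimes> (w \<otimes> b)"
      using z b w by (simp add: A.m_assoc)
    also have "\<dots> = (q \<odot> b) \<otimes> z"
      unfolding wb using z b qR by (simp add: smult_mult_left smult_mult_right)
    finally show ?thesis .
  qed
  have "casimir (a \<otimes> (q \<odot> b)) = w \<otimes> (q \<odot> b)"
    unfolding w_def using a b qR qb_central by (intro casimir_mult_central[symmetric]) auto
  also have "\<dots> = (q \<otimes>\<^bsub>R\<^esub> q) \<odot> \<one>"
    using w b qR by (simp add: smult_mult_right wb smult_assoc1)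
  finally have "casimir (a \<otimes> (q \<odot> b)) = (q \<otimes>\<^bsub>R\<^esub> q) \<odot> \<one>" .
  moreover have "q \<otimes>\<^bsub>R\<^esub> q \<in> carrier R - p"
    using q p.I_prime by auto
  ultimately show ?thesis
    using a b qR by (intro bexI[of _ "a \<otimes> (q \<odot> b)"] bexI[of _ "q \<otimes>\<^bsub>R\<^esub> q"]) simp_all
qed


section \<open>Frobenius forms and their traces\<close>

locale frobenius_setup = enveloping R A
  for R :: "('r, 'l) ring_scheme" and A :: "('r, 'a, 'm) module_scheme" (structure) +
  fixes \<beta> :: "'a \<Rightarrow> 'a \<Rightarrow> 'r"
  assumes fg: "fin_gen_module R A" and proj: "projective_module R A" and form: "frobenius_form R A \<beta>"
begin

lemma \<beta>_left: "y \<in> carrier A \<Longrightarrow> (\<lambda>x\<in>carrier A. \<beta> x y) \<in> linear_maps R A (regular_module R)"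
  and \<beta>_right: "x \<in> carrier A \<Longrightarrow> (\<lambda>y\<in>carrier A. \<beta> x y) \<in> linear_maps R A (regular_module R)"
  using form unfolding frobenius_form_def bilinear_form_def by simp_all

lemma \<beta>_closed [simp]: "x \<in> carrier A \<Longrightarrow> y \<in> carrier A \<Longrightarrow> \<beta> x y \<in> carrier R"
  using linear_mapsD(1)[OF \<beta>_left, of y x] by simp

lemma \<beta>_add_left: "x \<in> carrier A \<Longrightarrow> x' \<in> carrier A \<Longrightarrow> y \<in> carrier A \<Longrightarrow> \<beta> (x \<oplus> x') y = \<beta> x y \<oplus>\<^bsub>R\<^esub> \<beta> x' y"
  using linear_mapsD(2)[OF \<beta>_left, of y x x'] by simp

lemma \<beta>_smult_left: "r \<in> carrier R \<Longrightarrow> x \<in> carrier A \<Longrightarrow> y \<in> carrier A \<Longrightarrow> \<beta> (r \<odot> x) y = r \<otimes>\<^bsub>R\<^esub> \<beta> x y"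
  using linear_mapsD(3)[OF \<beta>_left, of y r x] by simp

lemma \<beta>_add_right: "x \<in> carrier A \<Longrightarrow> y \<in> carrier A \<Longrightarrow> y' \<in> carrier A \<Longrightarrow> \<beta> x (y \<oplus> y') = \<beta> x y \<oplus>\<^bsub>R\<^esub> \<beta> x y'"
  using linear_mapsD(2)[OF \<beta>_right, of x y y'] by simp

lemma \<beta>_smult_right: "r \<in> carrier R \<Longrightarrow> x \<in> carrier A \<Longrightarrow> y \<in> carrier A \<Longrightarrow> \<beta> x (r \<odot> y) = r \<otimes>\<^bsub>R\<^esub> \<beta> x y"
  using linear_mapsD(3)[OF \<beta>_right, of x r y] by simp

lemma \<beta>_assoc: "x \<in> carrier A \<Longrightarrow> y \<in> carrier A \<Longrightarrow> z \<in> carrier A \<Longrightarrow> \<beta> (x \<otimes> y) z = \<beta> x (y \<otimes> z)"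
  using form unfolding frobenius_form_def by simp

lemma \<beta>_left_inject:
  assumes "x \<in> carrier A" "x' \<in> carrier A" "\<And>y. y \<in> carrier A \<Longrightarrow> \<beta> x y = \<beta> x' y"
  shows "x = x'"
proof -
  have "inj_on (\<lambda>a. \<lambda>x\<in>carrier A. \<beta> a x) (carrier A)"
    using form unfolding frobenius_form_def bij_betw_def by blast
  moreover have "(\<lambda>y\<in>carrier A. \<beta> x y) = (\<lambda>y\<in>carrier A. \<beta> x' y)"
    using assms(3) by (rule restrict_ext)
  ultimately show ?thesis
    using assms(1,2) by (rule inj_onD)
qed

lemma \<beta>_sum_left:
  assumes "finite I" "\<And>i. i \<in> I \<Longrightarrow> c i \<in> carrier R" "\<And>i. i \<in> I \<Longrightarrow> x i \<in> carrier A" "y \<in> carrier A"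
  shows "\<beta> (\<Oplus>i\<in>I. c i \<odot> x i) y = (\<Oplus>\<^bsub>R\<^esub>i\<in>I. c i \<otimes>\<^bsub>R\<^esub> \<beta> (x i) y)"
proof -
  have "\<beta> (\<Oplus>i\<in>I. c i \<odot> x i) y = (\<Oplus>\<^bsub>R\<^esub>i\<in>I. \<beta> (c i \<odot> x i) y)"
    using assms by (intro additive_finsum[where h = "\<lambda>a. \<beta> a y", OF A.is_abelian_group R.is_abelian_group])
      (auto simp: \<beta>_add_left)
  also have "\<dots> = (\<Oplus>\<^bsub>R\<^esub>i\<in>I. c i \<otimes>\<^bsub>R\<^esub> \<beta> (x i) y)"
    using assms by (intro R.finsum_cong') (auto simp: \<beta>_smult_left)
  finally show ?thesis .
qed

lemma \<beta>_sum_right: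
  assumes "finite I" "\<And>i. i \<in> I \<Longrightarrow> c i \<in> carrier R" "\<And>i. i \<in> I \<Longrightarrow> x i \<in> carrier A" "y \<in> carrier A"
  shows "\<beta> y (\<Oplus>i\<in>I. c i \<odot> x i) = (\<Oplus>\<^bsub>R\<^esub>i\<in>I. c i \<otimes>\<^bsub>R\<^esub> \<beta> y (x i))"
proof -
  have "\<beta> y (\<Oplus>i\<in>I. c i \<odot> x i) = (\<Oplus>\<^bsub>R\<^esub>i\<in>I. \<beta> y (c i \<odot> x i))"
    using assms by (intro additive_finsum[where h = "\<lambda>a. \<beta> y a", OF A.is_abelian_group R.is_abelian_group])
      (auto simp: \<beta>_add_right)
  also have "\<dots> = (\<Oplus>\<^bsub>R\<^esub>i\<in>I. c i \<otimes>\<^bsub>R\<^esub> \<beta> y (x i))"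
    using assms by (intro R.finsum_cong') (auto simp: \<beta>_smult_right)
  finally show ?thesis .
qed

text \<open>
  The linear forms of a dual basis of the module \<open>A\<close> are all of the form \<open>\<beta>(b, -)\<close>.
\<close>

lemma right_expansion:
  obtains n x b where "\<And>i. i \<in> {1..n::nat} \<Longrightarrow> x i \<in> carrier A" "\<And>i. i \<in> {1..n} \<Longrightarrow> b i \<in> carrier A"
    and "\<And>a. a \<in> carrier A \<Longrightarrow> (\<Oplus>i\<in>{1..n}. \<beta> (b i) a \<odot> x i) = a"
proof -
  obtain n x f where x: "\<And>i. i \<in> {1..n::nat} \<Longrightarrow> x i \<in> carrier A"
    and f: "\<And>i. i \<in> {1..n} \<Longrightarrow> f i \<in> linear_maps R A (regular_module R)"
    and expand: "\<And>a. a \<in> carrier A \<Longrightarrow> (\<Oplus>i\<in>{1..n}. f i a \<odot> x i) = a"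
    using dual_basis[OF fg proj] by blast
  have "\<exists>b\<in>carrier A. f i = (\<lambda>a\<in>carrier A. \<beta> b a)" if "i \<in> {1..n}" for i
    using f[OF that] form unfolding frobenius_form_def bij_betw_def by blast
  then obtain b where b: "\<And>i. i \<in> {1..n} \<Longrightarrow> b i \<in> carrier A"
    and fb: "\<And>i. i \<in> {1..n} \<Longrightarrow> f i = (\<lambda>a\<in>carrier A. \<beta> (b i) a)"
    by metis
  have "(\<Oplus>i\<in>{1..n}. \<beta> (b i) a \<odot> x i) = a" if a: "a \<in> carrier A" for a
  proof -
    have "(\<Oplus>i\<in>{1..n}. \<beta> (b i) a \<odot> x i) = (\<Oplus>i\<in>{1..n}. f i a \<odot> x i)"
      using a b x by (intro A.finsum_cong') (auto simp: fb)
    then show ?thesis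
      using expand[OF a] by simp
  qed
  then show thesis
    using that x b by blast
qed

text \<open>
  A Frobenius form is nonsingular on the left by definition.  It is so on the right, since the
  elements of \<open>A\<close> are determined by the values of the functionals \<open>\<beta>(b, -)\<close>, by projectivity.
\<close>

lemma \<beta>_right_inject:
  assumes "y \<in> carrier A" "y' \<in> carrier A" "\<And>x. x \<in> carrier A \<Longrightarrow> \<beta> x y = \<beta> x y'"
  shows "y = y'"
proof -
  obtain n x b where "\<And>i. i \<in> {1..n::nat} \<Longrightarrow> x i \<in> carrier A" and b: "\<And>i. i \<in> {1..n} \<Longrightarrow> b i \<in> carrier A"
    and expand: "\<And>a. a \<in> carrier A \<Longrightarrow> (\<Oplus>i\<in>{1..n}. \<beta> (b i) a \<odot> x i) = a"
    by (rule right_expansion) (rule that)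
  then have "(\<Oplus>i\<in>{1..n}. \<beta> (b i) y \<odot> x i) = (\<Oplus>i\<in>{1..n}. \<beta> (b i) y' \<odot> x i)"
    using assms by (intro A.finsum_cong') auto
  then show ?thesis
    using expand assms(1,2) by simp
qed

text \<open>
  Swapping the two families of \<open>right_expansion\<close> gives dual bases:
  \<open>\<beta>(a, c) = \<Sum> \<beta>(b\<^sub>i, c) \<beta>(a, x\<^sub>i)\<close> for all \<open>c\<close>, so that \<open>a = \<Sum> \<beta>(a, x\<^sub>i) b\<^sub>i\<close> by nonsingularity.
\<close>

lemma dual_bases_exist:
  obtains n x y where "dual_bases A \<beta> n x y"
proof -
  obtain n x b where x: "\<And>i. i \<in> {1..n::nat} \<Longrightarrow> x i \<in> carrier A" and b: "\<And>i. i \<in> {1..n} \<Longrightarrow> b i \<in> carrier A"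
    and expand: "\<And>a. a \<in> carrier A \<Longrightarrow> (\<Oplus>i\<in>{1..n}. \<beta> (b i) a \<odot> x i) = a"
    by (rule right_expansion) (rule that)
  have "a = (\<Oplus>i\<in>{1..n}. \<beta> a (x i) \<odot> b i)" if a: "a \<in> carrier A" for a
  proof (rule \<beta>_left_inject[OF a])
    fix c assume c: "c \<in> carrier A"
    have "\<beta> a c = \<beta> a (\<Oplus>i\<in>{1..n}. \<beta> (b i) c \<odot> x i)"
      using expand[OF c] by simp
    also have "\<dots> = (\<Oplus>\<^bsub>R\<^esub>i\<in>{1..n}. \<beta> (b i) c \<otimes>\<^bsub>R\<^esub> \<beta> a (x i))"
      using a b c x by (intro \<beta>_sum_right) auto
    also have "\<dots> = (\<Oplus>\<^bsub>R\<^esub>i\<in>{1..n}. \<beta> a (x i) \<otimes>\<^bsub>R\<^esub> \<beta> (b i) c)"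
      using a b c x by (intro R.finsum_cong') (auto intro: R.m_comm)
    also have "\<dots> = \<beta> (\<Oplus>i\<in>{1..n}. \<beta> a (x i) \<odot> b i) c"
      using a b c x by (intro \<beta>_sum_left[symmetric]) auto
    finally show "\<beta> a c = \<beta> (\<Oplus>i\<in>{1..n}. \<beta> a (x i) \<odot> b i) c" .
  qed (use a b x in \<open>auto intro!: A.finsum_closed\<close>)
  then have "dual_bases A \<beta> n b x"
    unfolding dual_bases_def using x b by auto
  then show thesis by (rule that)
qed

text \<open>
  The second expansion \<open>a = \<Sum> \<beta>(x\<^sub>i, a) y\<^sub>i\<close> follows from the first, applied to the left argument
  of \<open>\<beta>(c, a)\<close>, because \<open>\<beta>\<close> is nonsingular on the right as well.
\<close>

lemma frobenius_trace_of_dual_bases: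
  assumes "dual_bases A \<beta> n x y"
  shows "frobenius_trace R A (\<lambda>a. \<beta> a \<one>) {1..n} x y"
proof -
  have x: "x i \<in> carrier A" and y: "y i \<in> carrier A" if "i \<in> {1..n}" for i
    using assms that unfolding dual_bases_def by auto
  have expand: "(\<Oplus>i\<in>{1..n}. \<beta> a (y i) \<odot> x i) = a" if "a \<in> carrier A" for a
    using assms that unfolding dual_bases_def by simp
  have expand': "(\<Oplus>i\<in>{1..n}. \<beta> (x i) a \<odot> y i) = a" if a: "a \<in> carrier A" for a
  proof (rule \<beta>_right_inject[OF _ a])
    fix c assume c: "c \<in> carrier A"
    have "\<beta> c (\<Oplus>i\<in>{1..n}. \<beta> (x i) a \<odot> y i) = (\<Oplus>\<^bsub>R\<^esub>i\<in>{1..n}. \<beta> (x i) a \<otimes>\<^bsub>R\<^esub> \<beta> c (y i))"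
      using a c x y by (intro \<beta>_sum_right) auto
    also have "\<dots> = (\<Oplus>\<^bsub>R\<^esub>i\<in>{1..n}. \<beta> c (y i) \<otimes>\<^bsub>R\<^esub> \<beta> (x i) a)"
      using a c x y by (intro R.finsum_cong') (auto intro: R.m_comm)
    also have "\<dots> = \<beta> (\<Oplus>i\<in>{1..n}. \<beta> c (y i) \<odot> x i) a"
      using a c x y by (intro \<beta>_sum_left[symmetric]) auto
    also have "\<dots> = \<beta> c a"
      using expand[OF c] by simp
    finally show "\<beta> c (\<Oplus>i\<in>{1..n}. \<beta> (x i) a \<odot> y i) = \<beta> c a" .
  qed (use a x y in \<open>auto intro!: A.finsum_closed\<close>)
  show ?thesis
  proof (intro frobenius_trace.intro enveloping_axioms frobenius_trace_axioms.intro)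
    fix a assume a: "a \<in> carrier A"
    have "(\<Oplus>i\<in>{1..n}. \<beta> (a \<otimes> y i) \<one> \<odot> x i) = (\<Oplus>i\<in>{1..n}. \<beta> a (y i) \<odot> x i)"
      using a x y by (intro A.finsum_cong') (auto simp: \<beta>_assoc)
    then show "(\<Oplus>i\<in>{1..n}. \<beta> (a \<otimes> y i) \<one> \<odot> x i) = a"
      using expand[OF a] by simp
    have "(\<Oplus>i\<in>{1..n}. \<beta> (x i \<otimes> a) \<one> \<odot> y i) = (\<Oplus>i\<in>{1..n}. \<beta> (x i) a \<odot> y i)"
      using a x y by (intro A.finsum_cong') (auto simp: \<beta>_assoc)
    then show "(\<Oplus>i\<in>{1..n}. \<beta> (x i \<otimes> a) \<one> \<odot> y i) = a"
      using expand'[OF a] by simp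
  qed (use x y in \<open>simp_all add: \<beta>_add_left \<beta>_smult_left\<close>)
qed

end


section \<open>The separability locus\<close>

text \<open>
  Necessity holds for any choice of a Frobenius form and dual bases.  Sufficiency starts from those
  that represent a given element of \<open>c(A) \<inter> R\<close>, which is why the base change is set up for all of them.
\<close>

lemma separable_residue_field_iff:
  fixes R :: "('r, 'l) ring_scheme" and A :: "('r, 'a, 'm) module_scheme"
  assumes "cring R" and frob: "frobenius_algebra R A" and p: "primeideal p R"
  shows "separable_algebra (residue_field R p) (base_change R A (residue_algebra R p)) \<longleftrightarrow>
    \<not> contraction R A (casimir_ideal R A) \<subseteq> p"
proof -
  let ?L = "residue_field R p"
  define \<iota> where "\<iota> r = fraction (R Quot p) (p +>\<^bsub>R\<^esub> r) \<one>\<^bsub>R Quot p\<^esub>" for r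
  note facts = residue_field_fractions[OF \<open>cring R\<close> p, folded \<iota>_def]
  have extend: "ring.extend ?L \<lparr>smult = \<lambda>r k. \<iota> r \<otimes>\<^bsub>?L\<^esub> k\<rparr> = residue_algebra R p"
    by (simp add: residue_algebra_def \<iota>_def)
  have A: "assoc_algebra R A" and fg: "fin_gen_module R A" and proj: "projective_module R A"
    using frob unfolding frobenius_algebra_def by auto
  have residue: "residue_base_change R A ?L \<iota> (\<lambda>a. \<beta> a \<one>\<^bsub>A\<^esub>) {1..n} x y p"
    if "frobenius_form R A \<beta>" "dual_bases A \<beta> n x y" for \<beta> n x y
  proof -
    interpret frobenius_setup R A \<beta>
      by (intro frobenius_setup.intro enveloping.intro frobenius_setup_axioms.intro A fg proj that(1))
    show ?thesis
      by (intro residue_base_change.intro trace_base_change.intro base_change_setup.intro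
          base_change_setup_axioms.intro trace_base_change_axioms.intro residue_base_change_axioms.intro
          A facts p frobenius_trace_of_dual_bases that assoc_algebra_of_hom \<open>cring R\<close>)
  qed
  show ?thesis
  proof
    assume sep: "separable_algebra ?L (base_change R A (residue_algebra R p))"
    obtain \<beta> where \<beta>: "frobenius_form R A \<beta>"
      using frob unfolding frobenius_algebra_def by auto
    interpret frobenius_setup R A \<beta>
      by (intro frobenius_setup.intro enveloping.intro frobenius_setup_axioms.intro A fg proj \<beta>)
    obtain n x y where xy: "dual_bases A \<beta> n x y"
      by (rule dual_bases_exist)
    interpret B: residue_base_change R A ?L \<iota> "\<lambda>a. \<beta> a \<one>\<^bsub>A\<^esub>" "{1..n}" x y p
      by (rule residue[OF \<beta> xy])
    obtain b q where b: "b \<in> carrier A" and q: "q \<in> carrier R - p" and bq: "B.F.casimir b = q \<odot>\<^bsub>A\<^esub> \<one>\<^bsub>A\<^esub>"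
      using B.casimir_congruence[unfolded extend, OF sep] B.F.casimir_scalar_if_congruence[OF p] by metis
    have "B.F.casimir b = casimir_operator A n x y b"
      unfolding B.F.casimir_def casimir_operator_def ..
    then have "q \<odot>\<^bsub>A\<^esub> \<one>\<^bsub>A\<^esub> \<in> casimir_operator A n x y ` carrier A"
      using b bq by (metis imageI)
    then have "q \<in> contraction R A (casimir_ideal R A)"
      using \<beta> xy q unfolding contraction_def casimir_ideal_def by blast
    then show "\<not> contraction R A (casimir_ideal R A) \<subseteq> p"
      using q by blast
  next
    assume "\<not> contraction R A (casimir_ideal R A) \<subseteq> p"
    then obtain r where r: "r \<in> carrier R - p" and "r \<odot>\<^bsub>A\<^esub> \<one>\<^bsub>A\<^esub> \<in> casimir_ideal R A"
      unfolding contraction_def by blast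
    then obtain \<beta> n x y a where \<beta>: "frobenius_form R A \<beta>" and xy: "dual_bases A \<beta> n x y"
      and a: "a \<in> carrier A" and ra: "r \<odot>\<^bsub>A\<^esub> \<one>\<^bsub>A\<^esub> = casimir_operator A n x y a"
      unfolding casimir_ideal_def by blast
    interpret B: residue_base_change R A ?L \<iota> "\<lambda>a. \<beta> a \<one>\<^bsub>A\<^esub>" "{1..n}" x y p
      by (rule residue[OF \<beta> xy])
    obtain k where k: "k \<in> carrier ?L" "k \<otimes>\<^bsub>?L\<^esub> \<iota> r = \<one>\<^bsub>?L\<^esub>"
      using facts(5)[OF r] by blast
    have "B.F.casimir a = r \<odot>\<^bsub>A\<^esub> \<one>\<^bsub>A\<^esub>"
      unfolding B.F.casimir_def ra casimir_operator_def ..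
    then show "separable_algebra ?L (base_change R A (residue_algebra R p))"
      using B.separable_if_casimir_scalar[unfolded extend] a r k by blast
  qed
qed

theorem proposition6:
  fixes R :: "('r, 'l) ring_scheme" and A :: "('r, 'a, 'm) module_scheme"
  assumes "cring R"
    and "frobenius_algebra R A"
  shows "separability_locus R A =
      Spec R - vanishing_set R (contraction R A (casimir_ideal R A)) \<and>
      Spec R - vanishing_set R (contraction R A (casimir_ideal R A)) =
      {P \<in> Spec R. \<not> contraction R A (casimir_ideal R A) \<subseteq> P}"
proof
  show eq: "Spec R - vanishing_set R (contraction R A (casimir_ideal R A)) =
      {P \<in> Spec R. \<not> contraction R A (casimir_ideal R A) \<subseteq> P}"
    by (auto simp: vanishing_set_def)
  show "separability_locus R A = Spec R - vanishing_set R (contraction R A (casimir_ideal R A))"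
    unfolding eq unfolding separability_locus_def Spec_def
    using separable_residue_field_iff[OF assms] by (simp cong: conj_cong)
qed

end
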